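(* Let $(R,\mathfrak{m},k)$ be a Gorenstein local domain of dimension one with quotient field $K$ and integral closure $\overline{R}$ in $K$. Let $E=\operatorname{End}_R(\mathfrak{m})$, viewed as the ring $E=\{\alpha\in K \mid \alpha\mathfrak{m}\subseteq\mathfrak{m}\}$, so that $R\subseteq E\subseteq\overline{R}$. Assume that there exist finitely generated $R$-modules $M$ and $N$, neither of them free, such that $M\otimes_R N$ is torsion-free. Then $E$ is a local ring, and the inclusion $R\to E$ induces a bijection on residue fields.
   Context: Rings are commutative and Noetherian; $(R,\mathfrak{m},k)$ denotes a local ring $R$ with maximal ideal $\mathfrak{m}$ and residue field $k=R/\mathfrak{m}$. An $R$-module $X$ is torsion-free if no non-zero element of $X$ is killed by a regular element (non-zero-divisor) of $R$; for a domain $R$ this means no non-zero element of $X$ is killed by a non-zero element of $R$. The zero module is considered free (of rank $0$). The identification of $\operatorname{End}_R(\mathfrak{m})$ with $\{\alpha\in K\mid \alpha\mathfrak{m}\subseteq\mathfrak{m}\}$ sends $\varphi$ to $\frac{1}{a}\varphi(a)$, where $a$ is any fixed non-zero element of $\mathfrak{m}$ (the result does not depend on $a$). *)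

theory Defs
  imports "HOL-Algebra.Algebra" "HOL-Library.Extended_Nat"
begin

section \<open>Rings\<close>

text \<open>All rings are commutative and Noetherian, so a local ring is Noetherian by definition.\<close>

definition local_ring :: "('a, 'b) ring_scheme \<Rightarrow> bool" where
  "local_ring R \<longleftrightarrow> cring R \<and> noetherian_ring R \<and> (\<exists>!m. maximalideal m R)"

definition max_ideal :: "('a, 'b) ring_scheme \<Rightarrow> 'a set" where
  "max_ideal R = (THE m. maximalideal m R)"

definition residue_field :: "('a, 'b) ring_scheme \<Rightarrow> 'a set ring" where
  "residue_field R = R Quot max_ideal R"

text \<open>
  The map \<open>x + m\<^sub>R \<mapsto> h x + m\<^sub>S\<close> of residue fields induced by \<open>h\<close>. The union consists of a single
  coset of \<open>m\<^sub>S\<close> exactly when the value does not depend on the representative \<open>x\<close>; if it does depend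
  on it, the union is not an element of the residue field of \<open>S\<close>. In particular, a statement that
  this map goes from one residue field to the other contains that it is well defined.
\<close>

definition induced_residue_map ::
  "('a, 'b) ring_scheme \<Rightarrow> ('c, 'd) ring_scheme \<Rightarrow> ('a \<Rightarrow> 'c) \<Rightarrow> 'a set \<Rightarrow> 'c set" where
  "induced_residue_map R S h A = (\<Union>x\<in>A. max_ideal S +>\<^bsub>S\<^esub> h x)"

definition krull_dim :: "('a, 'b) ring_scheme \<Rightarrow> enat" where
  "krull_dim R = Sup {enat n | n. \<exists>p :: nat \<Rightarrow> 'a set.
     (\<forall>i\<le>n. primeideal (p i) R) \<and> (\<forall>i<n. p i \<subset> p (Suc i))}"

text \<open>\<open>K\<close> is the quotient field of its subring \<open>R\<close>.\<close>

definition quotient_field :: "('a, 'b) ring_scheme \<Rightarrow> ('a, 'b) ring_scheme \<Rightarrow> bool" where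
  "quotient_field R K \<longleftrightarrow>
     field K \<and> subring (carrier R) K \<and> R = K\<lparr>carrier := carrier R\<rparr> \<and>
     carrier K = {a \<otimes>\<^bsub>K\<^esub> inv\<^bsub>K\<^esub> b | a b. a \<in> carrier R \<and> b \<in> carrier R - {\<zero>\<^bsub>R\<^esub>}}"

definition integral_closure :: "('a, 'b) ring_scheme \<Rightarrow> ('a, 'b) ring_scheme \<Rightarrow> 'a set" where
  "integral_closure R K = {x \<in> carrier K. \<exists>p \<in> carrier ((carrier R) [X]\<^bsub>K\<^esub>).
     p \<noteq> [] \<and> lead_coeff p = \<one>\<^bsub>K\<^esub> \<and> ring.eval K p x = \<zero>\<^bsub>K\<^esub>}"

definition regular_element :: "('a, 'b) ring_scheme \<Rightarrow> 'a \<Rightarrow> bool" where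
  "regular_element R r \<longleftrightarrow>
     r \<in> carrier R \<and> (\<forall>s\<in>carrier R. r \<otimes>\<^bsub>R\<^esub> s = \<zero>\<^bsub>R\<^esub> \<longrightarrow> s = \<zero>\<^bsub>R\<^esub>)"


section \<open>Modules\<close>

definition module_hom ::
  "('a, 'b) ring_scheme \<Rightarrow> ('a, 'm, 'x) module_scheme \<Rightarrow> ('a, 'n, 'y) module_scheme \<Rightarrow> ('m \<Rightarrow> 'n) set"
  where
  "module_hom R M N = {f \<in> carrier M \<rightarrow> carrier N.
     (\<forall>x\<in>carrier M. \<forall>y\<in>carrier M. f (x \<oplus>\<^bsub>M\<^esub> y) = f x \<oplus>\<^bsub>N\<^esub> f y) \<and>
     (\<forall>r\<in>carrier R. \<forall>x\<in>carrier M. f (r \<odot>\<^bsub>M\<^esub> x) = r \<odot>\<^bsub>N\<^esub> f x)}"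

definition finitely_generated :: "('a, 'b) ring_scheme \<Rightarrow> ('a, 'm, 'x) module_scheme \<Rightarrow> bool" where
  "finitely_generated R M \<longleftrightarrow>
     (\<exists>S. finite S \<and> S \<subseteq> carrier M \<and>
       (\<forall>x\<in>carrier M. \<exists>c \<in> S \<rightarrow> carrier R. x = (\<Oplus>\<^bsub>M\<^esub>s\<in>S. c s \<odot>\<^bsub>M\<^esub> s)))"

text \<open>The zero module is free, with basis \<open>{}\<close>.\<close>

definition is_basis ::
  "('a, 'b) ring_scheme \<Rightarrow> ('a, 'm, 'x) module_scheme \<Rightarrow> 'm set \<Rightarrow> bool" where
  "is_basis R M B \<longleftrightarrow>
     B \<subseteq> carrier M \<and>
     (\<forall>x\<in>carrier M. \<exists>A c. finite A \<and> A \<subseteq> B \<and> c \<in> A \<rightarrow> carrier R \<and>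
        x = (\<Oplus>\<^bsub>M\<^esub>b\<in>A. c b \<odot>\<^bsub>M\<^esub> b)) \<and>
     (\<forall>A c. finite A \<and> A \<subseteq> B \<and> c \<in> A \<rightarrow> carrier R \<and> (\<Oplus>\<^bsub>M\<^esub>b\<in>A. c b \<odot>\<^bsub>M\<^esub> b) = \<zero>\<^bsub>M\<^esub> \<longrightarrow>
        (\<forall>b\<in>A. c b = \<zero>\<^bsub>R\<^esub>))"

definition free_module :: "('a, 'b) ring_scheme \<Rightarrow> ('a, 'm, 'x) module_scheme \<Rightarrow> bool" where
  "free_module R M \<longleftrightarrow> (\<exists>B. is_basis R M B)"

definition torsion_free :: "('a, 'b) ring_scheme \<Rightarrow> ('a, 'm, 'x) module_scheme \<Rightarrow> bool" where
  "torsion_free R M \<longleftrightarrow>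
     (\<forall>r x. regular_element R r \<and> x \<in> carrier M \<and> r \<odot>\<^bsub>M\<^esub> x = \<zero>\<^bsub>M\<^esub> \<longrightarrow> x = \<zero>\<^bsub>M\<^esub>)"


section \<open>Tensor products\<close>

text \<open>
  \<open>M \<otimes>\<^sub>R N\<close> is the free abelian group on \<open>M \<times> N\<close> modulo the subgroup generated by the
  relations below; \<open>r\<close> acts by \<open>r (x \<otimes> y) = (r x) \<otimes> y\<close>. The record type of modules extends that of
  rings, hence the unused fields \<open>mult\<close> and \<open>one\<close>.
\<close>

definition tensor_relations ::
  "('a, 'b) ring_scheme \<Rightarrow> ('a, 'm, 'x) module_scheme \<Rightarrow> ('a, 'n, 'y) module_scheme
    \<Rightarrow> ('m \<times> 'n \<Rightarrow>\<^sub>0 int) set" where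
  "tensor_relations R M N =
     {frag_of (x \<oplus>\<^bsub>M\<^esub> x', y) - frag_of (x, y) - frag_of (x', y) | x x' y.
        x \<in> carrier M \<and> x' \<in> carrier M \<and> y \<in> carrier N} \<union>
     {frag_of (x, y \<oplus>\<^bsub>N\<^esub> y') - frag_of (x, y) - frag_of (x, y') | x y y'.
        x \<in> carrier M \<and> y \<in> carrier N \<and> y' \<in> carrier N} \<union>
     {frag_of (r \<odot>\<^bsub>M\<^esub> x, y) - frag_of (x, r \<odot>\<^bsub>N\<^esub> y) | r x y.
        r \<in> carrier R \<and> x \<in> carrier M \<and> y \<in> carrier N}"

definition tensor_product ::
  "('a, 'b) ring_scheme \<Rightarrow> ('a, 'm, 'x) module_scheme \<Rightarrow> ('a, 'n, 'y) module_scheme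
    \<Rightarrow> ('a, ('m \<times> 'n \<Rightarrow>\<^sub>0 int) set) module" where
  "tensor_product R M N =
     (let F = free_Abelian_group (carrier M \<times> carrier N);
          T = generate F (tensor_relations R M N)
      in \<lparr>carrier = carrier (F Mod T), monoid.mult = undefined, monoid.one = undefined,
          ring.zero = \<one>\<^bsub>F Mod T\<^esub>, ring.add = monoid.mult (F Mod T),
          smult = (\<lambda>r A. \<Union>u\<in>A. T #>\<^bsub>F\<^esub> frag_extend (\<lambda>(x, y). frag_of (r \<odot>\<^bsub>M\<^esub> x, y)) u)\<rparr>)"


section \<open>Gorenstein local rings\<close>

text \<open>
  The extension property is required for monomorphisms between modules whose elements lie in the
  type of the elements of \<open>R\<close>. These include the inclusions of the ideals into \<open>R\<close>, so by Baer's
  criterion the property follows for all modules.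
\<close>

definition injective_module :: "('a, 'b) ring_scheme \<Rightarrow> ('a, 'i, 'x) module_scheme \<Rightarrow> bool" where
  "injective_module R I \<longleftrightarrow> module R I \<and>
     (\<forall>(A :: ('a, 'a) module) (B :: ('a, 'a) module) f g.
        module R A \<and> module R B \<and>
        f \<in> module_hom R A B \<and> inj_on f (carrier A) \<and> g \<in> module_hom R A I \<longrightarrow>
        (\<exists>h \<in> module_hom R B I. \<forall>x\<in>carrier A. h (f x) = g x))"

text \<open>Exactness of \<open>0 \<rightarrow> M \<rightarrow> I\<^sub>0 \<rightarrow> I\<^sub>1 \<rightarrow> \<dots>\<close> with all \<open>I\<^sub>j\<close> injective.\<close>

definition injective_resolution ::
  "('a, 'b) ring_scheme \<Rightarrow> ('a, 'm, 'x) module_scheme \<Rightarrow>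
   (nat \<Rightarrow> ('a, 'i) module) \<Rightarrow> ('m \<Rightarrow> 'i) \<Rightarrow> (nat \<Rightarrow> 'i \<Rightarrow> 'i) \<Rightarrow> bool" where
  "injective_resolution R M I \<epsilon> d \<longleftrightarrow>
     (\<forall>j. injective_module R (I j)) \<and>
     \<epsilon> \<in> module_hom R M (I 0) \<and> inj_on \<epsilon> (carrier M) \<and>
     (\<forall>j. d j \<in> module_hom R (I j) (I (Suc j))) \<and>
     \<epsilon> ` carrier M = {x \<in> carrier (I 0). d 0 x = \<zero>\<^bsub>I (Suc 0)\<^esub>} \<and>
     (\<forall>j. d j ` carrier (I j) =
        {x \<in> carrier (I (Suc j)). d (Suc j) x = \<zero>\<^bsub>I (Suc (Suc j))\<^esub>})"

text \<open>
  A definition cannot quantify over types, so the type \<open>'i\<close> in which the modules of a resolution live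
  is a parameter. A theorem that assumes this property for a type variable \<open>'i\<close> holds for
  resolutions by arbitrary injective modules.
\<close>

definition finite_injective_dimension ::
  "'i itself \<Rightarrow> ('a, 'b) ring_scheme \<Rightarrow> ('a, 'm, 'x) module_scheme \<Rightarrow> bool" where
  "finite_injective_dimension _ R M \<longleftrightarrow>
     (\<exists>n (I :: nat \<Rightarrow> ('a, 'i) module) \<epsilon> d.
        injective_resolution R M I \<epsilon> d \<and> (\<forall>j>n. carrier (I j) = {\<zero>\<^bsub>I j\<^esub>}))"

definition regular_module :: "('a, 'b) ring_scheme \<Rightarrow> ('a, 'a) module" where
  "regular_module R =
     \<lparr>carrier = carrier R, monoid.mult = monoid.mult R, monoid.one = monoid.one R,
      ring.zero = ring.zero R, ring.add = ring.add R, smult = monoid.mult R\<rparr>"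

definition gorenstein_local_ring :: "'i itself \<Rightarrow> ('a, 'b) ring_scheme \<Rightarrow> bool" where
  "gorenstein_local_ring t R \<longleftrightarrow>
     local_ring R \<and> finite_injective_dimension t R (regular_module R)"


section \<open>The endomorphism ring of an ideal\<close>

text \<open>
  For a non-zero ideal \<open>I\<close> of a domain with quotient field \<open>K\<close>, the ring \<open>End(I)\<close>
  viewed as a subring of \<open>K\<close>; the lemma \<open>End_ring_iso_multiplier_ring\<close> is the identification.
\<close>

definition multiplier_ring :: "('a, 'b) ring_scheme \<Rightarrow> 'a set \<Rightarrow> ('a, 'b) ring_scheme" where
  "multiplier_ring K I = K\<lparr>carrier := {\<alpha> \<in> carrier K. \<forall>x\<in>I. \<alpha> \<otimes>\<^bsub>K\<^esub> x \<in> I}\<rparr>"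

text \<open>Maps are taken to be \<open>undefined\<close> outside the carrier, to make them unique as HOL functions.\<close>

definition End_ring :: "('a, 'b) ring_scheme \<Rightarrow> ('a, 'm, 'x) module_scheme \<Rightarrow> ('m \<Rightarrow> 'm) ring" where
  "End_ring R M =
     \<lparr>carrier = module_hom R M M \<inter> extensional (carrier M),
      monoid.mult = compose (carrier M),
      monoid.one = (\<lambda>x\<in>carrier M. x),
      ring.zero = (\<lambda>x\<in>carrier M. \<zero>\<^bsub>M\<^esub>),
      ring.add = (\<lambda>f g. \<lambda>x\<in>carrier M. f x \<oplus>\<^bsub>M\<^esub> g x)\<rparr>"

lemma End_ring_iso_multiplier_ring:
  fixes R K :: "('a, 'b) ring_scheme"
  assumes K: "quotient_field R K" and I: "ideal I R" and a: "a \<in> I" "a \<noteq> \<zero>\<^bsub>R\<^esub>"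
  shows "(\<lambda>f. inv\<^bsub>K\<^esub> a \<otimes>\<^bsub>K\<^esub> f a) \<in>
    ring_iso (End_ring R ((regular_module R)\<lparr>carrier := I\<rparr>)) (multiplier_ring K I)"
proof -
  interpret K: field K using K by (simp add: quotient_field_def)
  interpret I: ideal I R by (rule I)
  have R: "R = K\<lparr>carrier := carrier R\<rparr>" using K by (simp add: quotient_field_def)
  have RK: "carrier R \<subseteq> carrier K"
    using K by (meson quotient_field_def subringE(1))
  have ops: "monoid.mult R = monoid.mult K" "ring.add R = ring.add K" "\<zero>\<^bsub>R\<^esub> = \<zero>\<^bsub>K\<^esub>" "\<one>\<^bsub>R\<^esub> = \<one>\<^bsub>K\<^esub>"
    by (subst R, simp)+
  have IR: "x \<in> carrier R" if "x \<in> I" for x using that I.a_subset by blast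
  have IK: "x \<in> carrier K" if "x \<in> I" for x using IR[OF that] RK by blast
  have aK: "a \<in> carrier K" "a \<noteq> \<zero>\<^bsub>K\<^esub>" using a IK ops by auto
  have aU: "a \<in> Units K" using aK K.field_Units by blast
  have ia: "inv\<^bsub>K\<^esub> a \<in> carrier K" "inv\<^bsub>K\<^esub> a \<otimes>\<^bsub>K\<^esub> a = \<one>\<^bsub>K\<^esub>" using aU by auto
  have lin: "f (r \<otimes>\<^bsub>K\<^esub> x) = r \<otimes>\<^bsub>K\<^esub> f x" "f x \<in> I" "f (x \<oplus>\<^bsub>K\<^esub> y) = f x \<oplus>\<^bsub>K\<^esub> f y"
    if "f \<in> carrier (End_ring R ((regular_module R)\<lparr>carrier := I\<rparr>))" "r \<in> carrier R" "x \<in> I" "y \<in> I"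
    for f r x y
    using that by (auto simp: End_ring_def module_hom_def regular_module_def ops)
  have key: "f x = (inv\<^bsub>K\<^esub> a \<otimes>\<^bsub>K\<^esub> f a) \<otimes>\<^bsub>K\<^esub> x"
    if f: "f \<in> carrier (End_ring R ((regular_module R)\<lparr>carrier := I\<rparr>))" and x: "x \<in> I" for f x
  proof -
    have "a \<otimes>\<^bsub>K\<^esub> f x = f (a \<otimes>\<^bsub>K\<^esub> x)" using lin(1)[OF f IR[OF a(1)] x x] by simp
    also have "\<dots> = x \<otimes>\<^bsub>K\<^esub> f a"
      using lin(1)[OF f IR[OF x] a(1) a(1)] K.m_comm[OF aK(1) IK[OF x]] by simp
    finally have "inv\<^bsub>K\<^esub> a \<otimes>\<^bsub>K\<^esub> (a \<otimes>\<^bsub>K\<^esub> f x) = inv\<^bsub>K\<^esub> a \<otimes>\<^bsub>K\<^esub> (x \<otimes>\<^bsub>K\<^esub> f a)" by simp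
    moreover have "f x \<in> carrier K" "f a \<in> carrier K"
      using lin(2)[OF f IR[OF a(1)]] IK x a(1) by auto
    ultimately show ?thesis
      using ia aK IK[OF x] by (metis K.m_assoc K.m_comm K.l_one)
  qed
  let ?E = "End_ring R ((regular_module R)\<lparr>carrier := I\<rparr>)"
  let ?h = "\<lambda>f. inv\<^bsub>K\<^esub> a \<otimes>\<^bsub>K\<^esub> f a"
  have fa: "f a \<in> carrier K" if "f \<in> carrier ?E" for f
    using lin(2)[OF that IR[OF a(1)] a(1) a(1)] IK by blast
  have into: "?h f \<in> carrier (multiplier_ring K I)" if f: "f \<in> carrier ?E" for f
    using key[OF f] lin(2)[OF f IR[OF a(1)]] fa[OF f] ia
    by (auto simp: multiplier_ring_def)
  have hom: "?h \<in> ring_hom ?E (multiplier_ring K I)"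
  proof (rule ring_hom_memI)
    show "?h f \<in> carrier (multiplier_ring K I)" if "f \<in> carrier ?E" for f by (rule into[OF that])
    fix f g assume f: "f \<in> carrier ?E" and g: "g \<in> carrier ?E"
    have ga: "g a \<in> I" using lin(2)[OF g IR[OF a(1)] a(1) a(1)] .
    have "inv\<^bsub>K\<^esub> a \<otimes>\<^bsub>K\<^esub> f (g a) = inv\<^bsub>K\<^esub> a \<otimes>\<^bsub>K\<^esub> ((inv\<^bsub>K\<^esub> a \<otimes>\<^bsub>K\<^esub> f a) \<otimes>\<^bsub>K\<^esub> g a)"
      using key[OF f ga] by simp
    also have "\<dots> = (inv\<^bsub>K\<^esub> a \<otimes>\<^bsub>K\<^esub> f a) \<otimes>\<^bsub>K\<^esub> (inv\<^bsub>K\<^esub> a \<otimes>\<^bsub>K\<^esub> g a)"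
      using ia fa[OF f] fa[OF g] by (simp add: K.m_lcomm)
    finally show "?h (f \<otimes>\<^bsub>?E\<^esub> g) = ?h f \<otimes>\<^bsub>multiplier_ring K I\<^esub> ?h g"
      using a by (simp add: End_ring_def multiplier_ring_def compose_def)
    show "?h (f \<oplus>\<^bsub>?E\<^esub> g) = ?h f \<oplus>\<^bsub>multiplier_ring K I\<^esub> ?h g"
      using a ia fa[OF f] fa[OF g]
      by (simp add: End_ring_def multiplier_ring_def regular_module_def ops K.r_distr)
  next
    show "?h \<one>\<^bsub>?E\<^esub> = \<one>\<^bsub>multiplier_ring K I\<^esub>"
      using a ia by (simp add: End_ring_def multiplier_ring_def)
  qed
  have "bij_betw ?h (carrier ?E) (carrier (multiplier_ring K I))"
  proof (rule bij_betw_imageI)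
    show "inj_on ?h (carrier ?E)"
    proof (rule inj_onI)
      fix f g assume f: "f \<in> carrier ?E" and g: "g \<in> carrier ?E" and eq: "?h f = ?h g"
      show "f = g"
      proof (rule extensionalityI)
        show "f \<in> extensional I" "g \<in> extensional I" using f g by (auto simp: End_ring_def)
        show "f x = g x" if "x \<in> I" for x using key[OF f that] key[OF g that] eq by simp
      qed
    qed
    show "?h ` carrier ?E = carrier (multiplier_ring K I)"
    proof (intro equalityI subsetI)
      show "y \<in> carrier (multiplier_ring K I)" if "y \<in> ?h ` carrier ?E" for y
        using that into by blast
      fix \<alpha> assume al: "\<alpha> \<in> carrier (multiplier_ring K I)"
      then have alK: "\<alpha> \<in> carrier K" and alI: "\<And>x. x \<in> I \<Longrightarrow> \<alpha> \<otimes>\<^bsub>K\<^esub> x \<in> I"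
        by (auto simp: multiplier_ring_def)
      define f where "f = (\<lambda>x\<in>I. \<alpha> \<otimes>\<^bsub>K\<^esub> x)"
      have cl: "x \<oplus>\<^bsub>K\<^esub> y \<in> I" if "x \<in> I" "y \<in> I" for x y
        using additive_subgroup.a_closed[OF I.additive_subgroup_axioms that] by (simp add: ops)
      have cm: "r \<otimes>\<^bsub>K\<^esub> x \<in> I" if "r \<in> carrier R" "x \<in> I" for r x
        using I.I_l_closed[OF that(2,1)] by (simp add: ops)
      have rK: "r \<in> carrier K" if "r \<in> carrier R" for r using that RK by blast
      have "f \<in> carrier ?E"
        using alI alK cl cm IK rK
        by (auto simp: End_ring_def module_hom_def regular_module_def ops f_def K.r_distr K.m_lcomm)
      moreover have "?h f = \<alpha>"
        using a ia alK aK by (simp add: f_def K.m_lcomm)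
      ultimately show "\<alpha> \<in> ?h ` carrier ?E" by force
    qed
  qed
  with hom show ?thesis by (simp add: ring_iso_def)
qed

end

theory Submission
  imports Defs
begin

text \<open>
  Splitting off free summands, one may assume that all linear forms of \<open>M\<close> and of \<open>N\<close> take values
  in \<open>\<mm>\<close>. Since \<open>R\<close> has an injective resolution of length one, the image of such a module in a free
  module is stable under \<open>E\<close>. Hence \<open>x' \<otimes> y - x \<otimes> y'\<close> is torsion in \<open>M \<otimes> N\<close>, and so zero, whenever \<open>x'\<close>
  and \<open>y'\<close> represent \<open>e x\<close> and \<open>e y\<close> for the same \<open>e \<in> E\<close>; in particular the tensor product over \<open>k\<close>
  of a quotient of \<open>M/\<mm>M\<close> and a quotient of \<open>N/\<mm>N\<close> is balanced over \<open>E\<close>. Neither \<open>M\<close> nor \<open>N\<close> is torsion,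
  so they have nonzero forms \<open>f\<close> and \<open>g\<close>, whose images are nonzero ideals of \<open>E\<close>. By Nakayama's lemma these
  have nonzero quotients annihilated by any given maximal ideals of \<open>E\<close>. Two different maximal
  ideals, or an element of \<open>E\<close> whose residue class does not come from \<open>R\<close>, contradict the balancing.
\<close>

section \<open>One-dimensional Noetherian local domains\<close>

text \<open>The resolution supplied by \<open>gorenstein_local_ring\<close> is finite but of unknown
  length, so the resolution of length one has to be extracted from it: injectivity, trivial far out,
  is carried back to the image of the first differential. Each step back needs a divisible kernel;
  images of injective modules are divisible, \<open>R\<close> itself is not. Forms must have values
  in \<open>\<mm>\<close> because \<open>E\<close> multiplies \<open>\<mm>\<close> into
  \<open>R\<close>, while a unit value could leave \<open>R\<close>. The lift \<open>x'\<close> of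
  \<open>e x\<close> is unique only modulo torsion of \<open>M\<close>, which cannot be excluded
  beforehand. It is therefore recorded by an equation \<open>s x' = t x\<close> with
  \<open>e = t/s\<close>, and a common pair \<open>s\<close>, \<open>t\<close> for \<open>x\<close>
  and \<open>y\<close> is what exhibits the difference of tensors as torsion. Since \<open>E\<close>
  is not known to be local, the quotients \<open>f(M)/U\<close> and \<open>g(N)/V\<close> are formed
  at chosen maximal ideals by means of multipliers congruent to 1. For the residue field,
  \<open>U\<close> has to be stable under \<open>R\<close> only; functionals to \<open>k\<close> can
  still detect such quotients.\<close>

lemma (in noetherian_ring) exists_maximal_ideal_in:
  assumes "S \<noteq> {}" and "S \<subseteq> {I. ideal I R}"
  obtains I where "I \<in> S" and "\<And>J. J \<in> S \<Longrightarrow> I \<subseteq> J \<Longrightarrow> J = I"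
proof -
  have "\<exists>U\<in>S. \<forall>V\<in>C. V \<subseteq> U" if C: "subset.chain S C" for C
  proof (cases "C = {}")
    case True
    then show ?thesis using assms by auto
  next
    case False
    have "C \<subseteq> S" using C by (simp add: subset.chain_def)
    moreover have "subset.chain {I. ideal I R} C"
      using C assms(2) by (auto simp: subset.chain_def)
    \<comment> \<open>In a Noetherian ring the union of a nonempty chain of ideals is a member of
      the chain, so Zorn's lemma applies to families that are not closed under unions.\<close>
    ultimately have "\<Union>C \<in> S" using ideal_chain_is_trivial[OF False] by blast
    then show ?thesis by blast
  qed
  then show thesis using subset_Zorn[of S] that by metis
qed

text \<open>\<open>colon_max\<close> is the form in which dimension one enters: \<open>\<mm>\<close>
  is an associated prime of \<open>R/J\<close> for every nonzero proper ideal \<open>J\<close>, so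
  that \<open>R/J\<close> contains a copy of \<open>k\<close>.\<close>

locale one_dim_local_domain = noetherian_domain R for R (structure) +
  fixes \<mm>
  assumes ideal_max: "ideal \<mm> R"
    and nonmember_unit: "x \<in> carrier R \<Longrightarrow> x \<notin> \<mm> \<Longrightarrow> x \<in> Units R"
    and one_nonmember: "\<one> \<notin> \<mm>"
    and max_nonzero: "\<exists>x\<in>\<mm>. x \<noteq> \<zero>"
    and colon_max: "ideal J R \<Longrightarrow> J \<noteq> {\<zero>} \<Longrightarrow> \<one> \<notin> J \<Longrightarrow>
      \<exists>y\<in>carrier R. y \<notin> J \<and> (\<forall>r\<in>\<mm>. r \<otimes> y \<in> J)"

lemma (in cring) ideal_colon:
  assumes J: "ideal J R" and y: "y \<in> carrier R"
  shows "ideal {r \<in> carrier R. r \<otimes> y \<in> J} R"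
proof (rule idealI)
  interpret J: ideal J R by (rule J)
  show "ring R" by (rule ring_axioms)
  show "subgroup {r \<in> carrier R. r \<otimes> y \<in> J} (add_monoid R)"
  proof (rule add.subgroupI)
    show "{r \<in> carrier R. r \<otimes> y \<in> J} \<noteq> {}" using y J.zero_closed by (auto intro!: exI[of _ \<zero>])
  qed (use y in \<open>auto simp: l_distr l_minus\<close>)
  show "x \<otimes> a \<in> {r \<in> carrier R. r \<otimes> y \<in> J}" if "a \<in> {r \<in> carrier R. r \<otimes> y \<in> J}" "x \<in> carrier R" for a x
    using that y by (auto simp: m_assoc J.I_l_closed)
  show "a \<otimes> x \<in> {r \<in> carrier R. r \<otimes> y \<in> J}" if "a \<in> {r \<in> carrier R. r \<otimes> y \<in> J}" "x \<in> carrier R" for a x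
    using that y by (auto simp: m_assoc m_lcomm[of a x] J.I_l_closed)
qed

text \<open>A maximal member of the colon ideals \<open>(J : y)\<close> with \<open>y\<close>
  outside \<open>J\<close> is prime: if \<open>b y\<close> is not in \<open>J\<close>, then
  \<open>(J : b y)\<close> contains \<open>(J : y)\<close>, hence equals it, and
  \<open>a b y\<close> in \<open>J\<close> puts \<open>a\<close> into it.\<close>

lemma (in noetherian_ring) exists_associated_prime:
  assumes R: "cring R" and J: "ideal J R" "\<one> \<notin> J"
  obtains y where "y \<in> carrier R" "y \<notin> J" "primeideal {r \<in> carrier R. r \<otimes> y \<in> J} R"
proof -
  interpret cring R by (rule R)
  interpret J: ideal J R by (rule J)
  let ?C = "\<lambda>y. {r \<in> carrier R. r \<otimes> y \<in> J}"
  obtain I where I: "I \<in> ?C ` (carrier R - J)"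
      and max: "\<And>I'. I' \<in> ?C ` (carrier R - J) \<Longrightarrow> I \<subseteq> I' \<Longrightarrow> I' = I"
    using exists_maximal_ideal_in[of "?C ` (carrier R - J)"] J ideal_colon[OF J(1)] by blast
  then obtain y where y: "y \<in> carrier R" "y \<notin> J" "I = ?C y" by blast
  have "primeideal (?C y) R"
  proof (rule primeidealI)
    show "ideal (?C y) R" by (rule ideal_colon[OF J(1) y(1)])
    show "cring R" by (rule R)
    have "\<one> \<notin> ?C y" using y by simp
    then show "carrier R \<noteq> ?C y" using one_closed by blast
    fix a b assume ab: "a \<in> carrier R" "b \<in> carrier R" "a \<otimes> b \<in> ?C y"
    show "a \<in> ?C y \<or> b \<in> ?C y"
    proof (rule disjCI)
      assume b: "b \<notin> ?C y"
      have "?C y \<subseteq> ?C (b \<otimes> y)"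
        using ab y by (auto simp: m_lcomm[of _ b y] J.I_l_closed)
      then have "?C (b \<otimes> y) = ?C y" using max[of "?C (b \<otimes> y)"] ab y b by auto
      moreover have "a \<in> ?C (b \<otimes> y)" using ab y by (auto simp: m_assoc)
      ultimately show "a \<in> ?C y" by blast
    qed
  qed
  with y that show thesis by blast
qed

lemma (in ring) one_notin_proper_ideal: "ideal I R \<Longrightarrow> I \<noteq> carrier R \<Longrightarrow> \<one> \<notin> I"
  using ideal.one_imp_carrier by blast

lemma (in noetherian_ring) exists_maximalideal:
  assumes "ideal I R" "\<one> \<notin> I"
  obtains P where "maximalideal P R" "I \<subseteq> P"
proof -
  obtain P where P: "ideal P R" "\<one> \<notin> P" "I \<subseteq> P"
    and max: "\<And>J. ideal J R \<Longrightarrow> \<one> \<notin> J \<Longrightarrow> I \<subseteq> J \<Longrightarrow> P \<subseteq> J \<Longrightarrow> J = P"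
    by (rule exists_maximal_ideal_in[of "{J. ideal J R \<and> \<one> \<notin> J \<and> I \<subseteq> J}"])
      (use assms in blast)+
  have "maximalideal P R"
  proof (rule maximalidealI)
    show "ideal P R" by (rule P)
    show "carrier R \<noteq> P" using P(2) by auto
    fix J assume J: "ideal J R" "P \<subseteq> J" "J \<subseteq> carrier R"
    then show "J = P \<or> J = carrier R"
      using max[OF J(1)] P(3) one_notin_proper_ideal[OF J(1)] by blast
  qed
  with P that show thesis by blast
qed

lemma max_ideal_maximal:
  assumes "local_ring R"
  shows "maximalideal (max_ideal R) R" and "maximalideal P R \<Longrightarrow> P = max_ideal R"
  using assms theI'[of "\<lambda>m. maximalideal m R"] unfolding local_ring_def max_ideal_def
  by (auto simp: the_equality)

lemma local_ring_nonmember_unit: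
  assumes R: "local_ring R" and x: "x \<in> carrier R" "x \<notin> max_ideal R"
  shows "x \<in> Units R"
proof (rule ccontr)
  assume nu: "x \<notin> Units R"
  interpret cring R using R by (simp add: local_ring_def)
  interpret noetherian_ring R using R by (simp add: local_ring_def)
  have "\<one>\<^bsub>R\<^esub> \<notin> PIdl\<^bsub>R\<^esub> x"
    using nu x by (auto simp: cgenideal_def Units_def m_comm)
  then obtain P where "maximalideal P R" "PIdl\<^bsub>R\<^esub> x \<subseteq> P"
    using exists_maximalideal[OF cgenideal_ideal[OF x(1)]] by blast
  then show False using max_ideal_maximal(2)[OF R] cgenideal_self[OF x(1)] x(2) by blast
qed

text \<open>A nonzero prime properly below the maximal ideal would give, with the zero ideal, a
  chain of length two. So an associated prime of \<open>R/J\<close>, which contains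
  \<open>J\<close>, is the maximal ideal as soon as \<open>J\<close> is nonzero. A chain of length
  one supplies a nonzero element of the maximal ideal.\<close>

lemma krull_dim_one_local_domain:
  assumes R: "domain R" "local_ring R" and dim: "krull_dim R = 1"
  shows "one_dim_local_domain R (max_ideal R)"
proof -
  interpret R: domain R by (rule R(1))
  interpret R: noetherian_ring R using R(2) by (simp add: local_ring_def)
  interpret m: maximalideal "max_ideal R" R by (rule max_ideal_maximal(1)[OF R(2)])
  have one: "\<one>\<^bsub>R\<^esub> \<notin> max_ideal R" using m.one_imp_carrier m.I_notcarr by blast
  have sub: "P \<subseteq> max_ideal R" if P: "primeideal P R" for P
  proof -
    interpret P: primeideal P R by (rule P)
    have "\<one>\<^bsub>R\<^esub> \<notin> P" using P.one_imp_carrier P.I_notcarr by blast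
    then show ?thesis
      using R.exists_maximalideal[OF P.is_ideal] max_ideal_maximal(2)[OF R(2)] by blast
  qed
  let ?chain = "\<lambda>n p. (\<forall>i\<le>n. primeideal (p i) R) \<and> (\<forall>i<n. p i \<subset> p (Suc i))"
  let ?S = "{enat n | n. \<exists>p. ?chain n p}"
  have upper: "n \<le> 1" if "?chain n p" for n p
  proof -
    have "enat n \<in> ?S" using that by blast
    then have "enat n \<le> krull_dim R" unfolding krull_dim_def by (rule Sup_upper)
    then show ?thesis using dim by (simp add: one_enat_def)
  qed
  have "\<exists>n\<ge>1. \<exists>p. ?chain n p"
  proof (rule ccontr)
    assume no: "\<not> ?thesis"
    have "x \<le> 0" if x: "x \<in> ?S" for x
    proof -
      obtain k p where k: "x = enat k" "?chain k p" using x by blast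
      then have "k = 0" using no by (metis less_one not_le)
      then show ?thesis using k by (simp add: zero_enat_def)
    qed
    then have "Sup ?S \<le> 0" by (rule Sup_least)
    then show False using dim unfolding krull_dim_def by simp
  qed
  then obtain n p where n: "n \<ge> 1" "?chain n p" by blast
  then have p: "primeideal (p 0) R" "primeideal (p 1) R" "p 0 \<subset> p 1" by auto
  interpret p0: primeideal "p 0" R by (rule p(1))
  from p(3) obtain x where x: "x \<in> p 1" "x \<notin> p 0" by blast
  have xm: "x \<in> max_ideal R" "x \<noteq> \<zero>\<^bsub>R\<^esub>"
    using x sub[OF p(2)] p0.zero_closed by auto
  have maxprime: "P = max_ideal R" if P: "primeideal P R" "P \<noteq> {\<zero>\<^bsub>R\<^esub>}" for P
  proof (rule ccontr)
    assume neq: "P \<noteq> max_ideal R"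
    interpret P: primeideal P R by (rule P(1))
    let ?p = "\<lambda>i. if i = (0::nat) then {\<zero>\<^bsub>R\<^esub>} else if i = 1 then P else max_ideal R"
    have "?chain 2 ?p"
      using R.zeroprimeideal R.maximalideal_prime[OF m.is_maximalideal] P sub[OF P(1)] neq P.zero_closed
      by (auto simp: less_2_cases_iff)
    then have "2 \<le> (1::nat)" by (rule upper)
    then show False by simp
  qed
  show ?thesis
  proof (intro one_dim_local_domain.intro noetherian_domain.intro one_dim_local_domain_axioms.intro)
    show "noetherian_ring R" "domain R" by unfold_locales
    show "ideal (max_ideal R) R" by (rule m.is_ideal)
    show "x \<in> Units R" if "x \<in> carrier R" "x \<notin> max_ideal R" for x
      by (rule local_ring_nonmember_unit[OF R(2) that])
    show "\<one>\<^bsub>R\<^esub> \<notin> max_ideal R" by (rule one)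
    show "\<exists>x\<in>max_ideal R. x \<noteq> \<zero>\<^bsub>R\<^esub>" using xm by blast
    fix J assume J: "ideal J R" "J \<noteq> {\<zero>\<^bsub>R\<^esub>}" "\<one>\<^bsub>R\<^esub> \<notin> J"
    interpret J: ideal J R by (rule J(1))
    obtain y where y: "y \<in> carrier R" "y \<notin> J" "primeideal {r \<in> carrier R. r \<otimes>\<^bsub>R\<^esub> y \<in> J} R"
      using R.exists_associated_prime[OF R.is_cring J(1,3)] by blast
    obtain j where j: "j \<in> J" "j \<noteq> \<zero>\<^bsub>R\<^esub>" using J(2) J.zero_closed by blast
    then have "j \<in> {r \<in> carrier R. r \<otimes>\<^bsub>R\<^esub> y \<in> J}" using y(1) J.I_r_closed J.Icarr by blast
    then have "{r \<in> carrier R. r \<otimes>\<^bsub>R\<^esub> y \<in> J} = max_ideal R" using maxprime[OF y(3)] j(2) by blast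
    then show "\<exists>y\<in>carrier R. y \<notin> J \<and> (\<forall>r\<in>max_ideal R. r \<otimes>\<^bsub>R\<^esub> y \<in> J)" using y by blast
  qed
qed

section \<open>Baer's criterion for the cosyzygies of an injective resolution\<close>

lemma (in module) smult_r_diff:
  "a \<in> carrier R \<Longrightarrow> x \<in> carrier M \<Longrightarrow> y \<in> carrier M \<Longrightarrow>
    a \<odot>\<^bsub>M\<^esub> (x \<ominus>\<^bsub>M\<^esub> y) = a \<odot>\<^bsub>M\<^esub> x \<ominus>\<^bsub>M\<^esub> a \<odot>\<^bsub>M\<^esub> y"
  by (simp add: a_minus_def smult_r_distr smult_r_minus)

lemma (in module) smult_l_diff:
  "a \<in> carrier R \<Longrightarrow> b \<in> carrier R \<Longrightarrow> x \<in> carrier M \<Longrightarrow>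
    (a \<ominus> b) \<odot>\<^bsub>M\<^esub> x = a \<odot>\<^bsub>M\<^esub> x \<ominus>\<^bsub>M\<^esub> b \<odot>\<^bsub>M\<^esub> x"
  by (simp add: a_minus_def smult_l_distr smult_l_minus)

lemma (in abelian_group) minus_eq_zero_iff:
  "x \<in> carrier G \<Longrightarrow> y \<in> carrier G \<Longrightarrow> x \<ominus> y = \<zero> \<longleftrightarrow> x = y"
  by (metis a_minus_def add.inv_closed minus_equality minus_minus r_neg)

text \<open>A graph needs no choice of values outside the ideal on which the map is defined, and an
  extension to a larger ideal is just a larger set. Given the other conditions, the last one is
  single-valuedness.\<close>

definition linear_graph :: "('a, 'b) ring_scheme \<Rightarrow> ('a, 'm, 'x) module_scheme \<Rightarrow> 'm set \<Rightarrow> ('a \<times> 'm) set \<Rightarrow> bool"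
  where "linear_graph R M Z G \<longleftrightarrow> G \<subseteq> carrier R \<times> Z \<and> (\<zero>\<^bsub>R\<^esub>, \<zero>\<^bsub>M\<^esub>) \<in> G \<and>
    (\<forall>r v s w. (r, v) \<in> G \<longrightarrow> (s, w) \<in> G \<longrightarrow> (r \<oplus>\<^bsub>R\<^esub> s, v \<oplus>\<^bsub>M\<^esub> w) \<in> G) \<and>
    (\<forall>c\<in>carrier R. \<forall>r v. (r, v) \<in> G \<longrightarrow> (c \<otimes>\<^bsub>R\<^esub> r, c \<odot>\<^bsub>M\<^esub> v) \<in> G) \<and>
    (\<forall>v. (\<zero>\<^bsub>R\<^esub>, v) \<in> G \<longrightarrow> v = \<zero>\<^bsub>M\<^esub>)"

text \<open>Baer's criterion for the submodule \<open>Z\<close>, for homomorphisms from ideals to \<open>Z\<close> given as graphs.\<close>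

definition baer :: "('a, 'b) ring_scheme \<Rightarrow> ('a, 'm, 'x) module_scheme \<Rightarrow> 'm set \<Rightarrow> bool"
  where "baer R M Z \<longleftrightarrow> (\<forall>G. linear_graph R M Z G \<longrightarrow> (\<exists>z\<in>Z. \<forall>r v. (r, v) \<in> G \<longrightarrow> v = r \<odot>\<^bsub>M\<^esub> z))"

lemma linear_graphD:
  assumes "linear_graph R M Z G"
  shows "(r, v) \<in> G \<Longrightarrow> r \<in> carrier R" and "(r, v) \<in> G \<Longrightarrow> v \<in> Z"
    and "(\<zero>\<^bsub>R\<^esub>, \<zero>\<^bsub>M\<^esub>) \<in> G"
    and "(r, v) \<in> G \<Longrightarrow> (s, w) \<in> G \<Longrightarrow> (r \<oplus>\<^bsub>R\<^esub> s, v \<oplus>\<^bsub>M\<^esub> w) \<in> G"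
    and "c \<in> carrier R \<Longrightarrow> (r, v) \<in> G \<Longrightarrow> (c \<otimes>\<^bsub>R\<^esub> r, c \<odot>\<^bsub>M\<^esub> v) \<in> G"
    and "(\<zero>\<^bsub>R\<^esub>, v) \<in> G \<Longrightarrow> v = \<zero>\<^bsub>M\<^esub>"
  using assms unfolding linear_graph_def by blast+

lemma (in module) linear_graph_uminus:
  assumes "linear_graph R M Z G" "Z \<subseteq> carrier M" "(r, v) \<in> G"
  shows "(\<ominus> r, \<ominus>\<^bsub>M\<^esub> v) \<in> G"
  using linear_graphD(5)[OF assms(1), of "\<ominus> \<one>" r v] linear_graphD(1,2)[OF assms(1,3)] assms(2,3)
  by (auto simp: l_minus smult_l_minus)

lemma (in module) linear_graph_unique:
  assumes G: "linear_graph R M Z G" and Z: "Z \<subseteq> carrier M" and v: "(r, v) \<in> G" and w: "(r, w) \<in> G"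
  shows "v = w"
proof -
  have "(r \<oplus> \<ominus> r, v \<oplus>\<^bsub>M\<^esub> \<ominus>\<^bsub>M\<^esub> w) \<in> G"
    by (rule linear_graphD(4)[OF G v linear_graph_uminus[OF G Z w]])
  then have "v \<ominus>\<^bsub>M\<^esub> w = \<zero>\<^bsub>M\<^esub>"
    using linear_graphD(6)[OF G] linear_graphD(1)[OF G v] by (simp add: R.r_neg a_minus_def)
  then show ?thesis using M.minus_eq_zero_iff linear_graphD(2)[OF G] v w Z by blast
qed

lemma (in module) ideal_linear_graph_domain:
  assumes G: "linear_graph R M Z G" and Z: "Z \<subseteq> carrier M"
  shows "ideal (fst ` G) R"
proof (rule idealI)
  show "ring R" by (rule R.ring_axioms)
  show "subgroup (fst ` G) (add_monoid R)"
  proof (rule R.add.subgroupI)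
    show "fst ` G \<subseteq> carrier R" using linear_graphD(1)[OF G] by auto
    show "fst ` G \<noteq> {}" using linear_graphD(3)[OF G] by auto
    show "\<ominus> a \<in> fst ` G" if "a \<in> fst ` G" for a
      using that linear_graph_uminus[OF G Z] by force
    show "a \<oplus> b \<in> fst ` G" if "a \<in> fst ` G" "b \<in> fst ` G" for a b
      using that linear_graphD(4)[OF G] by force
  qed
  show "x \<otimes> a \<in> fst ` G" if "a \<in> fst ` G" "x \<in> carrier R" for a x
    using that linear_graphD(5)[OF G] by force
  then show "a \<otimes> x \<in> fst ` G" if "a \<in> fst ` G" "x \<in> carrier R" for a x
    using that linear_graphD(1)[OF G] R.m_comm by (metis imageE prod.collapse)
qed

lemma module_homD:
  assumes "f \<in> module_hom R M N"
  shows "x \<in> carrier M \<Longrightarrow> f x \<in> carrier N"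
    and "x \<in> carrier M \<Longrightarrow> y \<in> carrier M \<Longrightarrow> f (x \<oplus>\<^bsub>M\<^esub> y) = f x \<oplus>\<^bsub>N\<^esub> f y"
    and "r \<in> carrier R \<Longrightarrow> x \<in> carrier M \<Longrightarrow> f (r \<odot>\<^bsub>M\<^esub> x) = r \<odot>\<^bsub>N\<^esub> f x"
  using assms by (auto simp: module_hom_def)

lemma module_hom_zero:
  assumes "module R M" "module R N" "f \<in> module_hom R M N"
  shows "f \<zero>\<^bsub>M\<^esub> = \<zero>\<^bsub>N\<^esub>"
proof -
  interpret M: module R M by fact
  interpret N: module R N by fact
  have "f (\<zero>\<^bsub>R\<^esub> \<odot>\<^bsub>M\<^esub> \<zero>\<^bsub>M\<^esub>) = \<zero>\<^bsub>R\<^esub> \<odot>\<^bsub>N\<^esub> f \<zero>\<^bsub>M\<^esub>"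
    using module_homD(3)[OF assms(3)] by blast
  then show ?thesis using module_homD(1)[OF assms(3), of "\<zero>\<^bsub>M\<^esub>"] by simp
qed

lemma module_hom_diff:
  assumes "module R M" "module R N" "f \<in> module_hom R M N" "x \<in> carrier M" "y \<in> carrier M"
  shows "f (x \<ominus>\<^bsub>M\<^esub> y) = f x \<ominus>\<^bsub>N\<^esub> f y"
proof -
  interpret M: module R M by fact
  interpret N: module R N by fact
  have "f (\<ominus>\<^bsub>M\<^esub> y) = f ((\<ominus>\<^bsub>R\<^esub> \<one>\<^bsub>R\<^esub>) \<odot>\<^bsub>M\<^esub> y)" using assms(5) by (simp add: M.smult_l_minus)
  also have "\<dots> = \<ominus>\<^bsub>N\<^esub> f y"
    using module_homD(3)[OF assms(3), of "\<ominus>\<^bsub>R\<^esub> \<one>\<^bsub>R\<^esub>" y] module_homD(1)[OF assms(3,5)] assms(5)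
    by (simp add: N.smult_l_minus)
  finally show ?thesis
    using module_homD(2)[OF assms(3,4), of "\<ominus>\<^bsub>M\<^esub> y"] assms(5) by (simp add: a_minus_def)
qed

lemma regular_module_simps [simp]:
  "carrier (regular_module R) = carrier R" "add (regular_module R) = add R"
  "\<zero>\<^bsub>regular_module R\<^esub> = \<zero>\<^bsub>R\<^esub>" "smult (regular_module R) = monoid.mult R"
  by (simp_all add: regular_module_def)

lemma a_inv_regular_module [simp]: "\<ominus>\<^bsub>regular_module R\<^esub> x = \<ominus>\<^bsub>R\<^esub> x"
  by (simp add: a_inv_def m_inv_def regular_module_def)

lemma module_regular:
  assumes "cring R" shows "module R (regular_module R)"
proof -
  interpret cring R by fact
  show ?thesis
  proof (rule moduleI)
    show "cring R" by fact
    show "abelian_group (regular_module R)"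
      by (rule abelian_groupI)
        (auto simp: regular_module_def a_ac intro: bexI[of _ "\<ominus>\<^bsub>R\<^esub> x" for x] l_neg)
  qed (auto simp: regular_module_def l_distr r_distr m_assoc)
qed

text \<open>The inclusion of the domain of a graph into \<open>R\<close> is a monomorphism of
  modules over the type \<open>'a\<close>, the only ones that \<open>injective_module\<close> speaks
  about. The required \<open>z\<close> is the value of the extension at 1.\<close>

lemma injective_module_baer:
  fixes R :: "('a, 'b) ring_scheme"
  assumes I: "injective_module R I"
  shows "baer R I (carrier I)"
  unfolding baer_def
proof (intro allI impI)
  fix G assume G: "linear_graph R I (carrier I) G"
  interpret I: module R I using I by (simp add: injective_module_def)
  have mod: "module R (regular_module R)" by (rule module_regular) (rule I.is_cring)
  interpret reg: module R "regular_module R" by (rule mod)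
  define J where "J = fst ` G"
  interpret J: ideal J R unfolding J_def by (rule I.ideal_linear_graph_domain[OF G order_refl])
  define g where "g r = (THE v. (r, v) \<in> G)" for r
  have g: "g r = v" if "(r, v) \<in> G" for r v
    unfolding g_def using that I.linear_graph_unique[OF G order_refl] by blast
  have gG: "(r, g r) \<in> G" if "r \<in> J" for r using that g by (force simp: J_def)
  let ?A = "(regular_module R)\<lparr>carrier := J\<rparr>"
  have "submodule J R (regular_module R)"
    by (rule reg.submoduleI)
      (use J.Icarr J.I_l_closed J.a_inv_closed in \<open>auto simp flip: a_inv_def\<close>)
  then have A: "module R ?A" using mod by (rule submodule.submodule_is_module)
  have "g \<in> module_hom R ?A I"
    unfolding module_hom_def
    using linear_graphD(2)[OF G gG] linear_graphD(4)[OF G gG gG, THEN g]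
      linear_graphD(5)[OF G _ gG, THEN g] by simp
  moreover have "(\<lambda>x. x) \<in> module_hom R ?A (regular_module R)"
    using J.Icarr by (simp add: module_hom_def)
  ultimately obtain h where h: "h \<in> module_hom R (regular_module R) I" "\<And>x. x \<in> J \<Longrightarrow> h x = g x"
    using I[unfolded injective_module_def, THEN conjunct2, rule_format,
        of ?A "regular_module R" "\<lambda>x. x" g] A mod by auto
  have "v = r \<odot>\<^bsub>I\<^esub> h \<one>\<^bsub>R\<^esub>" if rv: "(r, v) \<in> G" for r v
  proof -
    have r: "r \<in> J" "r \<in> carrier R" using rv linear_graphD(1)[OF G] by (force simp: J_def)+
    have "v = h r" using g[OF rv] h(2)[OF r(1)] by simp
    also have "\<dots> = h (r \<odot>\<^bsub>regular_module R\<^esub> \<one>\<^bsub>R\<^esub>)" using r by (simp add: regular_module_def)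
    also have "\<dots> = r \<odot>\<^bsub>I\<^esub> h \<one>\<^bsub>R\<^esub>"
      by (rule module_homD(3)[OF h(1)]) (use r in \<open>auto simp: regular_module_def\<close>)
    finally show ?thesis .
  qed
  moreover have "h \<one>\<^bsub>R\<^esub> \<in> carrier I" using module_homD(1)[OF h(1)] by (simp add: regular_module_def)
  ultimately show "\<exists>z\<in>carrier I. \<forall>r v. (r, v) \<in> G \<longrightarrow> v = r \<odot>\<^bsub>I\<^esub> z" by blast
qed

text \<open>This is the graph of the map from \<open>R x\<close> to \<open>Z\<close> that sends
  \<open>r x\<close> to \<open>r z\<close>; the annihilator condition makes it well defined.\<close>

lemma (in module) linear_graph_scalar_multiples:
  assumes "submodule Z R M" "x \<in> carrier R" "z \<in> Z"
    and "\<And>r. r \<in> carrier R \<Longrightarrow> r \<otimes> x = \<zero> \<Longrightarrow> r \<odot>\<^bsub>M\<^esub> z = \<zero>\<^bsub>M\<^esub>"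
  shows "linear_graph R M Z {(r \<otimes> x, r \<odot>\<^bsub>M\<^esub> z) | r. r \<in> carrier R}"
proof -
  note Z = submoduleE[OF assms(1)]
  have z: "z \<in> carrier M" using Z(1) assms(3) by blast
  show ?thesis
    unfolding linear_graph_def
  proof (intro conjI allI impI ballI)
    show "(\<zero>, \<zero>\<^bsub>M\<^esub>) \<in> {(r \<otimes> x, r \<odot>\<^bsub>M\<^esub> z) | r. r \<in> carrier R}"
      using z assms(2) by (auto intro!: exI[of _ \<zero>])
  next
    fix r v s w
    assume "(r, v) \<in> {(r \<otimes> x, r \<odot>\<^bsub>M\<^esub> z) | r. r \<in> carrier R}"
      "(s, w) \<in> {(r \<otimes> x, r \<odot>\<^bsub>M\<^esub> z) | r. r \<in> carrier R}"
    then obtain a b where "a \<in> carrier R" "b \<in> carrier R" "r = a \<otimes> x" "v = a \<odot>\<^bsub>M\<^esub> z"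
      "s = b \<otimes> x" "w = b \<odot>\<^bsub>M\<^esub> z" by blast
    then show "(r \<oplus> s, v \<oplus>\<^bsub>M\<^esub> w) \<in> {(r \<otimes> x, r \<odot>\<^bsub>M\<^esub> z) | r. r \<in> carrier R}"
      using z assms(2) by (auto intro!: exI[of _ "a \<oplus> b"] simp: R.l_distr smult_l_distr)
  next
    fix c r v assume "c \<in> carrier R" "(r, v) \<in> {(r \<otimes> x, r \<odot>\<^bsub>M\<^esub> z) | r. r \<in> carrier R}"
    then obtain a where "a \<in> carrier R" "r = a \<otimes> x" "v = a \<odot>\<^bsub>M\<^esub> z" by blast
    then show "(c \<otimes> r, c \<odot>\<^bsub>M\<^esub> v) \<in> {(r \<otimes> x, r \<odot>\<^bsub>M\<^esub> z) | r. r \<in> carrier R}"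
      using z assms(2) \<open>c \<in> carrier R\<close> by (auto intro!: exI[of _ "c \<otimes> a"] simp: R.m_assoc smult_assoc1)
  qed (use assms Z in auto)
qed

text \<open>The map \<open>r x\<close> to \<open>r z\<close> on the ideal \<open>R x\<close> is well
  defined because \<open>x\<close> is a non-zero-divisor. It is multiplication by some
  \<open>z'\<close>, and \<open>r = 1\<close> gives the claim.\<close>

lemma baer_divisible:
  assumes M: "module R M" and Z: "submodule Z R M" and R: "domain R" and b: "baer R M Z"
    and x: "x \<in> carrier R" "x \<noteq> \<zero>\<^bsub>R\<^esub>" and z: "z \<in> Z"
  obtains z' where "z' \<in> Z" "z = x \<odot>\<^bsub>M\<^esub> z'"
proof -
  interpret M: module R M by fact
  interpret R: domain R by fact
  have zM: "z \<in> carrier M" using z M.submoduleE(1)[OF Z] by blast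
  have "linear_graph R M Z {(r \<otimes>\<^bsub>R\<^esub> x, r \<odot>\<^bsub>M\<^esub> z) | r. r \<in> carrier R}"
    by (rule M.linear_graph_scalar_multiples[OF Z x(1) z]) (use x zM R.integral in force)
  then obtain z' where z': "z' \<in> Z" "\<forall>r v. (r, v) \<in> {(r \<otimes>\<^bsub>R\<^esub> x, r \<odot>\<^bsub>M\<^esub> z) | r. r \<in> carrier R} \<longrightarrow> v = r \<odot>\<^bsub>M\<^esub> z'"
    using b unfolding baer_def by meson
  have "(x, z) \<in> {(r \<otimes>\<^bsub>R\<^esub> x, r \<odot>\<^bsub>M\<^esub> z) | r. r \<in> carrier R}"
    using x zM by (auto intro!: exI[of _ "\<one>\<^bsub>R\<^esub>"])
  then show thesis using z' that by blast
qed

lemma (in abelian_group) a_minus_zero [simp]: "x \<in> carrier G \<Longrightarrow> x \<ominus> \<zero> = x"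
  by (metis a_minus_def minus_equality r_zero zero_closed)

lemma (in abelian_group) a_minus_self [simp]: "x \<in> carrier G \<Longrightarrow> x \<ominus> x = \<zero>"
  by (simp add: a_minus_def r_neg)

lemma (in module) submodule_zero: "submodule Z R M \<Longrightarrow> \<zero>\<^bsub>M\<^esub> \<in> Z"
  using submoduleE(2,4) by (metis R.zero_closed all_not_in_conv smult_l_null submoduleE(1) subsetD)

lemma (in module) submodule_diff:
  assumes "submodule Z R M" "x \<in> Z" "y \<in> Z" shows "x \<ominus>\<^bsub>M\<^esub> y \<in> Z"
  using submoduleE(3,5)[OF assms(1)] assms(2,3) by (simp add: a_minus_def)

lemma (in monoid) Units_inv_mult_cancel:
  "u \<in> Units G \<Longrightarrow> y \<in> carrier G \<Longrightarrow> inv u \<otimes> (u \<otimes> y) = y"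
  by (metis Units_closed Units_inv_closed Units_l_inv l_one m_assoc)

section \<open>Reduction of Baer's criterion to homomorphisms from the maximal ideal\<close>

context one_dim_local_domain
begin

interpretation max: ideal \<mm> R by (rule ideal_max)

text \<open>The class of \<open>y\<close> spans a copy of \<open>k\<close> in \<open>R/(x)\<close>.
  It serves twice: to write \<open>k\<close> as \<open>(x, y)/(x)\<close> in the dimension shift,
  and as a fraction \<open>y/x\<close> outside \<open>R\<close> that \<open>\<mm>\<close> multiplies
  into \<open>R\<close>.\<close>

lemma colon_max_principal:
  assumes "x \<in> \<mm>" "x \<noteq> \<zero>"
  obtains y where "y \<in> carrier R" "\<And>s. s \<in> carrier R \<Longrightarrow> y \<noteq> x \<otimes> s"
    "\<And>r. r \<in> \<mm> \<Longrightarrow> \<exists>s\<in>carrier R. r \<otimes> y = x \<otimes> s"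
proof -
  have x: "x \<in> carrier R" using assms(1) max.Icarr by blast
  have P: "u \<in> PIdl x \<longleftrightarrow> (\<exists>s\<in>carrier R. u = x \<otimes> s)" for u
    using x by (auto simp: cgenideal_def m_comm)
  have "\<one> \<notin> PIdl x" using assms(1) one_nonmember max.I_r_closed P by auto
  moreover have "PIdl x \<noteq> {\<zero>}" using cgenideal_self[OF x] assms(2) by blast
  ultimately show thesis
    using colon_max[OF cgenideal_ideal[OF x]] P that by metis
qed

text \<open>In dimension one \<open>Ext\<^sup>1(k, Z) = 0\<close> suffices. Let \<open>J\<close> be
  a largest ideal to which the given map extends. If \<open>J\<close> is neither zero nor
  \<open>R\<close>, there is a \<open>y\<close> outside \<open>J\<close> with \<open>\<mm> y\<close>
  inside; the map on \<open>\<mm>\<close> sending \<open>r\<close> to the value at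
  \<open>r y\<close> extends to \<open>R\<close>, which prescribes a value at \<open>y\<close> and
  enlarges the domain to \<open>J + R y\<close>.\<close>

lemma baer_if_extends_from_max:
  assumes M: "module R M" and Z: "submodule Z R M"
    and ext: "\<And>G. linear_graph R M Z G \<Longrightarrow> fst ` G = \<mm> \<Longrightarrow>
      \<exists>z\<in>Z. \<forall>r v. (r, v) \<in> G \<longrightarrow> v = r \<odot>\<^bsub>M\<^esub> z"
  shows "baer R M Z"
  unfolding baer_def
proof (intro allI impI)
  fix G0 assume G0: "linear_graph R M Z G0"
  interpret M: module R M by (rule M)
  note ZE = M.submoduleE[OF Z]
  \<comment> \<open>Maximality is sought among the domains, which are ideals of a Noetherian ring,
    and not among the graphs.\<close>
  let ?S = "{fst ` G | G. linear_graph R M Z G \<and> G0 \<subseteq> G}"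
  have ne: "?S \<noteq> {}" using G0 by blast
  have ideals: "?S \<subseteq> {I. ideal I R}" using M.ideal_linear_graph_domain[OF _ ZE(1)] by blast
  obtain J where J: "J \<in> ?S" and max: "\<And>J'. J' \<in> ?S \<Longrightarrow> J \<subseteq> J' \<Longrightarrow> J' = J"
    by (rule exists_maximal_ideal_in[OF ne ideals]) blast
  from J obtain G where G: "linear_graph R M Z G" "G0 \<subseteq> G" "J = fst ` G" by blast
  note GD = linear_graphD[OF G(1)]
  interpret J: ideal J R unfolding G(3) by (rule M.ideal_linear_graph_domain[OF G(1) ZE(1)])
  have Zc: "v \<in> carrier M" if "v \<in> Z" for v using that ZE(1) by blast
  have "\<exists>z\<in>Z. \<forall>r v. (r, v) \<in> G \<longrightarrow> v = r \<odot>\<^bsub>M\<^esub> z"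
  proof (cases "J = {\<zero>}")
    case True
    have "v = r \<odot>\<^bsub>M\<^esub> \<zero>\<^bsub>M\<^esub>" if "(r, v) \<in> G" for r v
    proof -
      have "r = \<zero>" using that True G(3) by (metis fst_conv imageI singletonD)
      then have "v = \<zero>\<^bsub>M\<^esub>" using that GD(6) by blast
      then show ?thesis using \<open>r = \<zero>\<close> by simp
    qed
    then show ?thesis using M.submodule_zero[OF Z] by blast
  next
    case False
    show ?thesis
    proof (cases "\<one> \<in> J")
      case True
      then obtain z where z: "(\<one>, z) \<in> G" using G(3) by force
      have "v = r \<odot>\<^bsub>M\<^esub> z" if rv: "(r, v) \<in> G" for r v
        using GD(5)[OF GD(1)[OF rv] z] GD(1)[OF rv] M.linear_graph_unique[OF G(1) ZE(1) rv] by simp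
      then show ?thesis using GD(2)[OF z] by blast
    next
      case oneJ: False
      obtain y where y: "y \<in> carrier R" "y \<notin> J" "\<And>r. r \<in> \<mm> \<Longrightarrow> r \<otimes> y \<in> J"
        using colon_max[OF J.is_ideal False oneJ] by blast
      \<comment> \<open>These are the values that an extension to \<open>y\<close> must respect:
        \<open>r\<close> goes to the value of \<open>G\<close> at \<open>r y\<close>.\<close>
      define H where "H = {(r, v). r \<in> \<mm> \<and> (r \<otimes> y, v) \<in> G}"
      have "linear_graph R M Z H"
        unfolding linear_graph_def
      proof (intro conjI allI impI ballI)
        show "H \<subseteq> carrier R \<times> Z" using GD(2) max.Icarr by (auto simp: H_def)
        show "(\<zero>, \<zero>\<^bsub>M\<^esub>) \<in> H" using GD(3) y(1) by (simp add: H_def)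
        show "(r \<oplus> s, v \<oplus>\<^bsub>M\<^esub> w) \<in> H" if "(r, v) \<in> H" "(s, w) \<in> H" for r v s w
          using that GD(4)[of "r \<otimes> y" v "s \<otimes> y" w] y(1) max.Icarr by (simp add: H_def l_distr)
        show "(c \<otimes> r, c \<odot>\<^bsub>M\<^esub> v) \<in> H" if "c \<in> carrier R" "(r, v) \<in> H" for c r v
          using that GD(5)[of c "r \<otimes> y" v] y(1) max.Icarr by (simp add: H_def m_assoc max.I_l_closed)
        show "v = \<zero>\<^bsub>M\<^esub>" if "(\<zero>, v) \<in> H" for v
          using that GD(6) y(1) by (simp add: H_def)
      qed
      moreover have "fst ` H = \<mm>"
      proof (intro equalityI subsetI)
        show "r \<in> \<mm>" if "r \<in> fst ` H" for r using that by (auto simp: H_def)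
        show "r \<in> fst ` H" if r: "r \<in> \<mm>" for r
        proof -
          obtain v where "(r \<otimes> y, v) \<in> G" using y(3)[OF r] G(3) by auto
          then have "(r, v) \<in> H" using r by (simp add: H_def)
          then show ?thesis by (metis fst_conv imageI)
        qed
      qed
      ultimately obtain z where z: "z \<in> Z" "\<And>r v. (r, v) \<in> H \<Longrightarrow> v = r \<odot>\<^bsub>M\<^esub> z"
        using ext[of H] by blast
      note zM = Zc[OF z(1)]
      \<comment> \<open>The sum of \<open>G\<close> and the map \<open>s y\<close> to
        \<open>s z\<close>, with domain \<open>J + R y\<close>. The choice of \<open>z\<close>
        enters in its single-valuedness.\<close>
      let ?G = "{(a \<oplus> s \<otimes> y, v \<oplus>\<^bsub>M\<^esub> s \<odot>\<^bsub>M\<^esub> z) | a v s. (a, v) \<in> G \<and> s \<in> carrier R}"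
      have "linear_graph R M Z ?G"
        unfolding linear_graph_def
      proof (intro conjI allI impI ballI)
        show "?G \<subseteq> carrier R \<times> Z" using GD(1,2) y(1) z(1) ZE(4,5) by auto
        show "(\<zero>, \<zero>\<^bsub>M\<^esub>) \<in> ?G"
          using GD(3) y(1) zM by (auto intro!: exI[of _ \<zero>] exI[of _ "\<zero>\<^bsub>M\<^esub>"])
      next
        fix r v s w assume "(r, v) \<in> ?G" "(s, w) \<in> ?G"
        then obtain a v' c b w' d where *: "(a, v') \<in> G" "(b, w') \<in> G" "c \<in> carrier R" "d \<in> carrier R"
          "r = a \<oplus> c \<otimes> y" "v = v' \<oplus>\<^bsub>M\<^esub> c \<odot>\<^bsub>M\<^esub> z" "s = b \<oplus> d \<otimes> y" "w = w' \<oplus>\<^bsub>M\<^esub> d \<odot>\<^bsub>M\<^esub> z" by blast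
        have "r \<oplus> s = (a \<oplus> b) \<oplus> (c \<oplus> d) \<otimes> y"
          using * GD(1) y(1) by (simp add: l_distr a_ac)
        moreover have "v \<oplus>\<^bsub>M\<^esub> w = (v' \<oplus>\<^bsub>M\<^esub> w') \<oplus>\<^bsub>M\<^esub> (c \<oplus> d) \<odot>\<^bsub>M\<^esub> z"
          using * Zc[OF GD(2)] zM by (simp add: M.smult_l_distr M.a_ac)
        ultimately show "(r \<oplus> s, v \<oplus>\<^bsub>M\<^esub> w) \<in> ?G"
          using GD(4)[OF *(1,2)] *(3,4) by blast
      next
        fix c r v assume c: "c \<in> carrier R" and "(r, v) \<in> ?G"
        then obtain a v' s where *: "(a, v') \<in> G" "s \<in> carrier R"
          "r = a \<oplus> s \<otimes> y" "v = v' \<oplus>\<^bsub>M\<^esub> s \<odot>\<^bsub>M\<^esub> z" by blast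
        have "c \<otimes> r = c \<otimes> a \<oplus> (c \<otimes> s) \<otimes> y"
          using * GD(1) y(1) c by (simp add: r_distr m_assoc)
        moreover have "c \<odot>\<^bsub>M\<^esub> v = c \<odot>\<^bsub>M\<^esub> v' \<oplus>\<^bsub>M\<^esub> (c \<otimes> s) \<odot>\<^bsub>M\<^esub> z"
          using * Zc[OF GD(2)] zM c by (simp add: M.smult_r_distr M.smult_assoc1)
        ultimately show "(c \<otimes> r, c \<odot>\<^bsub>M\<^esub> v) \<in> ?G"
          using GD(5)[OF c *(1)] *(2) c by blast
      next
        fix v assume "(\<zero>, v) \<in> ?G"
        then obtain a v' s where *: "(a, v') \<in> G" "s \<in> carrier R"
          "\<zero> = a \<oplus> s \<otimes> y" "v = v' \<oplus>\<^bsub>M\<^esub> s \<odot>\<^bsub>M\<^esub> z" by blast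
        have aJ: "a \<in> J" using *(1) G(3) by (metis fst_conv imageI)
        note aR = J.Icarr[OF aJ]
        have "s \<otimes> y = \<ominus> a" using *(2,3) aR y(1) by (metis m_closed minus_equality a_comm)
        then have sJ: "s \<otimes> y \<in> J" using aJ J.a_inv_closed by (simp add: a_inv_def)
        \<comment> \<open>A unit \<open>s\<close> would put \<open>y\<close> into \<open>J\<close>.
          So every relation \<open>a + s y = 0\<close> has \<open>s\<close> in \<open>\<mm>\<close>,
          where \<open>s z\<close> agrees with the value of \<open>G\<close> at
          \<open>s y\<close>.\<close>
        have "s \<in> \<mm>"
        proof (rule ccontr)
          assume "s \<notin> \<mm>"
          then have s: "s \<in> Units R" using nonmember_unit *(2) by blast
          then have "inv s \<otimes> (s \<otimes> y) = y"
            using y(1) by (rule Units_inv_mult_cancel)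
          then show False using J.I_l_closed[OF sJ Units_inv_closed[OF s]] y(2) by simp
        qed
        obtain w where "(s \<otimes> y, w) \<in> G" using sJ G(3) by auto
        moreover from this have "w = s \<odot>\<^bsub>M\<^esub> z"
          using z(2) \<open>s \<in> \<mm>\<close> by (simp add: H_def)
        ultimately have "(\<zero>, v) \<in> G" using GD(4)[OF *(1)] *(3,4) by metis
        then show "v = \<zero>\<^bsub>M\<^esub>" by (rule GD(6))
      qed
      moreover have "G \<subseteq> ?G"
      proof
        fix p assume p: "p \<in> G"
        obtain a v where av: "p = (a, v)" by fastforce
        have G: "(a, v) \<in> G" using p av by simp
        have "p = (a \<oplus> \<zero> \<otimes> y, v \<oplus>\<^bsub>M\<^esub> \<zero> \<odot>\<^bsub>M\<^esub> z)"
          using G av GD(1) Zc[OF GD(2)] y(1) zM by simp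
        then show "p \<in> ?G" using G zero_closed by (intro CollectI exI conjI)
      qed
      moreover have "(y, z) \<in> ?G"
      proof -
        have "(y, z) = (\<zero> \<oplus> \<one> \<otimes> y, \<zero>\<^bsub>M\<^esub> \<oplus>\<^bsub>M\<^esub> \<one> \<odot>\<^bsub>M\<^esub> z)" using y(1) zM by simp
        then show ?thesis using GD(3) by blast
      qed
      moreover define G' where "G' = ?G"
      ultimately have G': "linear_graph R M Z G'" "G \<subseteq> G'" "(y, z) \<in> G'" by simp_all
      have "fst ` G' \<in> ?S" using G'(1) order_trans[OF G(2) G'(2)] by blast
      moreover have "J \<subseteq> fst ` G'" unfolding G(3) by (rule image_mono[OF G'(2)])
      moreover have "y \<in> fst ` G'" using G'(3) by (metis fst_conv imageI)
      ultimately show ?thesis using max[of "fst ` G'"] y(2) by blast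
    qed
  qed
  then show "\<exists>z\<in>Z. \<forall>r v. (r, v) \<in> G0 \<longrightarrow> v = r \<odot>\<^bsub>M\<^esub> z" using G(2) by blast
qed

text \<open>
  Dimension shifting: if the second cosyzygy is injective then \<open>Ext\<^sup>2(R/(x, y), Z) = 0\<close>, and \<open>Z\<close>
  is divisible, so \<open>Ext\<^sup>1(R/(x), Z) = 0\<close>; hence \<open>Ext\<^sup>1(k, Z) = 0\<close> where \<open>k \<cong> (x, y)/(x)\<close>.
\<close>

lemma baer_kernel:
  assumes B: "module R B" "baer R B (carrier B)" and C: "module R C"
    and \<delta>: "\<delta> \<in> module_hom R B C"
    and Z: "submodule Z R B" "Z = {b \<in> carrier B. \<delta> b = \<zero>\<^bsub>C\<^esub>}"
    and W: "baer R C (\<delta> ` carrier B)"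
    and div: "\<And>x z. x \<in> carrier R \<Longrightarrow> x \<noteq> \<zero> \<Longrightarrow> z \<in> Z \<Longrightarrow> \<exists>z'\<in>Z. z = x \<odot>\<^bsub>B\<^esub> z'"
  shows "baer R B Z"
proof (rule baer_if_extends_from_max[OF B(1) Z(1)])
  interpret B: module R B by fact
  interpret C: module R C by fact
  fix G assume G: "linear_graph R B Z G" and dom: "fst ` G = \<mm>"
  note h = module_homD[OF \<delta>]
  have Zc: "v \<in> carrier B" if "v \<in> Z" for v using that Z(2) by blast
  have "linear_graph R B (carrier B) G"
    using G Zc unfolding linear_graph_def by blast
  then obtain a where a: "a \<in> carrier B" "\<And>r v. (r, v) \<in> G \<Longrightarrow> v = r \<odot>\<^bsub>B\<^esub> a"
    using B(2) unfolding baer_def by blast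
  \<comment> \<open>\<open>\<mm> a\<close> lies in \<open>Z\<close>, so \<open>\<delta> a\<close>
    spans zero or a copy of \<open>k\<close>; it is the obstruction to taking \<open>a\<close> in
    \<open>Z\<close>.\<close>
  have mb: "r \<odot>\<^bsub>C\<^esub> \<delta> a = \<zero>\<^bsub>C\<^esub>" if r: "r \<in> \<mm>" for r
  proof -
    obtain v where v: "(r, v) \<in> G" using r dom by force
    then have "v \<in> Z" "v = r \<odot>\<^bsub>B\<^esub> a" using linear_graphD(2)[OF G] a(2) by blast+
    then show ?thesis using h(3)[of r a] max.Icarr[OF r] a(1) Z(2) by simp
  qed
  obtain x where x: "x \<in> \<mm>" "x \<noteq> \<zero>" using max_nonzero by blast
  have xR: "x \<in> carrier R" using x(1) max.Icarr by blast
  obtain y where y: "y \<in> carrier R" "\<And>s. s \<in> carrier R \<Longrightarrow> y \<noteq> x \<otimes> s"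
    "\<And>r. r \<in> \<mm> \<Longrightarrow> \<exists>s\<in>carrier R. r \<otimes> y = x \<otimes> s"
    using colon_max_principal[OF x] by blast
  \<comment> \<open>The map on the ideal \<open>(x, y)\<close> with \<open>x\<close> to 0 and
    \<open>y\<close> to \<open>\<delta> a\<close>. It is well defined since a relation
    \<open>r x + s y = 0\<close> forces \<open>s\<close> into \<open>\<mm>\<close>, which kills
    \<open>\<delta> a\<close>.\<close>
  define H where "H = {(r \<otimes> x \<oplus> s \<otimes> y, s \<odot>\<^bsub>C\<^esub> \<delta> a) | r s. r \<in> carrier R \<and> s \<in> carrier R}"
  have HI: "(r \<otimes> x \<oplus> s \<otimes> y, s \<odot>\<^bsub>C\<^esub> \<delta> a) \<in> H" if "r \<in> carrier R" "s \<in> carrier R" for r s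
    using that by (auto simp: H_def)
  have "linear_graph R C (\<delta> ` carrier B) H"
    unfolding linear_graph_def
  proof (intro conjI allI impI ballI)
    have "s \<odot>\<^bsub>C\<^esub> \<delta> a \<in> \<delta> ` carrier B" if "s \<in> carrier R" for s
      using h(3)[OF that a(1)] that a(1) by (metis B.smult_closed imageI)
    then show "H \<subseteq> carrier R \<times> \<delta> ` carrier B" using xR y(1) by (auto simp: H_def)
    show "(\<zero>, \<zero>\<^bsub>C\<^esub>) \<in> H" using HI[of \<zero> \<zero>] xR y(1) h(1)[OF a(1)] by simp
  next
    fix r v s w assume "(r, v) \<in> H" "(s, w) \<in> H"
    then obtain r1 r2 s1 s2 where *: "r1 \<in> carrier R" "r2 \<in> carrier R" "s1 \<in> carrier R" "s2 \<in> carrier R"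
      "r = r1 \<otimes> x \<oplus> r2 \<otimes> y" "v = r2 \<odot>\<^bsub>C\<^esub> \<delta> a" "s = s1 \<otimes> x \<oplus> s2 \<otimes> y" "w = s2 \<odot>\<^bsub>C\<^esub> \<delta> a"
      by (auto simp: H_def)
    have "r \<oplus> s = (r1 \<oplus> s1) \<otimes> x \<oplus> (r2 \<oplus> s2) \<otimes> y" "v \<oplus>\<^bsub>C\<^esub> w = (r2 \<oplus> s2) \<odot>\<^bsub>C\<^esub> \<delta> a"
      using * xR y(1) h(1)[OF a(1)] by (simp_all add: l_distr a_ac C.smult_l_distr)
    then show "(r \<oplus> s, v \<oplus>\<^bsub>C\<^esub> w) \<in> H" using HI * by simp
  next
    fix c r v assume c: "c \<in> carrier R" and "(r, v) \<in> H"
    then obtain r1 r2 where *: "r1 \<in> carrier R" "r2 \<in> carrier R"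
      "r = r1 \<otimes> x \<oplus> r2 \<otimes> y" "v = r2 \<odot>\<^bsub>C\<^esub> \<delta> a"
      by (auto simp: H_def)
    have "c \<otimes> r = (c \<otimes> r1) \<otimes> x \<oplus> (c \<otimes> r2) \<otimes> y" "c \<odot>\<^bsub>C\<^esub> v = (c \<otimes> r2) \<odot>\<^bsub>C\<^esub> \<delta> a"
      using * c xR y(1) h(1)[OF a(1)] by (simp_all add: r_distr m_assoc C.smult_assoc1)
    then show "(c \<otimes> r, c \<odot>\<^bsub>C\<^esub> v) \<in> H" using HI * c by simp
  next
    fix v assume "(\<zero>, v) \<in> H"
    then obtain r s where *: "r \<in> carrier R" "s \<in> carrier R" "\<zero> = r \<otimes> x \<oplus> s \<otimes> y" "v = s \<odot>\<^bsub>C\<^esub> \<delta> a"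
      by (auto simp: H_def)
    have "s \<in> \<mm>"
    proof (rule ccontr)
      assume "s \<notin> \<mm>"
      then have s: "s \<in> Units R" using nonmember_unit *(2) by blast
      have "s \<otimes> y = \<ominus> (r \<otimes> x)" using *(1-3) xR y(1) by (metis m_closed minus_equality a_comm)
      then have "inv s \<otimes> (s \<otimes> y) = inv s \<otimes> (\<ominus> (r \<otimes> x))" by simp
      moreover have "inv s \<otimes> (s \<otimes> y) = y" using s y(1) by (rule Units_inv_mult_cancel)
      ultimately have "y = x \<otimes> (\<ominus> (inv s \<otimes> r))"
        using s *(1) xR by (simp add: r_minus m_ac)
      then show False using y(2) s *(1) by simp
    qed
    then show "v = \<zero>\<^bsub>C\<^esub>" using mb *(4) by simp
  qed
  then obtain b' where b': "b' \<in> \<delta> ` carrier B" "\<And>r v. (r, v) \<in> H \<Longrightarrow> v = r \<odot>\<^bsub>C\<^esub> b'"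
    using W unfolding baer_def by blast
  obtain a' where a': "a' \<in> carrier B" "b' = \<delta> a'" using b'(1) by blast
  have xb: "x \<odot>\<^bsub>C\<^esub> b' = \<zero>\<^bsub>C\<^esub>"
    using b'(2)[OF HI[of \<one> \<zero>]] xR y(1) h(1)[OF a(1)] by simp
  have yb: "y \<odot>\<^bsub>C\<^esub> b' = \<delta> a"
    using b'(2)[OF HI[of \<zero> \<one>]] xR y(1) h(1)[OF a(1)] by simp
  have "x \<odot>\<^bsub>B\<^esub> a' \<in> Z" using xb h(3)[OF xR a'(1)] a' xR Z(2) by simp
  then obtain z' where z': "z' \<in> Z" "x \<odot>\<^bsub>B\<^esub> a' = x \<odot>\<^bsub>B\<^esub> z'" using div[OF xR x(2)] by blast
  have z'B: "z' \<in> carrier B" "\<delta> z' = \<zero>\<^bsub>C\<^esub>" using z'(1) Z(2) by blast+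
  \<comment> \<open>The correction \<open>c\<close> has the same image under \<open>\<delta>\<close>
    as \<open>a\<close> and is killed by \<open>\<mm>\<close>: for \<open>r\<close> in
    \<open>\<mm>\<close> one has \<open>r y = x s\<close>, and \<open>x (a' - z') = 0\<close>. Hence
    \<open>a - c\<close> lies in \<open>Z\<close> and still represents \<open>G\<close>.\<close>
  define c where "c = y \<odot>\<^bsub>B\<^esub> (a' \<ominus>\<^bsub>B\<^esub> z')"
  have cB: "c \<in> carrier B" using y(1) a'(1) z'B(1) by (simp add: c_def)
  have "\<delta> c = \<delta> a"
    unfolding c_def
    using h(3)[OF y(1), of "a' \<ominus>\<^bsub>B\<^esub> z'"] module_hom_diff[OF B(1) C \<delta> a'(1) z'B(1)] a' z'B yb h(1)[OF a'(1)]
    by simp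
  then have "\<delta> (a \<ominus>\<^bsub>B\<^esub> c) = \<zero>\<^bsub>C\<^esub>"
    using module_hom_diff[OF B(1) C \<delta> a(1) cB] h(1)[OF a(1)] by (simp add: a_minus_def C.r_neg)
  then have zZ: "a \<ominus>\<^bsub>B\<^esub> c \<in> Z" using Z(2) a(1) cB by simp
  have "v = r \<odot>\<^bsub>B\<^esub> (a \<ominus>\<^bsub>B\<^esub> c)" if rv: "(r, v) \<in> G" for r v
  proof -
    have r: "r \<in> \<mm>" using rv dom by (metis fst_conv imageI)
    then have rR: "r \<in> carrier R" using max.Icarr by blast
    obtain s where s: "s \<in> carrier R" "r \<otimes> y = x \<otimes> s" using y(3)[OF r] by blast
    have "r \<odot>\<^bsub>B\<^esub> c = (r \<otimes> y) \<odot>\<^bsub>B\<^esub> (a' \<ominus>\<^bsub>B\<^esub> z')"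
      using rR y(1) a'(1) z'B(1) by (simp add: c_def B.smult_assoc1)
    also have "\<dots> = s \<odot>\<^bsub>B\<^esub> (x \<odot>\<^bsub>B\<^esub> (a' \<ominus>\<^bsub>B\<^esub> z'))"
      using s xR a'(1) z'B(1) by (simp add: m_comm[of x s] B.smult_assoc1)
    also have "\<dots> = \<zero>\<^bsub>B\<^esub>"
      using B.smult_r_diff[OF xR a'(1) z'B(1)] z'(2) s(1) xR z'B(1) by simp
    finally show ?thesis
      using B.smult_r_diff[OF rR a(1) cB] a(2)[OF rv] rR a(1) by simp
  qed
  then show "\<exists>z\<in>Z. \<forall>r v. (r, v) \<in> G \<longrightarrow> v = r \<odot>\<^bsub>B\<^esub> z" using zZ by blast
qed

end

text \<open>
  A Gorenstein local ring of dimension one has an exact sequence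
  \<open>0 \<rightarrow> R \<rightarrow> A \<rightarrow> \<delta> A \<rightarrow> 0\<close> with \<open>A\<close> and \<open>\<delta> A\<close> injective.
\<close>

locale one_dim_gorenstein_domain = one_dim_local_domain R \<mm> + A: module R A + B: module R B
  for R :: "('a, 'b) ring_scheme" (structure) and \<mm> and A :: "('a, 'i) module" and B :: "('a, 'i) module" +
  fixes \<epsilon> \<delta>
  assumes \<epsilon>_hom: "\<epsilon> \<in> module_hom R (regular_module R) A" and \<epsilon>_inj: "inj_on \<epsilon> (carrier R)"
    and \<delta>_hom: "\<delta> \<in> module_hom R A B"
    and exact: "\<epsilon> ` carrier R = {x \<in> carrier A. \<delta> x = \<zero>\<^bsub>B\<^esub>}"
    and baer_A: "baer R A (carrier A)" and baer_image: "baer R B (\<delta> ` carrier A)"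

lemma submodule_image:
  assumes "module R M" "module R N" "f \<in> module_hom R M N"
  shows "submodule (f ` carrier M) R N"
proof -
  interpret M: module R M by fact
  interpret N: module R N by fact
  note f = module_homD[OF assms(3)]
  show ?thesis
  proof (rule N.submoduleI)
    show "f ` carrier M \<subseteq> carrier N" using f(1) by blast
    show "\<zero>\<^bsub>N\<^esub> \<in> f ` carrier M" using module_hom_zero[OF assms] by (metis M.zero_closed imageI)
    fix a b assume "a \<in> f ` carrier M" "b \<in> f ` carrier M"
    then show "a \<oplus>\<^bsub>N\<^esub> b \<in> f ` carrier M" by (auto simp flip: f(2))
  next
    fix r a assume "r \<in> carrier R" "a \<in> f ` carrier M"
    then show "r \<odot>\<^bsub>N\<^esub> a \<in> f ` carrier M" by (auto simp flip: f(3))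
  next
    fix a assume a: "a \<in> f ` carrier M"
    then obtain x where x: "x \<in> carrier M" "a = f x" by blast
    have "\<ominus>\<^bsub>N\<^esub> a = f ((\<ominus>\<^bsub>R\<^esub> \<one>\<^bsub>R\<^esub>) \<odot>\<^bsub>M\<^esub> x)"
      using x f(1)[OF x(1)] by (subst f(3)) (simp_all add: N.smult_l_minus)
    then show "\<ominus>\<^bsub>N\<^esub> a \<in> f ` carrier M" using x(1) by simp
  qed
qed

text \<open>Descending induction along the resolution: the images of the differentials vanish far
  out, and \<open>baer_kernel\<close> passes from the image of a differential to its kernel, which
  is the preceding image. The divisibility required there is inherited from \<open>I j\<close>. The
  resolution can then be cut off at the image of \<open>d 0\<close>.\<close>

lemma (in one_dim_local_domain) gorenstein_one_dim:
  assumes "gorenstein_local_ring TYPE('i) R"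
  obtains A B :: "('a, 'i) module" and \<epsilon> \<delta> where "one_dim_gorenstein_domain R \<mm> A B \<epsilon> \<delta>"
proof -
  obtain n and I :: "nat \<Rightarrow> ('a, 'i) module" and \<epsilon> d
    where res: "injective_resolution R (regular_module R) I \<epsilon> d"
      and zero: "\<And>j. j > n \<Longrightarrow> carrier (I j) = {\<zero>\<^bsub>I j\<^esub>}"
    using assms unfolding gorenstein_local_ring_def finite_injective_dimension_def by blast
  have inj: "injective_module R (I j)" and hom: "d j \<in> module_hom R (I j) (I (Suc j))"
    and ex: "d j ` carrier (I j) = {x \<in> carrier (I (Suc j)). d (Suc j) x = \<zero>\<^bsub>I (Suc (Suc j))\<^esub>}" for j
    using res unfolding injective_resolution_def by blast+
  have mod: "module R (I j)" for j using inj by (simp add: injective_module_def)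
  have sub: "submodule (d j ` carrier (I j)) R (I (Suc j))" for j
    by (rule submodule_image[OF mod mod hom])
  have "baer R (I (Suc j)) (d j ` carrier (I j))" for j
  proof -
    \<comment> \<open>The induction starts at \<open>max n j\<close>, whose successor exceeds
      \<open>n\<close>, so that the image there is zero.\<close>
    have "j \<le> max n j" by simp
    then show ?thesis
    proof (induction j rule: inc_induct)
      case base
      let ?k = "max n j"
      have "carrier (I (Suc ?k)) = {\<zero>\<^bsub>I (Suc ?k)\<^esub>}" by (rule zero) simp
      then have im: "d ?k ` carrier (I ?k) = {\<zero>\<^bsub>I (Suc ?k)\<^esub>}"
        using module.submoduleE(1,2)[OF mod sub[of ?k]] by (simp add: subset_singleton_iff)
      interpret I: module R "I (Suc ?k)" by (rule mod)
      show ?case unfolding im baer_def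
        using linear_graphD(1,2) by fastforce
    next
      case (step j)
      show ?case
      proof (rule baer_kernel[OF mod injective_module_baer[OF inj] mod hom sub ex step.IH])
        fix x z assume x: "x \<in> carrier R" "x \<noteq> \<zero>" and "z \<in> d j ` carrier (I j)"
        then obtain a where a: "a \<in> carrier (I j)" "z = d j a" by blast
        obtain a' where "a' \<in> carrier (I j)" "a = x \<odot>\<^bsub>I j\<^esub> a'"
          by (rule baer_divisible[OF mod module.carrier_is_submodule[OF mod] domain_axioms
                injective_module_baer[OF inj] x a(1)])
        then show "\<exists>z'\<in>d j ` carrier (I j). z = x \<odot>\<^bsub>I (Suc j)\<^esub> z'"
          using a(2) module_homD(3)[OF hom x(1)] by blast
      qed
    qed
  qed
  then have "one_dim_gorenstein_domain R \<mm> (I 0) (I (Suc 0)) \<epsilon> (d 0)"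
    using res mod injective_module_baer[OF inj]
    unfolding one_dim_gorenstein_domain_def one_dim_gorenstein_domain_axioms_def injective_resolution_def
    by (simp add: one_dim_local_domain_axioms)
  then show thesis by (rule that)
qed

section \<open>Stability of nonfree modules under the endomorphism ring\<close>

context one_dim_gorenstein_domain
begin

definition linear_on_vectors :: "(('d \<Rightarrow> 'a) \<Rightarrow> 'i) \<Rightarrow> bool"
  where "linear_on_vectors T \<longleftrightarrow>
    (\<forall>y\<in>UNIV \<rightarrow> carrier R. T y \<in> carrier A) \<and>
    (\<forall>y\<in>UNIV \<rightarrow> carrier R. \<forall>y'\<in>UNIV \<rightarrow> carrier R. T (\<lambda>i. y i \<oplus> y' i) = T y \<oplus>\<^bsub>A\<^esub> T y') \<and>
    (\<forall>c\<in>carrier R. \<forall>y\<in>UNIV \<rightarrow> carrier R. T (\<lambda>i. c \<otimes> y i) = c \<odot>\<^bsub>A\<^esub> T y)"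

text \<open>A homomorphism from a submodule of \<open>R\<^sup>D\<close> to the first cosyzygy.
  Vectors are functions on the whole index type; the last condition makes the value depend on the
  coordinates in \<open>D\<close> alone.\<close>

definition vector_graph :: "'d set \<Rightarrow> (('d \<Rightarrow> 'a) \<times> 'i) set \<Rightarrow> bool"
  where "vector_graph D G \<longleftrightarrow> G \<subseteq> (UNIV \<rightarrow> carrier R) \<times> \<delta> ` carrier A \<and> ((\<lambda>i. \<zero>), \<zero>\<^bsub>B\<^esub>) \<in> G \<and>
    (\<forall>y v y' v'. (y, v) \<in> G \<longrightarrow> (y', v') \<in> G \<longrightarrow> (\<lambda>i. y i \<oplus> y' i, v \<oplus>\<^bsub>B\<^esub> v') \<in> G) \<and>
    (\<forall>c\<in>carrier R. \<forall>y v. (y, v) \<in> G \<longrightarrow> (\<lambda>i. c \<otimes> y i, c \<odot>\<^bsub>B\<^esub> v) \<in> G) \<and>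
    (\<forall>y v. (y, v) \<in> G \<longrightarrow> (\<forall>i\<in>D. y i = \<zero>) \<longrightarrow> v = \<zero>\<^bsub>B\<^esub>)"

lemma linear_on_vectorsD:
  assumes "linear_on_vectors T"
  shows "y \<in> UNIV \<rightarrow> carrier R \<Longrightarrow> T y \<in> carrier A"
    and "y \<in> UNIV \<rightarrow> carrier R \<Longrightarrow> y' \<in> UNIV \<rightarrow> carrier R \<Longrightarrow> T (\<lambda>i. y i \<oplus> y' i) = T y \<oplus>\<^bsub>A\<^esub> T y'"
    and "c \<in> carrier R \<Longrightarrow> y \<in> UNIV \<rightarrow> carrier R \<Longrightarrow> T (\<lambda>i. c \<otimes> y i) = c \<odot>\<^bsub>A\<^esub> T y"
  using assms unfolding linear_on_vectors_def by blast+

lemma vector_graphD: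
  assumes "vector_graph D G"
  shows "(y, v) \<in> G \<Longrightarrow> y \<in> UNIV \<rightarrow> carrier R" and "(y, v) \<in> G \<Longrightarrow> v \<in> \<delta> ` carrier A"
    and "((\<lambda>i. \<zero>), \<zero>\<^bsub>B\<^esub>) \<in> G"
    and "(y, v) \<in> G \<Longrightarrow> (y', v') \<in> G \<Longrightarrow> (\<lambda>i. y i \<oplus> y' i, v \<oplus>\<^bsub>B\<^esub> v') \<in> G"
    and "c \<in> carrier R \<Longrightarrow> (y, v) \<in> G \<Longrightarrow> (\<lambda>i. c \<otimes> y i, c \<odot>\<^bsub>B\<^esub> v) \<in> G"
    and "(y, v) \<in> G \<Longrightarrow> \<forall>i\<in>D. y i = \<zero> \<Longrightarrow> v = \<zero>\<^bsub>B\<^esub>"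
  using assms unfolding vector_graph_def by blast+

text \<open>Injectivity of the first cosyzygy is extended from ideals to submodules of
  \<open>R\<^sup>D\<close> one coordinate at a time, and the result is lifted to \<open>A\<close>
  along the way. Once an extension for the vectors with \<open>y i = 0\<close> is subtracted, what
  remains depends on \<open>y i\<close> only and is a map from an ideal.\<close>

lemma vector_graph_extends:
  fixes D :: "'d set"
  assumes "finite D" "vector_graph D G"
  shows "\<exists>T. linear_on_vectors T \<and> (\<forall>y v. (y, v) \<in> G \<longrightarrow> \<delta> (T y) = v)"
  using assms
proof (induction D arbitrary: G)
  case empty
  have "linear_on_vectors (\<lambda>y. \<zero>\<^bsub>A\<^esub>)" by (simp add: linear_on_vectors_def)
  moreover have "\<delta> \<zero>\<^bsub>A\<^esub> = v" if "(y, v) \<in> G" for y v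
    using vector_graphD(6)[OF empty that] module_hom_zero[OF A.module_axioms B.module_axioms \<delta>_hom] by simp
  ultimately show ?case by (intro exI[of _ "\<lambda>y. \<zero>\<^bsub>A\<^esub>"]) simp
next
  case (insert i D)
  note GD = vector_graphD[OF insert.prems]
  note d = module_homD[OF \<delta>_hom]
  have Gi: "y j \<in> carrier R" if "(y, v) \<in> G" for y v j using GD(1)[OF that] by auto
  have Zsub: "submodule (\<delta> ` carrier A) R B"
    by (rule submodule_image[OF A.module_axioms B.module_axioms \<delta>_hom])
  note Z = B.submoduleE[OF Zsub]
  have Gv: "v \<in> carrier B" if "(y, v) \<in> G" for y v using GD(2)[OF that] Z(1) by blast
  let ?G0 = "{(y, v). (y, v) \<in> G \<and> y i = \<zero>}"
  have "vector_graph D ?G0"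
    unfolding vector_graph_def
  proof (intro conjI allI impI ballI)
    show "?G0 \<subseteq> (UNIV \<rightarrow> carrier R) \<times> \<delta> ` carrier A" using GD(1,2) by auto
    show "((\<lambda>i. \<zero>), \<zero>\<^bsub>B\<^esub>) \<in> ?G0" using GD(3) by simp
    show "(\<lambda>i. y i \<oplus> y' i, v \<oplus>\<^bsub>B\<^esub> v') \<in> ?G0" if "(y, v) \<in> ?G0" "(y', v') \<in> ?G0" for y v y' v'
      using that GD(4)[of y v y' v'] by simp
    show "(\<lambda>i. c \<otimes> y i, c \<odot>\<^bsub>B\<^esub> v) \<in> ?G0" if "c \<in> carrier R" "(y, v) \<in> ?G0" for c y v
      using that GD(5)[of c y v] by simp
    show "v = \<zero>\<^bsub>B\<^esub>" if "(y, v) \<in> ?G0" "\<forall>i\<in>D. y i = \<zero>" for y v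
      using that GD(6)[of y v] by simp
  qed
  then obtain T0 where T0: "linear_on_vectors T0" "\<And>y v. (y, v) \<in> G \<Longrightarrow> y i = \<zero> \<Longrightarrow> \<delta> (T0 y) = v"
    using insert.IH[of ?G0] by auto
  note T = linear_on_vectorsD[OF T0(1)]
  define H where "H = {(y i, v \<ominus>\<^bsub>B\<^esub> \<delta> (T0 y)) | y v. (y, v) \<in> G}"
  have HI: "(y i, v \<ominus>\<^bsub>B\<^esub> \<delta> (T0 y)) \<in> H" if "(y, v) \<in> G" for y v using that by (auto simp: H_def)
  have dT: "\<delta> (T0 y) \<in> carrier B" if "(y, v) \<in> G" for y v using d(1) T(1) GD(1)[OF that] by blast
  have "linear_graph R B (\<delta> ` carrier A) H"
    unfolding linear_graph_def
  proof (intro conjI allI impI ballI)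
    have "v \<ominus>\<^bsub>B\<^esub> \<delta> (T0 y) \<in> \<delta> ` carrier A" if "(y, v) \<in> G" for y v
      using B.submodule_diff[OF Zsub GD(2)[OF that]] T(1) GD(1)[OF that] by blast
    then show "H \<subseteq> carrier R \<times> \<delta> ` carrier A" using Gi by (auto simp: H_def)
    have z: "\<delta> (T0 (\<lambda>i. \<zero>)) = \<zero>\<^bsub>B\<^esub>" using T0(2)[OF GD(3)] by simp
    then show "(\<zero>, \<zero>\<^bsub>B\<^esub>) \<in> H" using HI[OF GD(3)] by simp
  next
    fix r v s w assume "(r, v) \<in> H" "(s, w) \<in> H"
    then obtain y v' y' w' where *: "(y, v') \<in> G" "(y', w') \<in> G"
      "r = y i" "v = v' \<ominus>\<^bsub>B\<^esub> \<delta> (T0 y)" "s = y' i" "w = w' \<ominus>\<^bsub>B\<^esub> \<delta> (T0 y')" by (auto simp: H_def)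
    have "\<delta> (T0 (\<lambda>i. y i \<oplus> y' i)) = \<delta> (T0 y) \<oplus>\<^bsub>B\<^esub> \<delta> (T0 y')"
      using T(2)[OF GD(1)[OF *(1)] GD(1)[OF *(2)]] d(2)[OF T(1)[OF GD(1)[OF *(1)]] T(1)[OF GD(1)[OF *(2)]]]
      by simp
    moreover have "v \<oplus>\<^bsub>B\<^esub> w = (v' \<oplus>\<^bsub>B\<^esub> w') \<ominus>\<^bsub>B\<^esub> (\<delta> (T0 y) \<oplus>\<^bsub>B\<^esub> \<delta> (T0 y'))"
      using * Gv dT by (simp add: a_minus_def B.M.minus_add B.M.a_ac)
    ultimately show "(r \<oplus> s, v \<oplus>\<^bsub>B\<^esub> w) \<in> H" using HI[OF GD(4)[OF *(1,2)]] *(3,5) by simp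
  next
    fix c r v assume c: "c \<in> carrier R" and "(r, v) \<in> H"
    then obtain y v' where *: "(y, v') \<in> G" "r = y i" "v = v' \<ominus>\<^bsub>B\<^esub> \<delta> (T0 y)" by (auto simp: H_def)
    have "\<delta> (T0 (\<lambda>i. c \<otimes> y i)) = c \<odot>\<^bsub>B\<^esub> \<delta> (T0 y)"
      using T(3)[OF c GD(1)[OF *(1)]] d(3)[OF c T(1)[OF GD(1)[OF *(1)]]] by simp
    moreover have "c \<odot>\<^bsub>B\<^esub> v = c \<odot>\<^bsub>B\<^esub> v' \<ominus>\<^bsub>B\<^esub> c \<odot>\<^bsub>B\<^esub> \<delta> (T0 y)"
      using * c Gv dT by (simp add: B.smult_r_diff)
    ultimately show "(c \<otimes> r, c \<odot>\<^bsub>B\<^esub> v) \<in> H" using HI[OF GD(5)[OF c *(1)]] *(2) by simp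
  next
    fix v assume "(\<zero>, v) \<in> H"
    then obtain y v' where *: "(y, v') \<in> G" "y i = \<zero>" "v = v' \<ominus>\<^bsub>B\<^esub> \<delta> (T0 y)" by (auto simp: H_def)
    then show "v = \<zero>\<^bsub>B\<^esub>" using T0(2) Gv by simp
  qed
  then obtain z where z: "z \<in> \<delta> ` carrier A" "\<And>r v. (r, v) \<in> H \<Longrightarrow> v = r \<odot>\<^bsub>B\<^esub> z"
    using baer_image unfolding baer_def by blast
  obtain u where u: "u \<in> carrier A" "z = \<delta> u" using z(1) by blast
  define S where "S y = T0 y \<oplus>\<^bsub>A\<^esub> y i \<odot>\<^bsub>A\<^esub> u" for y
  have yi: "y i \<in> carrier R" if "y \<in> UNIV \<rightarrow> carrier R" for y :: "'d \<Rightarrow> 'a" using that by auto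
  have "linear_on_vectors S"
    unfolding linear_on_vectors_def S_def using T u(1) yi
    by (simp add: A.smult_l_distr A.smult_r_distr A.smult_assoc1 A.M.a_ac)
  moreover have "\<delta> (S y) = v" if yv: "(y, v) \<in> G" for y v
  proof -
    have "\<delta> (S y) = \<delta> (T0 y) \<oplus>\<^bsub>B\<^esub> y i \<odot>\<^bsub>B\<^esub> z"
      using d(2)[OF T(1)[OF GD(1)[OF yv]], of "y i \<odot>\<^bsub>A\<^esub> u"] d(3)[of "y i" u] u Gi[OF yv] by (simp add: S_def)
    also have "y i \<odot>\<^bsub>B\<^esub> z = v \<ominus>\<^bsub>B\<^esub> \<delta> (T0 y)" using z(2)[OF HI[OF yv]] by simp
    also have "\<delta> (T0 y) \<oplus>\<^bsub>B\<^esub> \<dots> = v"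
      using Gv[OF yv] dT[OF yv] by (simp add: a_minus_def B.M.a_lcomm B.M.r_neg)
    finally show ?thesis .
  qed
  ultimately show ?case by blast
qed

abbreviation forms :: "('a, 'm, 'x) module_scheme \<Rightarrow> ('m \<Rightarrow> 'a) set"
  where "forms M \<equiv> module_hom R M (regular_module R)"

text \<open>With \<open>A\<close> in the role of \<open>K\<close> and \<open>u\<close> in that of
  \<open>1/x\<close>, the element \<open>y u\<close> is \<open>y/x\<close>: since
  \<open>r y = x s\<close> for \<open>r\<close> in \<open>\<mm>\<close>, its multiples by
  \<open>\<mm>\<close> lie in the image of \<open>R\<close>. It does not lie there itself, as
  \<open>y\<close> is not a multiple of \<open>x\<close>.\<close>

lemma exists_socle_element:
  obtains x y u where "x \<in> carrier R" "y \<in> carrier R" "u \<in> carrier A" "\<epsilon> \<one> = x \<odot>\<^bsub>A\<^esub> u"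
    "\<And>s. s \<in> carrier R \<Longrightarrow> y \<noteq> x \<otimes> s"
    "\<And>r. r \<in> \<mm> \<Longrightarrow> r \<odot>\<^bsub>B\<^esub> \<delta> (y \<odot>\<^bsub>A\<^esub> u) = \<zero>\<^bsub>B\<^esub>"
proof -
  interpret max: ideal \<mm> R by (rule ideal_max)
  note e = module_homD[OF \<epsilon>_hom, simplified]
  note d = module_homD[OF \<delta>_hom]
  obtain x where xm: "x \<in> \<mm>" and x0: "x \<noteq> \<zero>" using max_nonzero by blast
  have x: "x \<in> carrier R" using xm max.Icarr by blast
  obtain y where y: "y \<in> carrier R" "\<And>s. s \<in> carrier R \<Longrightarrow> y \<noteq> x \<otimes> s"
    and ann: "\<And>r. r \<in> \<mm> \<Longrightarrow> \<exists>s\<in>carrier R. r \<otimes> y = x \<otimes> s"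
    using colon_max_principal[OF xm x0] by blast
  obtain u where u: "u \<in> carrier A" "\<epsilon> \<one> = x \<odot>\<^bsub>A\<^esub> u"
    by (rule baer_divisible[OF A.module_axioms A.carrier_is_submodule domain_axioms baer_A x x0, of "\<epsilon> \<one>"])
      (use e(1) in auto)
  have "r \<odot>\<^bsub>B\<^esub> \<delta> (y \<odot>\<^bsub>A\<^esub> u) = \<zero>\<^bsub>B\<^esub>" if r: "r \<in> \<mm>" for r
  proof -
    have rR: "r \<in> carrier R" using r max.Icarr by blast
    obtain s where s: "s \<in> carrier R" "r \<otimes> y = x \<otimes> s" using ann[OF r] by blast
    have "r \<odot>\<^bsub>A\<^esub> (y \<odot>\<^bsub>A\<^esub> u) = (r \<otimes> y) \<odot>\<^bsub>A\<^esub> u" using rR y(1) u(1) by (simp add: A.smult_assoc1)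
    also have "\<dots> = s \<odot>\<^bsub>A\<^esub> \<epsilon> \<one>" using s x u by (simp add: m_comm[of x s] A.smult_assoc1)
    also have "\<dots> = \<epsilon> s" using e(3)[of s \<one>] s(1) by simp
    finally have "r \<odot>\<^bsub>A\<^esub> (y \<odot>\<^bsub>A\<^esub> u) \<in> \<epsilon> ` carrier R" using s(1) by simp
    then have "\<delta> (r \<odot>\<^bsub>A\<^esub> (y \<odot>\<^bsub>A\<^esub> u)) = \<zero>\<^bsub>B\<^esub>" using exact by blast
    then show ?thesis using d(3)[OF rR, of "y \<odot>\<^bsub>A\<^esub> u"] y(1) u(1) by simp
  qed
  then show thesis using that[OF x y(1) u y(2)] by blast
qed

text \<open>
  The fraction \<open>p / q\<close> multiplies \<open>\<mm>\<close> into \<open>R\<close>. If \<open>w = (p / q) x\<close> were not in the image of \<open>M\<close> in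
  the free module \<open>R\<^sup>D\<close>, then \<open>w\<close> would generate a copy of the residue field modulo that image, and
  by injectivity of the first cosyzygy some form of \<open>M\<close> would not take an integral value at \<open>w\<close>.
\<close>

lemma fraction_multiple_in_image:
  fixes M :: "('a, 'm, 'x) module_scheme"
  assumes M: "module R M" and D: "finite D" "D \<subseteq> forms M"
    and pq: "p \<in> carrier R" "q \<in> carrier R" "q \<noteq> \<zero>" "\<And>r. r \<in> \<mm> \<Longrightarrow> \<exists>s\<in>carrier R. p \<otimes> r = q \<otimes> s"
    and x: "x \<in> carrier M" "\<And>f. f \<in> forms M \<Longrightarrow> f x \<in> \<mm>"
  shows "\<exists>x'\<in>carrier M. \<forall>f\<in>D. q \<otimes> f x' = p \<otimes> f x"
proof (rule ccontr)
  assume no: "\<not> ?thesis"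
  interpret M: module R M by (rule M)
  note e = module_homD[OF \<epsilon>_hom, simplified]
  note d = module_homD[OF \<delta>_hom]
  have mod_reg: "module R (regular_module R)" by (rule module_regular) (rule is_cring)
  obtain a b u where a: "a \<in> carrier R" and b: "b \<in> carrier R" and u: "u \<in> carrier A" "\<epsilon> \<one> = a \<odot>\<^bsub>A\<^esub> u"
    and ndiv: "\<And>s. s \<in> carrier R \<Longrightarrow> b \<noteq> a \<otimes> s"
    and socle: "\<And>r. r \<in> \<mm> \<Longrightarrow> r \<odot>\<^bsub>B\<^esub> \<delta> (b \<odot>\<^bsub>A\<^esub> u) = \<zero>\<^bsub>B\<^esub>"
    using exists_socle_element by blast
  define z0 where "z0 = \<delta> (b \<odot>\<^bsub>A\<^esub> u)"
  have z0: "z0 \<in> carrier B" "r \<in> carrier R \<Longrightarrow> r \<odot>\<^bsub>B\<^esub> z0 \<in> \<delta> ` carrier A" for r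
    using d(1,3) b u(1) unfolding z0_def by (auto simp flip: d(3))
  \<comment> \<open>Forms outside \<open>D\<close> are replaced by zero, since vectors are indexed
    by all functions and not by \<open>D\<close> alone.\<close>
  define \<phi> where "\<phi> f y = (if f \<in> D then f y else \<zero>)" for f :: "'m \<Rightarrow> 'a" and y
  have \<phi>: "\<phi> f y \<in> carrier R" "\<phi> f (y \<oplus>\<^bsub>M\<^esub> y') = \<phi> f y \<oplus> \<phi> f y'" "\<phi> f (r \<odot>\<^bsub>M\<^esub> y) = r \<otimes> \<phi> f y"
    "\<phi> f \<zero>\<^bsub>M\<^esub> = \<zero>"
    if "y \<in> carrier M" "y' \<in> carrier M" "r \<in> carrier R" for f y y' r
    using that D(2) module_homD[of f R M "regular_module R"] module_hom_zero[OF M mod_reg, of f]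
    by (auto simp: \<phi>_def)
  define vec where "vec y r = (\<lambda>f. q \<otimes> \<phi> f y \<oplus> r \<otimes> (p \<otimes> \<phi> f x))" for y r
  \<comment> \<open>Everything is scaled by \<open>q\<close>, so that \<open>w\<close> becomes
    \<open>p\<close> times the vector of \<open>x\<close>. The image of \<open>M\<close> goes to 0
    and \<open>w\<close> to \<open>z0\<close>; by assumption \<open>r w\<close> lies in the image of
    \<open>M\<close> only for \<open>r\<close> in \<open>\<mm>\<close>, which kills
    \<open>z0\<close>.\<close>
  define G where "G = {(vec y r, r \<odot>\<^bsub>B\<^esub> z0) | y r. y \<in> carrier M \<and> r \<in> carrier R}"
  have GI: "(vec y r, r \<odot>\<^bsub>B\<^esub> z0) \<in> G" if "y \<in> carrier M" "r \<in> carrier R" for y r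
    using that by (auto simp: G_def)
  have "vector_graph D G"
    unfolding vector_graph_def
  proof (intro conjI allI impI ballI)
    show "G \<subseteq> (UNIV \<rightarrow> carrier R) \<times> \<delta> ` carrier A"
      using \<phi>(1) x(1) pq z0 by (auto simp: G_def vec_def)
    show "((\<lambda>f. \<zero>), \<zero>\<^bsub>B\<^esub>) \<in> G"
      using GI[of "\<zero>\<^bsub>M\<^esub>" \<zero>] \<phi>(1,4) x(1) pq z0(1) by (simp add: vec_def)
  next
    fix y v y' v' assume "(y, v) \<in> G" "(y', v') \<in> G"
    then obtain m r m' r' where *: "m \<in> carrier M" "r \<in> carrier R" "m' \<in> carrier M" "r' \<in> carrier R"
      "y = vec m r" "v = r \<odot>\<^bsub>B\<^esub> z0" "y' = vec m' r'" "v' = r' \<odot>\<^bsub>B\<^esub> z0" by (auto simp: G_def)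
    have "(\<lambda>f. y f \<oplus> y' f) = vec (m \<oplus>\<^bsub>M\<^esub> m') (r \<oplus> r')"
      using * \<phi>(1,2) pq x(1) by (simp add: vec_def l_distr r_distr a_ac)
    moreover have "v \<oplus>\<^bsub>B\<^esub> v' = (r \<oplus> r') \<odot>\<^bsub>B\<^esub> z0" using * z0(1) by (simp add: B.smult_l_distr)
    ultimately show "(\<lambda>f. y f \<oplus> y' f, v \<oplus>\<^bsub>B\<^esub> v') \<in> G" using GI * by simp
  next
    fix c y v assume c: "c \<in> carrier R" and "(y, v) \<in> G"
    then obtain m r where *: "m \<in> carrier M" "r \<in> carrier R" "y = vec m r" "v = r \<odot>\<^bsub>B\<^esub> z0" by (auto simp: G_def)
    have "(\<lambda>f. c \<otimes> y f) = vec (c \<odot>\<^bsub>M\<^esub> m) (c \<otimes> r)"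
      using * c \<phi>(1,3) pq x(1) by (simp add: vec_def r_distr m_ac)
    moreover have "c \<odot>\<^bsub>B\<^esub> v = (c \<otimes> r) \<odot>\<^bsub>B\<^esub> z0" using * c z0(1) by (simp add: B.smult_assoc1)
    ultimately show "(\<lambda>f. c \<otimes> y f, c \<odot>\<^bsub>B\<^esub> v) \<in> G" using GI * c by simp
  next
    fix y v assume "(y, v) \<in> G" and zero: "\<forall>f\<in>D. y f = \<zero>"
    then obtain m r where *: "m \<in> carrier M" "r \<in> carrier R" "y = vec m r" "v = r \<odot>\<^bsub>B\<^esub> z0" by (auto simp: G_def)
    have "r \<in> \<mm>"
    proof (rule ccontr)
      assume "r \<notin> \<mm>"
      then have r: "r \<in> Units R" using nonmember_unit *(2) by blast
      let ?x' = "(\<ominus> (inv r)) \<odot>\<^bsub>M\<^esub> m"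
      have "q \<otimes> f ?x' = p \<otimes> f x" if f: "f \<in> D" for f
      proof -
        note hf = module_homD[OF subsetD[OF D(2) f], simplified]
        have c: "f m \<in> carrier R" "f x \<in> carrier R" using hf(1) *(1) x(1) by blast+
        have "q \<otimes> f m \<oplus> r \<otimes> (p \<otimes> f x) = \<zero>" using zero f *(3) by (auto simp: vec_def \<phi>_def)
        then have eq: "r \<otimes> (p \<otimes> f x) = \<ominus> (q \<otimes> f m)"
          using c *(2) pq by (metis a_comm m_closed minus_equality)
        have "p \<otimes> f x = inv r \<otimes> (r \<otimes> (p \<otimes> f x))"
          using Units_inv_mult_cancel[OF r] c pq by simp
        also have "\<dots> = q \<otimes> ((\<ominus> (inv r)) \<otimes> f m)"
          unfolding eq using r c pq by (simp add: l_minus r_minus m_ac)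
        finally show ?thesis using hf(3)[of "\<ominus> (inv r)" m] r *(1) by simp
      qed
      moreover have "?x' \<in> carrier M" using r *(1) by simp
      ultimately show False using no by blast
    qed
    then show "v = \<zero>\<^bsub>B\<^esub>" using socle *(4) by (simp add: z0_def)
  qed
  then obtain T where T: "linear_on_vectors T" and \<delta>T: "\<And>y v. (y, v) \<in> G \<Longrightarrow> \<delta> (T y) = v"
    using vector_graph_extends[OF D(1)] by blast
  note TD = linear_on_vectorsD[OF T]
  have vecc: "(\<lambda>f. c \<otimes> \<phi> f y) \<in> UNIV \<rightarrow> carrier R" if "y \<in> carrier M" "c \<in> carrier R" for y c
    using \<phi>(1) that by auto
  have im: "T (\<lambda>f. q \<otimes> \<phi> f y) \<in> \<epsilon> ` carrier R" if y: "y \<in> carrier M" for y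
  proof -
    have "vec y \<zero> = (\<lambda>f. q \<otimes> \<phi> f y)" using \<phi>(1) y x(1) pq by (simp add: vec_def)
    then have "\<delta> (T (\<lambda>f. q \<otimes> \<phi> f y)) = \<zero>\<^bsub>B\<^esub>" using \<delta>T[OF GI[OF y, of \<zero>]] z0(1) by simp
    then show ?thesis using exact TD(1) vecc[OF y pq(2)] by blast
  qed
  \<comment> \<open>On \<open>q\<close> times the image of \<open>M\<close> the values of
    \<open>T\<close> lie in the kernel of \<open>\<delta>\<close>, which is a copy of
    \<open>R\<close>. Read in \<open>R\<close> they give the form whose value at \<open>w\<close> is
    examined.\<close>
  define F where "F y = inv_into (carrier R) \<epsilon> (T (\<lambda>f. q \<otimes> \<phi> f y))" for y
  have F: "F y \<in> carrier R" "\<epsilon> (F y) = T (\<lambda>f. q \<otimes> \<phi> f y)" if "y \<in> carrier M" for y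
    using inv_into_into[OF im[OF that]] f_inv_into_f[OF im[OF that]] by (simp_all add: F_def)
  have "F \<in> forms M"
    unfolding module_hom_def
  proof (intro CollectI conjI ballI)
    show "F \<in> carrier M \<rightarrow> carrier (regular_module R)" using F(1) by simp
  next
    fix y y' assume y: "y \<in> carrier M" "y' \<in> carrier M"
    have "\<epsilon> (F (y \<oplus>\<^bsub>M\<^esub> y')) = T (\<lambda>f. q \<otimes> \<phi> f y \<oplus> q \<otimes> \<phi> f y')"
      using F(2)[of "y \<oplus>\<^bsub>M\<^esub> y'"] y \<phi>(1,2) pq by (simp add: r_distr)
    also have "\<dots> = \<epsilon> (F y) \<oplus>\<^bsub>A\<^esub> \<epsilon> (F y')" using TD(2) vecc y pq(2) F(2) by simp
    also have "\<dots> = \<epsilon> (F y \<oplus> F y')" using e(2) F(1) y by simp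
    finally show "F (y \<oplus>\<^bsub>M\<^esub> y') = F y \<oplus>\<^bsub>regular_module R\<^esub> F y'"
      using \<epsilon>_inj F(1) y by (simp add: inj_on_eq_iff)
  next
    fix r y assume r: "r \<in> carrier R" and y: "y \<in> carrier M"
    have "\<epsilon> (F (r \<odot>\<^bsub>M\<^esub> y)) = T (\<lambda>f. r \<otimes> (q \<otimes> \<phi> f y))"
      using F(2)[of "r \<odot>\<^bsub>M\<^esub> y"] r y \<phi>(1,3) pq by (simp add: m_lcomm)
    also have "\<dots> = r \<odot>\<^bsub>A\<^esub> \<epsilon> (F y)" using TD(3) r vecc y pq(2) F(2) by simp
    also have "\<dots> = \<epsilon> (r \<otimes> F y)" using e(3) F(1) r y by simp
    finally show "F (r \<odot>\<^bsub>M\<^esub> y) = r \<odot>\<^bsub>regular_module R\<^esub> F y"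
      using \<epsilon>_inj F(1) r y by (simp add: inj_on_eq_iff)
  qed
  \<comment> \<open>Here the condition on the forms is needed: \<open>F x\<close> lies in
    \<open>\<mm>\<close>, and \<open>p/q\<close> multiplies \<open>\<mm>\<close> into
    \<open>R\<close>.\<close>
  then obtain s where s: "s \<in> carrier R" "p \<otimes> F x = q \<otimes> s" using pq(4) x(2) by blast
  define t where "t = T (\<lambda>f. p \<otimes> \<phi> f x)"
  have t: "t \<in> carrier A" using TD(1) vecc[OF x(1) pq(1)] by (simp add: t_def)
  have "vec \<zero>\<^bsub>M\<^esub> \<one> = (\<lambda>f. p \<otimes> \<phi> f x)" using \<phi>(1,4) x(1) pq by (simp add: vec_def)
  then have "\<delta> t = z0" using \<delta>T[OF GI[of "\<zero>\<^bsub>M\<^esub>" \<one>]] z0(1) by (simp add: t_def)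
  then have "\<delta> (t \<ominus>\<^bsub>A\<^esub> b \<odot>\<^bsub>A\<^esub> u) = \<zero>\<^bsub>B\<^esub>"
    using module_hom_diff[OF A.module_axioms B.module_axioms \<delta>_hom t, of "b \<odot>\<^bsub>A\<^esub> u"] b u(1) z0 by (simp add: z0_def)
  then have "t \<ominus>\<^bsub>A\<^esub> b \<odot>\<^bsub>A\<^esub> u \<in> \<epsilon> ` carrier R" unfolding exact using t b u(1) by simp
  then obtain c where c: "c \<in> carrier R" "t \<ominus>\<^bsub>A\<^esub> b \<odot>\<^bsub>A\<^esub> u = \<epsilon> c" by blast
  have "q \<odot>\<^bsub>A\<^esub> t = T (\<lambda>f. p \<otimes> (q \<otimes> \<phi> f x))"
    using TD(3)[OF pq(2) vecc[OF x(1) pq(1)]] \<phi>(1) x(1) pq by (simp add: t_def m_lcomm)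
  also have "\<dots> = \<epsilon> (q \<otimes> s)"
    using TD(3)[OF pq(1) vecc[OF x(1) pq(2)]] F x(1) e(3)[OF pq(1), of "F x"] s(2) by simp
  finally have qt: "q \<odot>\<^bsub>A\<^esub> t = \<epsilon> (q \<otimes> s)" .
  \<comment> \<open>\<open>A\<close> may have torsion, so \<open>q t = \<epsilon> (q s)\<close> does
    not give \<open>t = \<epsilon> s\<close>. After multiplication by \<open>a q\<close> all terms
    lie in the image of \<open>R\<close>, where they yield \<open>b = a (s - c)\<close>, against the
    choice of \<open>b\<close>.\<close>
  have "\<epsilon> (a \<otimes> (q \<otimes> c)) = (a \<otimes> q) \<odot>\<^bsub>A\<^esub> (t \<ominus>\<^bsub>A\<^esub> b \<odot>\<^bsub>A\<^esub> u)"
    unfolding c(2) using e(3)[of "a \<otimes> q" c] a pq c(1) by (simp add: m_assoc)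
  also have "\<dots> = a \<odot>\<^bsub>A\<^esub> (q \<odot>\<^bsub>A\<^esub> t) \<ominus>\<^bsub>A\<^esub> (b \<otimes> q) \<odot>\<^bsub>A\<^esub> (a \<odot>\<^bsub>A\<^esub> u)"
    using a b pq t u(1) by (simp add: A.smult_r_diff m_ac flip: A.smult_assoc1)
  also have "\<dots> = \<epsilon> (a \<otimes> (q \<otimes> s)) \<ominus>\<^bsub>A\<^esub> \<epsilon> (b \<otimes> q)"
    unfolding qt u(2)[symmetric] using e(3)[OF a, of "q \<otimes> s"] e(3)[of "b \<otimes> q" \<one>] a b pq s(1) by simp
  also have "\<dots> = \<epsilon> (a \<otimes> (q \<otimes> s) \<ominus> b \<otimes> q)"
    using module_hom_diff[OF mod_reg A.module_axioms \<epsilon>_hom, of "a \<otimes> (q \<otimes> s)" "b \<otimes> q"] a b pq s(1)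
    by (simp add: a_minus_def)
  finally have "a \<otimes> (q \<otimes> c) = a \<otimes> (q \<otimes> s) \<ominus> b \<otimes> q"
    using \<epsilon>_inj a b c(1) pq s(1) by (simp add: inj_on_eq_iff)
  then have "q \<otimes> b = q \<otimes> (a \<otimes> (s \<ominus> c))"
    using a b c(1) pq s(1) by algebra
  then have "b = a \<otimes> (s \<ominus> c)"
    using pq(2,3) a b c(1) s(1) m_lcancel[of q] by simp
  then show False using ndiv c(1) s(1) by simp
qed

end

section \<open>Finitely generated modules\<close>

text \<open>Phrased through submodules and not through linear combinations: a property is
  transferred from the generators to \<open>M\<close> by showing that it defines a
  submodule.\<close>

definition generated_by :: "('a, 'b) ring_scheme \<Rightarrow> ('a, 'm, 'x) module_scheme \<Rightarrow> 'm set \<Rightarrow> bool"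
  where "generated_by R M S \<longleftrightarrow>
    S \<subseteq> carrier M \<and> (\<forall>U. submodule U R M \<longrightarrow> S \<subseteq> U \<longrightarrow> carrier M \<subseteq> U)"

lemma (in module) finsum_in_submodule:
  assumes U: "submodule U R M" and "finite A" "\<And>i. i \<in> A \<Longrightarrow> f i \<in> U"
  shows "(\<Oplus>\<^bsub>M\<^esub>i\<in>A. f i) \<in> U"
  using assms(2,3)
proof (induction A)
  case empty
  then show ?case using submodule_zero[OF U] by simp
next
  case (insert i A)
  then have "f \<in> A \<rightarrow> carrier M" "f i \<in> carrier M" using submoduleE(1)[OF U] by auto
  then show ?case using insert submoduleE(5)[OF U] by simp
qed

lemma finitely_generated_generators:
  assumes M: "module R M" and "finitely_generated R M"
  obtains S where "finite S" "generated_by R M S"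
proof -
  interpret module R M by (rule M)
  obtain S where S: "finite S" "S \<subseteq> carrier M"
    "\<And>x. x \<in> carrier M \<Longrightarrow> \<exists>c\<in>S \<rightarrow> carrier R. x = (\<Oplus>\<^bsub>M\<^esub>s\<in>S. c s \<odot>\<^bsub>M\<^esub> s)"
    using assms(2) unfolding finitely_generated_def by blast
  have "x \<in> U" if U: "submodule U R M" "S \<subseteq> U" and x: "x \<in> carrier M" for U x
  proof -
    obtain c where c: "c \<in> S \<rightarrow> carrier R" "x = (\<Oplus>\<^bsub>M\<^esub>s\<in>S. c s \<odot>\<^bsub>M\<^esub> s)" using S(3)[OF x] by blast
    show ?thesis
      unfolding c(2)
      by (rule finsum_in_submodule[OF U(1) S(1)]) (use c(1) submoduleE(4)[OF U(1)] U(2) in auto)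
  qed
  then show thesis using that S(1,2) unfolding generated_by_def by blast
qed

lemma (in abelian_group) diff_eq_diff_if_sums_eq:
  assumes "v \<in> carrier G" "a \<in> carrier G" "w \<in> carrier G" "b \<in> carrier G" "v \<oplus> a = w \<oplus> b"
  shows "a \<ominus> b = w \<ominus> v"
proof -
  have "a = \<ominus> v \<oplus> (w \<oplus> b)" using assms r_neg1[of v a] by simp
  then have "a \<ominus> b = \<ominus> v \<oplus> (w \<oplus> (b \<oplus> \<ominus> b))" using assms(1,3,4) by (simp add: a_minus_def a_assoc)
  then show ?thesis using assms(1,3,4) by (simp add: a_minus_def r_neg a_comm)
qed

lemma (in module) submodule_add_multiples:
  assumes V: "submodule V R M" and x: "x \<in> carrier M"
  shows "submodule {v \<oplus>\<^bsub>M\<^esub> r \<odot>\<^bsub>M\<^esub> x | v r. v \<in> V \<and> r \<in> carrier R} R M" (is "submodule ?W R M")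
proof -
  note VE = submoduleE[OF V]
  have Vc: "v \<in> carrier M" if "v \<in> V" for v using that VE(1) by blast
  have WI: "w \<in> ?W" if "w = v \<oplus>\<^bsub>M\<^esub> r \<odot>\<^bsub>M\<^esub> x" "v \<in> V" "r \<in> carrier R" for w v r using that by blast
  show ?thesis
  proof (rule submoduleI)
    show "?W \<subseteq> carrier M" using Vc x by auto
    show "\<zero>\<^bsub>M\<^esub> \<in> ?W" by (rule WI[of _ "\<zero>\<^bsub>M\<^esub>" \<zero>]) (use x submodule_zero[OF V] in auto)
  next
    fix w assume "w \<in> ?W"
    then obtain v r where *: "w = v \<oplus>\<^bsub>M\<^esub> r \<odot>\<^bsub>M\<^esub> x" "v \<in> V" "r \<in> carrier R" by blast
    show "\<ominus>\<^bsub>M\<^esub> w \<in> ?W"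
      by (rule WI[of _ "\<ominus>\<^bsub>M\<^esub> v" "\<ominus> r"]) (use * x Vc VE(3) in \<open>auto simp: M.minus_add smult_l_minus\<close>)
  next
    fix w w' assume "w \<in> ?W" "w' \<in> ?W"
    then obtain v r v' r' where *: "w = v \<oplus>\<^bsub>M\<^esub> r \<odot>\<^bsub>M\<^esub> x" "v \<in> V" "r \<in> carrier R"
      "w' = v' \<oplus>\<^bsub>M\<^esub> r' \<odot>\<^bsub>M\<^esub> x" "v' \<in> V" "r' \<in> carrier R" by blast
    show "w \<oplus>\<^bsub>M\<^esub> w' \<in> ?W"
      by (rule WI[of _ "v \<oplus>\<^bsub>M\<^esub> v'" "r \<oplus> r'"]) (use * x Vc VE(5) in \<open>auto simp: smult_l_distr M.a_ac\<close>)
  next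
    fix a w assume a: "a \<in> carrier R" and "w \<in> ?W"
    then obtain v r where *: "w = v \<oplus>\<^bsub>M\<^esub> r \<odot>\<^bsub>M\<^esub> x" "v \<in> V" "r \<in> carrier R" by blast
    show "a \<odot>\<^bsub>M\<^esub> w \<in> ?W"
      by (rule WI[of _ "a \<odot>\<^bsub>M\<^esub> v" "a \<otimes> r"])
        (use * a x Vc VE(4) in \<open>auto simp: smult_r_distr smult_assoc1\<close>)
  qed
qed

text \<open>A finitely generated module over a domain embeds, up to torsion, into a free module.\<close>

lemma (in domain) separating_forms_span:
  fixes M :: "('a, 'm, 'x) module_scheme"
  assumes M: "module R M" and S: "finite S" "S \<subseteq> carrier M"
  shows "\<exists>V D d. submodule V R M \<and> S \<subseteq> V \<and> finite D \<and>
    D \<subseteq> module_hom R (M\<lparr>carrier := V\<rparr>) (regular_module R) \<and> d \<in> carrier R \<and> d \<noteq> \<zero> \<and>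
    (\<forall>y\<in>V. (\<forall>f\<in>D. f y = \<zero>) \<longrightarrow> d \<odot>\<^bsub>M\<^esub> y = \<zero>\<^bsub>M\<^esub>)"
  using S
proof (induction S)
  case empty
  interpret M: module R M by (rule M)
  have "submodule {\<zero>\<^bsub>M\<^esub>} R M" by (rule M.submoduleI) auto
  then show ?case
    by (intro exI[of _ "{\<zero>\<^bsub>M\<^esub>}"] exI[of _ "{}"] exI[of _ \<one>]) auto
next
  case (insert x S)
  interpret M: module R M by (rule M)
  obtain V D d where V: "submodule V R M" "S \<subseteq> V" and D: "finite D"
    "D \<subseteq> module_hom R (M\<lparr>carrier := V\<rparr>) (regular_module R)" and d: "d \<in> carrier R" "d \<noteq> \<zero>"
    and sep: "\<And>y. y \<in> V \<Longrightarrow> \<forall>f\<in>D. f y = \<zero> \<Longrightarrow> d \<odot>\<^bsub>M\<^esub> y = \<zero>\<^bsub>M\<^esub>"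
    using insert by blast
  have x: "x \<in> carrier M" using insert.prems by blast
  note VE = M.submoduleE[OF V(1)]
  have Vc: "v \<in> carrier M" if "v \<in> V" for v using that VE(1) by blast
  have f: "f v \<in> carrier R" "f (v \<oplus>\<^bsub>M\<^esub> w) = f v \<oplus> f w" "r \<in> carrier R \<Longrightarrow> f (r \<odot>\<^bsub>M\<^esub> v) = r \<otimes> f v"
    if "f \<in> D" "v \<in> V" "w \<in> V" for f v w r
    using module_homD[OF subsetD[OF D(2) that(1)]] that(2,3) by auto
  define W where "W = {v \<oplus>\<^bsub>M\<^esub> r \<odot>\<^bsub>M\<^esub> x | v r. v \<in> V \<and> r \<in> carrier R}"
  have W: "submodule W R M" unfolding W_def by (rule M.submodule_add_multiples[OF V(1) x])
  have VW: "V \<subseteq> W"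
  proof
    show "v \<in> W" if "v \<in> V" for v
      unfolding W_def using that x Vc by (intro CollectI exI[of _ v] exI[of _ \<zero>]) simp
  qed
  have xW: "x \<in> W"
    unfolding W_def using x M.submodule_zero[OF V(1)]
    by (intro CollectI exI[of _ "\<zero>\<^bsub>M\<^esub>"] exI[of _ \<one>]) simp
  have Wc: "y \<in> carrier M" if "y \<in> W" for y using that M.submoduleE(1)[OF W] by blast
  have xSW: "insert x S \<subseteq> W" using VW V(2) xW by blast
  show ?case
  \<comment> \<open>Either \<open>x\<close> is torsion modulo \<open>V\<close>, and the forms of
    \<open>V\<close> are pulled back along multiplication by some \<open>c\<close>; or
    \<open>V + R x\<close> is a direct sum with \<open>R x\<close> free, and the coefficient of
    \<open>x\<close> is a new form.\<close>
  proof (cases "\<exists>c\<in>carrier R. c \<noteq> \<zero> \<and> c \<odot>\<^bsub>M\<^esub> x \<in> V")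
    case True
    then obtain c where c: "c \<in> carrier R" "c \<noteq> \<zero>" "c \<odot>\<^bsub>M\<^esub> x \<in> V" by blast
    have cW: "c \<odot>\<^bsub>M\<^esub> y \<in> V" if "y \<in> W" for y
    proof -
      obtain v r where v: "v \<in> V" "r \<in> carrier R" "y = v \<oplus>\<^bsub>M\<^esub> r \<odot>\<^bsub>M\<^esub> x" using \<open>y \<in> W\<close> unfolding W_def by blast
      have "c \<odot>\<^bsub>M\<^esub> y = c \<odot>\<^bsub>M\<^esub> v \<oplus>\<^bsub>M\<^esub> r \<odot>\<^bsub>M\<^esub> (c \<odot>\<^bsub>M\<^esub> x)"
        using v c(1) x Vc by (simp add: M.smult_r_distr m_comm[of c r] flip: M.smult_assoc1)
      then show ?thesis using VE(4,5) v(1,2) c by simp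
    qed
    let ?D = "(\<lambda>f y. f (c \<odot>\<^bsub>M\<^esub> y)) ` D"
    have "?D \<subseteq> module_hom R (M\<lparr>carrier := W\<rparr>) (regular_module R)"
    proof
      fix g assume "g \<in> ?D"
      then obtain f' where f': "f' \<in> D" "g = (\<lambda>y. f' (c \<odot>\<^bsub>M\<^esub> y))" by blast
      show "g \<in> module_hom R (M\<lparr>carrier := W\<rparr>) (regular_module R)"
        unfolding module_hom_def
      proof (intro CollectI conjI ballI)
        show "g \<in> carrier (M\<lparr>carrier := W\<rparr>) \<rightarrow> carrier (regular_module R)"
          using f(1)[OF f'(1) cW cW] f'(2) by simp
        show "g (y \<oplus>\<^bsub>M\<lparr>carrier := W\<rparr>\<^esub> z) = g y \<oplus>\<^bsub>regular_module R\<^esub> g z"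
          if "y \<in> carrier (M\<lparr>carrier := W\<rparr>)" "z \<in> carrier (M\<lparr>carrier := W\<rparr>)" for y z
          using that f(2)[OF f'(1) cW cW] f'(2) Wc c(1) by (simp add: M.smult_r_distr)
        show "g (r \<odot>\<^bsub>M\<lparr>carrier := W\<rparr>\<^esub> y) = r \<odot>\<^bsub>regular_module R\<^esub> g y"
          if r: "r \<in> carrier R" and y: "y \<in> carrier (M\<lparr>carrier := W\<rparr>)" for r y
        proof -
          have "c \<odot>\<^bsub>M\<^esub> (r \<odot>\<^bsub>M\<^esub> y) = r \<odot>\<^bsub>M\<^esub> (c \<odot>\<^bsub>M\<^esub> y)"
            using r y c(1) Wc by (simp add: m_comm[of c r] flip: M.smult_assoc1)
          then show ?thesis using f(3)[OF f'(1) cW cW] f'(2) r y by simp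
        qed
      qed
    qed
    moreover have "(d \<otimes> c) \<odot>\<^bsub>M\<^esub> y = \<zero>\<^bsub>M\<^esub>" if "y \<in> W" "\<forall>g\<in>?D. g y = \<zero>" for y
      using sep[OF cW[OF that(1)]] that Wc d(1) c(1) by (simp add: M.smult_assoc1)
    moreover have "d \<otimes> c \<noteq> \<zero>" using d c integral by blast
    ultimately show ?thesis
      using W xSW D(1) d(1) c(1)
      by (intro exI[of _ W] exI[of _ ?D] exI[of _ "d \<otimes> c"] conjI ballI impI) (assumption | simp)+
  next
    case False
    have unique: "v = v' \<and> r = r'"
      if *: "v \<in> V" "v' \<in> V" "r \<in> carrier R" "r' \<in> carrier R"
        "v \<oplus>\<^bsub>M\<^esub> r \<odot>\<^bsub>M\<^esub> x = v' \<oplus>\<^bsub>M\<^esub> r' \<odot>\<^bsub>M\<^esub> x" for v v' r r'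
    proof -
      have "(r \<ominus> r') \<odot>\<^bsub>M\<^esub> x = v' \<ominus>\<^bsub>M\<^esub> v"
        using * x Vc M.diff_eq_diff_if_sums_eq[of v "r \<odot>\<^bsub>M\<^esub> x" v' "r' \<odot>\<^bsub>M\<^esub> x"]
        by (simp add: M.smult_l_diff)
      then have "(r \<ominus> r') \<odot>\<^bsub>M\<^esub> x \<in> V" using M.submodule_diff[OF V(1) *(2,1)] by simp
      then have "r \<ominus> r' = \<zero>" using False *(3,4) by blast
      then have r: "r = r'" using *(3,4) minus_eq_zero_iff by blast
      then show ?thesis using *(5) M.add.r_cancel[of "r' \<odot>\<^bsub>M\<^esub> x" v v'] * x Vc by simp
    qed
    define vp where "vp y = (THE v. v \<in> V \<and> (\<exists>r\<in>carrier R. y = v \<oplus>\<^bsub>M\<^esub> r \<odot>\<^bsub>M\<^esub> x))" for y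
    define rp where "rp y = (THE r. r \<in> carrier R \<and> (\<exists>v\<in>V. y = v \<oplus>\<^bsub>M\<^esub> r \<odot>\<^bsub>M\<^esub> x))" for y
    have vp: "vp (v \<oplus>\<^bsub>M\<^esub> r \<odot>\<^bsub>M\<^esub> x) = v" if "v \<in> V" "r \<in> carrier R" for v r
      unfolding vp_def using that unique by (intro the_equality) blast+
    have rp: "rp (v \<oplus>\<^bsub>M\<^esub> r \<odot>\<^bsub>M\<^esub> x) = r" if "v \<in> V" "r \<in> carrier R" for v r
      unfolding rp_def using that unique by (intro the_equality) blast+
    have Wdec: "\<exists>v\<in>V. \<exists>r\<in>carrier R. y = v \<oplus>\<^bsub>M\<^esub> r \<odot>\<^bsub>M\<^esub> x" if "y \<in> W" for y
      using that unfolding W_def by blast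
    have add: "(v \<oplus>\<^bsub>M\<^esub> r \<odot>\<^bsub>M\<^esub> x) \<oplus>\<^bsub>M\<^esub> (v' \<oplus>\<^bsub>M\<^esub> r' \<odot>\<^bsub>M\<^esub> x) = (v \<oplus>\<^bsub>M\<^esub> v') \<oplus>\<^bsub>M\<^esub> (r \<oplus> r') \<odot>\<^bsub>M\<^esub> x"
      and mul: "c \<odot>\<^bsub>M\<^esub> (v \<oplus>\<^bsub>M\<^esub> r \<odot>\<^bsub>M\<^esub> x) = c \<odot>\<^bsub>M\<^esub> v \<oplus>\<^bsub>M\<^esub> (c \<otimes> r) \<odot>\<^bsub>M\<^esub> x"
      if "v \<in> V" "v' \<in> V" "r \<in> carrier R" "r' \<in> carrier R" "c \<in> carrier R" for v v' r r' c
      using that x Vc by (simp_all add: M.smult_l_distr M.smult_r_distr M.smult_assoc1 M.a_ac)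
    let ?D = "insert rp ((\<lambda>f y. f (vp y)) ` D)"
    have part: "h \<in> module_hom R (M\<lparr>carrier := W\<rparr>) (regular_module R)"
      if h: "\<And>v r. v \<in> V \<Longrightarrow> r \<in> carrier R \<Longrightarrow> h (v \<oplus>\<^bsub>M\<^esub> r \<odot>\<^bsub>M\<^esub> x) = k v r"
        and k: "\<And>v r. v \<in> V \<Longrightarrow> r \<in> carrier R \<Longrightarrow> k v r \<in> carrier R"
          "\<And>v r v' r'. v \<in> V \<Longrightarrow> r \<in> carrier R \<Longrightarrow> v' \<in> V \<Longrightarrow> r' \<in> carrier R \<Longrightarrow>
            k (v \<oplus>\<^bsub>M\<^esub> v') (r \<oplus> r') = k v r \<oplus> k v' r'"
          "\<And>c v r. c \<in> carrier R \<Longrightarrow> v \<in> V \<Longrightarrow> r \<in> carrier R \<Longrightarrow>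
            k (c \<odot>\<^bsub>M\<^esub> v) (c \<otimes> r) = c \<otimes> k v r"
      for h and k :: "'m \<Rightarrow> 'a \<Rightarrow> 'a"
      unfolding module_hom_def
    proof (intro CollectI conjI ballI)
      show "h \<in> carrier (M\<lparr>carrier := W\<rparr>) \<rightarrow> carrier (regular_module R)"
      proof
        fix y assume "y \<in> carrier (M\<lparr>carrier := W\<rparr>)"
        then have "y \<in> W" by simp
        from Wdec[OF this] obtain v r where "v \<in> V" "r \<in> carrier R" "y = v \<oplus>\<^bsub>M\<^esub> r \<odot>\<^bsub>M\<^esub> x" by blast
        then show "h y \<in> carrier (regular_module R)" using h k(1) by simp
      qed
    next
      fix y z assume "y \<in> carrier (M\<lparr>carrier := W\<rparr>)" "z \<in> carrier (M\<lparr>carrier := W\<rparr>)"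
      then have "y \<in> W" "z \<in> W" by simp_all
      from this[THEN Wdec] obtain v r v' r' where "v \<in> V" "r \<in> carrier R" "v' \<in> V" "r' \<in> carrier R"
        "y = v \<oplus>\<^bsub>M\<^esub> r \<odot>\<^bsub>M\<^esub> x" "z = v' \<oplus>\<^bsub>M\<^esub> r' \<odot>\<^bsub>M\<^esub> x" by blast
      then show "h (y \<oplus>\<^bsub>M\<lparr>carrier := W\<rparr>\<^esub> z) = h y \<oplus>\<^bsub>regular_module R\<^esub> h z"
        using h k(2) VE(5) by (simp add: add)
    next
      fix c y assume c: "c \<in> carrier R" and "y \<in> carrier (M\<lparr>carrier := W\<rparr>)"
      then have "y \<in> W" by simp
      from Wdec[OF this] obtain v r where "v \<in> V" "r \<in> carrier R" "y = v \<oplus>\<^bsub>M\<^esub> r \<odot>\<^bsub>M\<^esub> x" by blast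
      then show "h (c \<odot>\<^bsub>M\<lparr>carrier := W\<rparr>\<^esub> y) = c \<odot>\<^bsub>regular_module R\<^esub> h y"
        using c h k(3) VE(4) by (simp add: mul)
    qed
    have "rp \<in> module_hom R (M\<lparr>carrier := W\<rparr>) (regular_module R)"
      by (rule part[of _ "\<lambda>v r. r"]) (use rp in auto)
    moreover have "(\<lambda>y. g (vp y)) \<in> module_hom R (M\<lparr>carrier := W\<rparr>) (regular_module R)" if "g \<in> D" for g
      by (rule part[of _ "\<lambda>v r. g v"]) (use vp f[OF that] in auto)
    ultimately have "?D \<subseteq> module_hom R (M\<lparr>carrier := W\<rparr>) (regular_module R)" by blast
    moreover have "d \<odot>\<^bsub>M\<^esub> y = \<zero>\<^bsub>M\<^esub>" if y: "y \<in> W" "\<forall>g\<in>?D. g y = \<zero>" for y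
    proof -
      obtain v r where v: "v \<in> V" "r \<in> carrier R" "y = v \<oplus>\<^bsub>M\<^esub> r \<odot>\<^bsub>M\<^esub> x" using Wdec[OF y(1)] by blast
      have "r = \<zero>" using y(2) rp v by simp
      then have "y = v" using v x Vc by simp
      moreover have "\<forall>f\<in>D. f v = \<zero>" using y(2) vp[OF v(1,2)] v(3) by auto
      ultimately show ?thesis using sep v(1) by blast
    qed
    ultimately show ?thesis
      using W xSW D(1) d
      by (intro exI[of _ W] exI[of _ ?D] exI[of _ d] conjI ballI impI) (assumption | simp)+
  qed
qed

lemma (in domain) separating_forms:
  assumes M: "module R M" and S: "finite S" "generated_by R M S"
  obtains D d where "finite D" "D \<subseteq> module_hom R M (regular_module R)" "d \<in> carrier R" "d \<noteq> \<zero>"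
    "\<And>y. y \<in> carrier M \<Longrightarrow> \<forall>f\<in>D. f y = \<zero> \<Longrightarrow> d \<odot>\<^bsub>M\<^esub> y = \<zero>\<^bsub>M\<^esub>"
proof -
  obtain V D d where *: "submodule V R M" "S \<subseteq> V" "finite D"
    "D \<subseteq> module_hom R (M\<lparr>carrier := V\<rparr>) (regular_module R)" "d \<in> carrier R" "d \<noteq> \<zero>"
    "\<forall>y\<in>V. (\<forall>f\<in>D. f y = \<zero>) \<longrightarrow> d \<odot>\<^bsub>M\<^esub> y = \<zero>\<^bsub>M\<^esub>"
    using separating_forms_span[OF M S(1) S(2)[unfolded generated_by_def, THEN conjunct1]] by (elim exE conjE)
  have "V = carrier M"
    using S(2) *(1,2) module.submoduleE(1)[OF M *(1)] unfolding generated_by_def by blast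
  then show thesis using that[of D d] *(3-7) by simp
qed

section \<open>Splitting off free summands\<close>

lemma (in abelian_group) add_minus_cancel:
  "a \<in> carrier G \<Longrightarrow> x \<in> carrier G \<Longrightarrow> a \<oplus> (x \<ominus> a) = x"
  by (simp add: a_minus_def a_comm[of x] r_neg2)

lemma (in module) submodule_module: "submodule U R M \<Longrightarrow> module R (M\<lparr>carrier := U\<rparr>)"
  by (rule submodule.submodule_is_module[OF _ module_axioms])

lemma (in module) finsum_submodule_eq:
  assumes U: "submodule U R M" and "finite A" "f \<in> A \<rightarrow> U"
  shows "(\<Oplus>\<^bsub>M\<lparr>carrier := U\<rparr>\<^esub>i\<in>A. f i) = (\<Oplus>\<^bsub>M\<^esub>i\<in>A. f i)"
  using assms(2,3)
proof (induction A)
  interpret U: module R "M\<lparr>carrier := U\<rparr>" by (rule submodule_module[OF U])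
  case empty
  show ?case using U.M.finsum_empty M.finsum_empty by simp
next
  interpret U: module R "M\<lparr>carrier := U\<rparr>" by (rule submodule_module[OF U])
  case (insert i A)
  have "f \<in> A \<rightarrow> carrier M" "f i \<in> carrier M" using insert.prems submoduleE(1)[OF U] by auto
  then show ?case
    using insert U.M.finsum_insert[of A i f] by simp
qed

lemma (in module) submodule_trans:
  assumes U: "submodule U R M" and V: "submodule V R (M\<lparr>carrier := U\<rparr>)"
  shows "submodule V R M"
proof -
  interpret U: module R "M\<lparr>carrier := U\<rparr>" by (rule submodule_module[OF U])
  show ?thesis
    using submodule.submodule_is_module[OF V U.module_axioms] U.submoduleE(1)[OF V] submoduleE(1)[OF U]
    by (intro module_incl_imp_submodule) auto
qed

lemma (in module) submodule_kernel:
  assumes N: "module R N" and f: "f \<in> module_hom R M N"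
  shows "submodule {x \<in> carrier M. f x = \<zero>\<^bsub>N\<^esub>} R M"
proof -
  interpret N: module R N by (rule N)
  note h = module_homD[OF f]
  show ?thesis
  proof (rule submoduleI)
    show "\<zero>\<^bsub>M\<^esub> \<in> {x \<in> carrier M. f x = \<zero>\<^bsub>N\<^esub>}" using module_hom_zero[OF module_axioms N f] by simp
    show "\<ominus>\<^bsub>M\<^esub> a \<in> {x \<in> carrier M. f x = \<zero>\<^bsub>N\<^esub>}" if "a \<in> {x \<in> carrier M. f x = \<zero>\<^bsub>N\<^esub>}" for a
      using that h(3)[of "\<ominus> \<one>" a] by (simp add: smult_l_minus)
  qed (use h in auto)
qed

lemma (in module) submodule_preimage:
  assumes N: "module R N" and f: "f \<in> module_hom R M N" and W: "submodule W R N"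
  shows "submodule {x \<in> carrier M. f x \<in> W} R M"
proof -
  interpret N: module R N by (rule N)
  note h = module_homD[OF f]
  note WE = N.submoduleE[OF W]
  show ?thesis
  proof (rule submoduleI)
    show "\<zero>\<^bsub>M\<^esub> \<in> {x \<in> carrier M. f x \<in> W}"
      using module_hom_zero[OF module_axioms N f] N.submodule_zero[OF W] by simp
    show "\<ominus>\<^bsub>M\<^esub> a \<in> {x \<in> carrier M. f x \<in> W}" if "a \<in> {x \<in> carrier M. f x \<in> W}" for a
      using that h(1)[of a] h(3)[of "\<ominus> \<one>" a] WE(3)
      by (simp add: smult_l_minus N.smult_l_minus)
  qed (use h WE in auto)
qed

text \<open>\<open>M\<close> is the direct sum of \<open>R s\<close> and the kernel of a form \<open>g\<close> with \<open>g s = 1\<close>.\<close>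

context module
begin

context
  fixes g s
  assumes g: "g \<in> module_hom R M (regular_module R)" and s: "s \<in> carrier M" "g s = \<one>"
begin

abbreviation form_kernel :: "'c set" where "form_kernel \<equiv> {x \<in> carrier M. g x = \<zero>}"

abbreviation form_projection :: "'c \<Rightarrow> 'c" where "form_projection y \<equiv> y \<ominus>\<^bsub>M\<^esub> g y \<odot>\<^bsub>M\<^esub> s"

lemma submodule_form_kernel: "submodule form_kernel R M"
  using submodule_kernel[OF module_regular[OF R.is_cring] g] by simp

lemma form_projection_hom: "form_projection \<in> module_hom R M (M\<lparr>carrier := form_kernel\<rparr>)"
proof -
  note h = module_homD[OF g, simplified]
  have hd: "g (x \<ominus>\<^bsub>M\<^esub> y) = g x \<ominus> g y" if "x \<in> carrier M" "y \<in> carrier M" for x y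
    using module_hom_diff[OF module_axioms module_regular[OF R.is_cring] g that] by (simp add: a_minus_def)
  show ?thesis
    unfolding module_hom_def
  proof (intro CollectI conjI ballI)
    show "form_projection \<in> carrier M \<rightarrow> carrier (M\<lparr>carrier := form_kernel\<rparr>)"
      using h hd s by auto
    show "form_projection (x \<oplus>\<^bsub>M\<^esub> y) = form_projection x \<oplus>\<^bsub>M\<lparr>carrier := form_kernel\<rparr>\<^esub> form_projection y"
      if "x \<in> carrier M" "y \<in> carrier M" for x y
      using that h s(1) by (simp add: smult_l_distr a_minus_def M.minus_add M.a_ac)
    show "form_projection (r \<odot>\<^bsub>M\<^esub> x) = r \<odot>\<^bsub>M\<lparr>carrier := form_kernel\<rparr>\<^esub> form_projection x"
      if "r \<in> carrier R" "x \<in> carrier M" for r x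
      using that h s(1) by (simp add: smult_r_diff smult_assoc1)
  qed
qed

lemma form_projection_fixes: "x \<in> form_kernel \<Longrightarrow> form_projection x = x"
  using s by simp

text \<open>The projection kills \<open>s\<close> and fixes the kernel, so the images of the
  remaining generators suffice. The drop in their number drives the induction that splits off free
  summands.\<close>

lemma generated_by_form_kernel:
  assumes S: "generated_by R M S" "s \<in> S"
  shows "generated_by R (M\<lparr>carrier := form_kernel\<rparr>) (form_projection ` (S - {s}))"
  unfolding generated_by_def
proof (intro conjI allI impI)
  let ?U = "M\<lparr>carrier := form_kernel\<rparr>"
  note U = submodule_form_kernel
  interpret U: module R ?U by (rule submodule_module[OF U])
  note p = form_projection_hom
  have S': "S \<subseteq> carrier M" using S(1) by (simp add: generated_by_def)
  show "form_projection ` (S - {s}) \<subseteq> carrier ?U"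
    using module_homD(1)[OF p] S' by blast
  fix W assume W: "submodule W R ?U" and sub: "form_projection ` (S - {s}) \<subseteq> W"
  have "submodule {x \<in> carrier M. form_projection x \<in> W} R M"
    by (rule submodule_preimage[OF U.module_axioms p W])
  moreover have "S \<subseteq> {x \<in> carrier M. form_projection x \<in> W}"
  proof
    fix x assume x: "x \<in> S"
    show "x \<in> {x \<in> carrier M. form_projection x \<in> W}"
    proof (cases "x = s")
      case True
      then have "form_projection x = \<zero>\<^bsub>M\<^esub>" using s by simp
      then show ?thesis using U.submodule_zero[OF W] S' x by auto
    next
      case False
      then show ?thesis using sub S' x by blast
    qed
  qed
  ultimately have "carrier M \<subseteq> {x \<in> carrier M. form_projection x \<in> W}"
    using S(1) by (simp add: generated_by_def)
  then show "carrier ?U \<subseteq> W" using form_projection_fixes by force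
qed

text \<open>Used in the contrapositive: if \<open>M\<close> is not free, neither is the complement
  left after splitting off \<open>R s\<close>. As \<open>g s = 1\<close> is not 0, \<open>s\<close>
  is outside \<open>B\<close>, and applying \<open>g\<close> to a relation isolates the coefficient
  of \<open>s\<close>.\<close>

lemma is_basis_insert:
  assumes nz: "\<one> \<noteq> \<zero>" and B: "is_basis R (M\<lparr>carrier := form_kernel\<rparr>) B"
  shows "is_basis R M (insert s B)"
proof -
  let ?U = "M\<lparr>carrier := form_kernel\<rparr>"
  note U = submodule_form_kernel
  interpret U: module R ?U by (rule submodule_module[OF U])
  note h = module_homD[OF g, simplified]
  have BU: "B \<subseteq> form_kernel" using B by (simp add: is_basis_def)
  have sB: "s \<notin> B" using BU s nz by auto
  have sum: "(\<Oplus>\<^bsub>?U\<^esub>b\<in>A. c b \<odot>\<^bsub>?U\<^esub> b) = (\<Oplus>\<^bsub>M\<^esub>b\<in>A. c b \<odot>\<^bsub>M\<^esub> b)"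
    "(\<Oplus>\<^bsub>M\<^esub>b\<in>A. c b \<odot>\<^bsub>M\<^esub> b) \<in> form_kernel"
    if "finite A" "A \<subseteq> B" "c \<in> A \<rightarrow> carrier R" for A c
  proof -
    have *: "c b \<odot>\<^bsub>M\<^esub> b \<in> form_kernel" if "b \<in> A" for b
      using submoduleE(4)[OF U] that \<open>A \<subseteq> B\<close> \<open>c \<in> A \<rightarrow> carrier R\<close> BU by blast
    show "(\<Oplus>\<^bsub>?U\<^esub>b\<in>A. c b \<odot>\<^bsub>?U\<^esub> b) = (\<Oplus>\<^bsub>M\<^esub>b\<in>A. c b \<odot>\<^bsub>M\<^esub> b)"
      using finsum_submodule_eq[OF U that(1), of "\<lambda>b. c b \<odot>\<^bsub>M\<^esub> b"] * by auto
    show "(\<Oplus>\<^bsub>M\<^esub>b\<in>A. c b \<odot>\<^bsub>M\<^esub> b) \<in> form_kernel"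
      by (rule finsum_in_submodule[OF U that(1) *])
  qed
  have ins: "(\<Oplus>\<^bsub>M\<^esub>b\<in>insert s A. c b \<odot>\<^bsub>M\<^esub> b) = c s \<odot>\<^bsub>M\<^esub> s \<oplus>\<^bsub>M\<^esub> (\<Oplus>\<^bsub>M\<^esub>b\<in>A. c b \<odot>\<^bsub>M\<^esub> b)"
    if "finite A" "A \<subseteq> B" "c \<in> insert s A \<rightarrow> carrier R" for A c
    using that s(1) sB BU by (intro M.finsum_insert) auto
  show ?thesis
    unfolding is_basis_def
  proof (intro conjI ballI allI impI)
    show "insert s B \<subseteq> carrier M" using BU s(1) by blast
  next
    fix x assume x: "x \<in> carrier M"
    have "form_projection x \<in> carrier ?U" using module_homD(1)[OF form_projection_hom x] .
    then obtain A c where A: "finite A" "A \<subseteq> B" "c \<in> A \<rightarrow> carrier R"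
      "form_projection x = (\<Oplus>\<^bsub>?U\<^esub>b\<in>A. c b \<odot>\<^bsub>?U\<^esub> b)"
      using B[unfolded is_basis_def, THEN conjunct2, THEN conjunct1, THEN bspec,
          of "form_projection x"] by (elim meta_impE exE conjE) assumption+
    define c' where "c' = c(s := g x)"
    have c': "c' \<in> insert s A \<rightarrow> carrier R" using A(3) h(1)[OF x] by (auto simp: c'_def)
    have "(\<Oplus>\<^bsub>M\<^esub>b\<in>A. c' b \<odot>\<^bsub>M\<^esub> b) = (\<Oplus>\<^bsub>M\<^esub>b\<in>A. c b \<odot>\<^bsub>M\<^esub> b)"
      by (rule M.finsum_cong') (use A(2,3) sB BU in \<open>auto simp: c'_def\<close>)
    also have "\<dots> = form_projection x" using sum(1)[OF A(1-3)] A(4) by simp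
    finally have "(\<Oplus>\<^bsub>M\<^esub>b\<in>insert s A. c' b \<odot>\<^bsub>M\<^esub> b) = g x \<odot>\<^bsub>M\<^esub> s \<oplus>\<^bsub>M\<^esub> form_projection x"
      using ins[OF A(1,2) c'] by (simp add: c'_def)
    also have "\<dots> = x" using x h(1)[OF x] s(1) by (intro M.add_minus_cancel) simp_all
    finally show "\<exists>A c. finite A \<and> A \<subseteq> insert s B \<and> c \<in> A \<rightarrow> carrier R \<and> x = (\<Oplus>\<^bsub>M\<^esub>b\<in>A. c b \<odot>\<^bsub>M\<^esub> b)"
      using A(1,2) c' by (intro exI[of _ "insert s A"] exI[of _ c']) auto
  next
    fix A c b
    assume A: "finite A \<and> A \<subseteq> insert s B \<and> c \<in> A \<rightarrow> carrier R \<and> (\<Oplus>\<^bsub>M\<^esub>b\<in>A. c b \<odot>\<^bsub>M\<^esub> b) = \<zero>\<^bsub>M\<^esub>"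
      and b: "b \<in> A"
    let ?A = "A - {s}"
    have A': "finite ?A" "?A \<subseteq> B" "c \<in> ?A \<rightarrow> carrier R" using A by auto
    note sumA = sum[OF A']
    have indep: "c b = \<zero>" if "(\<Oplus>\<^bsub>M\<^esub>b\<in>?A. c b \<odot>\<^bsub>M\<^esub> b) = \<zero>\<^bsub>M\<^esub>" "b \<in> ?A" for b
    proof -
      have "finite ?A \<and> ?A \<subseteq> B \<and> c \<in> ?A \<rightarrow> carrier R \<and> (\<Oplus>\<^bsub>?U\<^esub>b\<in>?A. c b \<odot>\<^bsub>?U\<^esub> b) = \<zero>\<^bsub>?U\<^esub>"
        using A' sumA(1) that(1) by simp
      from B[unfolded is_basis_def, THEN conjunct2, THEN conjunct2, rule_format, OF this that(2)]
      show ?thesis .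
    qed
    show "c b = \<zero>"
    proof (cases "s \<in> A")
      case True
      then have cs: "c s \<in> carrier R" using A by auto
      have "\<zero>\<^bsub>M\<^esub> = c s \<odot>\<^bsub>M\<^esub> s \<oplus>\<^bsub>M\<^esub> (\<Oplus>\<^bsub>M\<^esub>b\<in>?A. c b \<odot>\<^bsub>M\<^esub> b)"
        using ins[OF A'(1,2), of c] A cs insert_Diff[OF True] by simp
      moreover from this have "g \<zero>\<^bsub>M\<^esub> = c s"
        using h(2)[of "c s \<odot>\<^bsub>M\<^esub> s"] h(3)[OF cs s(1)] sumA(2) cs s by simp
      ultimately have "c s = \<zero>" "(\<Oplus>\<^bsub>M\<^esub>b\<in>?A. c b \<odot>\<^bsub>M\<^esub> b) = \<zero>\<^bsub>M\<^esub>"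
        using module_hom_zero[OF module_axioms module_regular[OF R.is_cring] g] s(1) sumA(2) by simp_all
      then show ?thesis using indep b by (cases "b = s") auto
    next
      case False
      then show ?thesis using indep[of b] A b by (metis Diff_empty Diff_insert0)
    qed
  qed
qed

end

end

text \<open>As long as some form has a unit value, it has one at a generator, which then spans a
  free summand. The complement is again not free and has fewer generators, so the process ends, and
  not at the zero module, which is free. The retraction is kept because functionals on the summand
  are later extended along it.\<close>

lemma (in one_dim_local_domain) exists_summand_with_forms_in_max:
  fixes M :: "('a, 'm, 'x) module_scheme"
  assumes "module R M" "finite S" "generated_by R M S" "\<not> free_module R M"
  shows "\<exists>U \<pi> S'. submodule U R M \<and> \<pi> \<in> module_hom R M (M\<lparr>carrier := U\<rparr>) \<and> (\<forall>u\<in>U. \<pi> u = u) \<and>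
    finite S' \<and> generated_by R (M\<lparr>carrier := U\<rparr>) S' \<and> U \<noteq> {\<zero>\<^bsub>M\<^esub>} \<and>
    (\<forall>f\<in>module_hom R (M\<lparr>carrier := U\<rparr>) (regular_module R). \<forall>u\<in>U. f u \<in> \<mm>)"
  using assms
proof (induction "card S" arbitrary: M S rule: less_induct)
  case less
  interpret M: module R M by (rule less.prems)
  interpret max: ideal \<mm> R by (rule ideal_max)
  have nz: "\<one> \<noteq> \<zero>" using one_nonmember max.zero_closed by metis
  show ?case
  proof (cases "\<forall>f\<in>module_hom R M (regular_module R). \<forall>u\<in>carrier M. f u \<in> \<mm>")
    case True
    have "carrier M \<noteq> {\<zero>\<^bsub>M\<^esub>}"
    proof
      assume "carrier M = {\<zero>\<^bsub>M\<^esub>}"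
      then have "is_basis R M {}" by (simp add: is_basis_def)
      then show False using less.prems(4) by (auto simp: free_module_def)
    qed
    moreover have "(\<lambda>x. x) \<in> module_hom R M (M\<lparr>carrier := carrier M\<rparr>)" by (simp add: module_hom_def)
    ultimately show ?thesis
      using True M.carrier_is_submodule less.prems(2,3)
      by (intro exI[of _ "carrier M"] exI[of _ "\<lambda>x. x"] exI[of _ S]) simp
  next
    case False
    then obtain f where f: "f \<in> module_hom R M (regular_module R)" "\<exists>u\<in>carrier M. f u \<notin> \<mm>" by blast
    note hf = module_homD[OF f(1), simplified]
    have reg: "module R (regular_module R)" by (rule module_regular[OF is_cring])
    interpret reg: module R "regular_module R" by (rule reg)
    have "submodule \<mm> R (regular_module R)"
      by (rule reg.submoduleI)
        (use max.Icarr max.I_l_closed max.a_inv_closed in \<open>auto simp flip: a_inv_def\<close>)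
    then have "submodule {x \<in> carrier M. f x \<in> \<mm>} R M" by (rule M.submodule_preimage[OF reg f(1)])
    then have "\<not> S \<subseteq> {x \<in> carrier M. f x \<in> \<mm>}" using less.prems(3) f(2) unfolding generated_by_def by blast
    then obtain s where s: "s \<in> S" "s \<in> carrier M" "f s \<notin> \<mm>" using less.prems(3) unfolding generated_by_def by blast
    then have u: "f s \<in> Units R" using nonmember_unit hf(1) by blast
    define g where "g x = inv (f s) \<otimes> f x" for x
    have g: "g \<in> module_hom R M (regular_module R)"
      using hf u by (simp add: module_hom_def g_def r_distr m_lcomm)
    have gs: "g s = \<one>" using u by (simp add: g_def)
    let ?K = "{x \<in> carrier M. g x = \<zero>}"
    let ?N = "M\<lparr>carrier := ?K\<rparr>"
    let ?p = "\<lambda>y. y \<ominus>\<^bsub>M\<^esub> g y \<odot>\<^bsub>M\<^esub> s"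
    note K = M.submodule_form_kernel[OF g s(2) gs]
    have "card (?p ` (S - {s})) < card S"
      using less.prems(2) s(1) by (meson card_Diff1_less card_image_le finite_Diff le_less_trans)
    moreover have "\<not> free_module R ?N"
      using M.is_basis_insert[OF g s(2) gs nz] less.prems(4) unfolding free_module_def by blast
    ultimately obtain U \<pi> S' where U: "submodule U R ?N" "\<pi> \<in> module_hom R ?N (M\<lparr>carrier := U\<rparr>)"
      "\<forall>u\<in>U. \<pi> u = u" "finite S'" "generated_by R (M\<lparr>carrier := U\<rparr>) S'" "U \<noteq> {\<zero>\<^bsub>M\<^esub>}"
      "\<forall>f\<in>module_hom R (M\<lparr>carrier := U\<rparr>) (regular_module R). \<forall>u\<in>U. f u \<in> \<mm>"
      using less.hyps[of "?p ` (S - {s})" ?N] M.submodule_module[OF K] less.prems(2)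
        M.generated_by_form_kernel[OF g s(2) gs less.prems(3) s(1)] by auto
    have p: "?p \<in> module_hom R M ?N" by (rule M.form_projection_hom[OF g s(2) gs])
    note hp = module_homD[OF p, simplified] and h\<pi> = module_homD[OF U(2), simplified]
    have "(\<lambda>x. \<pi> (?p x)) \<in> module_hom R M (M\<lparr>carrier := U\<rparr>)"
      unfolding module_hom_def
    proof (intro CollectI conjI ballI)
      show "(\<lambda>x. \<pi> (?p x)) \<in> carrier M \<rightarrow> carrier (M\<lparr>carrier := U\<rparr>)" using hp(1) h\<pi>(1) by simp
      show "\<pi> (?p (x \<oplus>\<^bsub>M\<^esub> y)) = \<pi> (?p x) \<oplus>\<^bsub>M\<lparr>carrier := U\<rparr>\<^esub> \<pi> (?p y)"
        if "x \<in> carrier M" "y \<in> carrier M" for x y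
        using hp(1,2) h\<pi>(2) that by simp
      show "\<pi> (?p (r \<odot>\<^bsub>M\<^esub> x)) = r \<odot>\<^bsub>M\<lparr>carrier := U\<rparr>\<^esub> \<pi> (?p x)"
        if "r \<in> carrier R" "x \<in> carrier M" for r x
        using hp(1,3) h\<pi>(3) that by simp
    qed
    moreover have "\<pi> (?p x) = x" if "x \<in> U" for x
      using that U(3) M.form_projection_fixes[OF g s(2) gs]
        module.submoduleE(1)[OF M.submodule_module[OF K] U(1)] by auto
    ultimately show ?thesis
      using M.submodule_trans[OF K U(1)] U(4-7)
      by (intro exI[of _ U] exI[of _ "\<lambda>x. \<pi> (?p x)"] exI[of _ S']) simp
  qed
qed

section \<open>Torsion in tensor products\<close>

lemma tensor_relationsE:
  assumes "u \<in> tensor_relations R M N"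
  obtains (1) p p' q where "p \<in> carrier M" "p' \<in> carrier M" "q \<in> carrier N"
      "u = frag_of (p \<oplus>\<^bsub>M\<^esub> p', q) - frag_of (p, q) - frag_of (p', q)"
    | (2) p q q' where "p \<in> carrier M" "q \<in> carrier N" "q' \<in> carrier N"
      "u = frag_of (p, q \<oplus>\<^bsub>N\<^esub> q') - frag_of (p, q) - frag_of (p, q')"
    | (3) r p q where "r \<in> carrier R" "p \<in> carrier M" "q \<in> carrier N"
      "u = frag_of (r \<odot>\<^bsub>M\<^esub> p, q) - frag_of (p, r \<odot>\<^bsub>N\<^esub> q)"
  using assms unfolding tensor_relations_def
  by (elim UnE CollectE exE conjE)
    ((rule that(1); assumption) | (rule that(2); assumption) | (rule that(3); assumption))+

lemma tensor_relationsI: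
  "p \<in> carrier M \<Longrightarrow> p' \<in> carrier M \<Longrightarrow> q \<in> carrier N \<Longrightarrow>
    frag_of (p \<oplus>\<^bsub>M\<^esub> p', q) - frag_of (p, q) - frag_of (p', q) \<in> tensor_relations R M N"
  "p \<in> carrier M \<Longrightarrow> q \<in> carrier N \<Longrightarrow> q' \<in> carrier N \<Longrightarrow>
    frag_of (p, q \<oplus>\<^bsub>N\<^esub> q') - frag_of (p, q) - frag_of (p, q') \<in> tensor_relations R M N"
  "r \<in> carrier R \<Longrightarrow> p \<in> carrier M \<Longrightarrow> q \<in> carrier N \<Longrightarrow>
    frag_of (r \<odot>\<^bsub>M\<^esub> p, q) - frag_of (p, r \<odot>\<^bsub>N\<^esub> q) \<in> tensor_relations R M N"
  unfolding tensor_relations_def by blast+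

lemma (in module) submodule_Union_chain:
  assumes "\<C> \<noteq> {}" and chain: "subset.chain {U. submodule U R M \<and> P U} \<C>"
  shows "submodule (\<Union>\<C>) R M"
proof (rule submoduleI)
  have sub: "submodule U R M" if "U \<in> \<C>" for U using chain that by (auto simp: subset.chain_def)
  show "\<Union>\<C> \<subseteq> carrier M" using submoduleE(1)[OF sub] by blast
  show "\<zero>\<^bsub>M\<^esub> \<in> \<Union>\<C>" using assms(1) submodule_zero[OF sub] by blast
  show "\<ominus>\<^bsub>M\<^esub> a \<in> \<Union>\<C>" if "a \<in> \<Union>\<C>" for a using that submoduleE(3)[OF sub] by blast
  show "r \<odot>\<^bsub>M\<^esub> a \<in> \<Union>\<C>" if "r \<in> carrier R" "a \<in> \<Union>\<C>" for r a using that submoduleE(4)[OF sub] by blast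
  fix a b assume "a \<in> \<Union>\<C>" "b \<in> \<Union>\<C>"
  then obtain U V where "U \<in> \<C>" "V \<in> \<C>" "a \<in> U" "b \<in> V" by blast
  moreover from this have "U \<subseteq> V \<or> V \<subseteq> U" using chain by (auto simp: subset.chain_def)
  ultimately obtain W where "W \<in> \<C>" "a \<in> W" "b \<in> W" by blast
  then show "a \<oplus>\<^bsub>M\<^esub> b \<in> \<Union>\<C>" using submoduleE(5)[OF sub] by blast
qed

section \<open>Functionals to the residue field and the balancing identity\<close>

context one_dim_local_domain
begin

interpretation max: ideal \<mm> R by (rule ideal_max)

text \<open>The \<open>R\<close>-linear maps from \<open>M\<close> to \<open>k\<close>, that is, the
  linear forms on \<open>M/\<mm>M\<close>. Products of values of two such maps replace the tensor
  product over \<open>k\<close> of quotients of \<open>M/\<mm>M\<close> and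
  \<open>N/\<mm>N\<close>.\<close>

definition residue_functional :: "('a, 'm, 'x) module_scheme \<Rightarrow> ('m \<Rightarrow> 'a set) \<Rightarrow> bool"
  where "residue_functional M \<alpha> \<longleftrightarrow>
    (\<forall>x\<in>carrier M. \<alpha> x \<in> carrier (R Quot \<mm>)) \<and>
    (\<forall>x\<in>carrier M. \<forall>y\<in>carrier M. \<alpha> (x \<oplus>\<^bsub>M\<^esub> y) = \<alpha> x \<oplus>\<^bsub>R Quot \<mm>\<^esub> \<alpha> y) \<and>
    (\<forall>r\<in>carrier R. \<forall>x\<in>carrier M. \<alpha> (r \<odot>\<^bsub>M\<^esub> x) = (\<mm> +> r) \<otimes>\<^bsub>R Quot \<mm>\<^esub> \<alpha> x)"

lemma residue_functionalD:
  assumes "residue_functional M \<alpha>"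
  shows "x \<in> carrier M \<Longrightarrow> \<alpha> x \<in> carrier (R Quot \<mm>)"
    and "x \<in> carrier M \<Longrightarrow> y \<in> carrier M \<Longrightarrow> \<alpha> (x \<oplus>\<^bsub>M\<^esub> y) = \<alpha> x \<oplus>\<^bsub>R Quot \<mm>\<^esub> \<alpha> y"
    and "r \<in> carrier R \<Longrightarrow> x \<in> carrier M \<Longrightarrow> \<alpha> (r \<odot>\<^bsub>M\<^esub> x) = (\<mm> +> r) \<otimes>\<^bsub>R Quot \<mm>\<^esub> \<alpha> x"
  using assms unfolding residue_functional_def by blast+

lemma residue_ring: "cring (R Quot \<mm>)"
  by (rule max.quotient_is_cring[OF is_cring])

lemma residue_hom: "ring_hom_ring R (R Quot \<mm>) ((+>) \<mm>)"
  by (rule max.rcos_ring_hom_ring)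

lemma residue_eq_iff: "a \<in> carrier R \<Longrightarrow> b \<in> carrier R \<Longrightarrow> \<mm> +> a = \<mm> +> b \<longleftrightarrow> a \<ominus> b \<in> \<mm>"
  using quotient_eq_iff_same_a_r_cos[OF ideal_max] by blast

lemma residue_one_nonzero: "\<one>\<^bsub>R Quot \<mm>\<^esub> \<noteq> \<zero>\<^bsub>R Quot \<mm>\<^esub>"
proof
  assume "\<one>\<^bsub>R Quot \<mm>\<^esub> = \<zero>\<^bsub>R Quot \<mm>\<^esub>"
  then have "\<mm> +> \<one> = \<mm> +> \<zero>"
    using ring_hom_ring.homh[OF residue_hom] max.a_rcos_const[OF max.zero_closed]
    by (simp add: FactRing_def)
  then show False using residue_eq_iff[of \<one> \<zero>] one_nonmember by simp
qed

text \<open>A submodule \<open>U\<close> maximal among those that contain \<open>U0\<close> and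
  avoid \<open>v\<close> is a hyperplane: since \<open>\<mm> M\<close> lies in \<open>U\<close>, the
  quotient is a vector space over \<open>k\<close>, and by maximality \<open>v\<close> spans it. The
  functional is the coordinate with respect to \<open>v\<close>.\<close>

lemma exists_residue_functional:
  assumes M: "module R M" and U0: "submodule U0 R M"
    and mM: "\<And>r x. r \<in> \<mm> \<Longrightarrow> x \<in> carrier M \<Longrightarrow> r \<odot>\<^bsub>M\<^esub> x \<in> U0"
    and v: "v \<in> carrier M" "v \<notin> U0"
  obtains \<alpha> where "residue_functional M \<alpha>" "\<alpha> v = \<one>\<^bsub>R Quot \<mm>\<^esub>"
    "\<And>u. u \<in> U0 \<Longrightarrow> \<alpha> u = \<zero>\<^bsub>R Quot \<mm>\<^esub>"
proof -
  interpret M: module R M by (rule M)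
  interpret \<rho>: ring_hom_ring R "R Quot \<mm>" "(+>) \<mm>" by (rule residue_hom)
  let ?S = "{U. submodule U R M \<and> (U0 \<subseteq> U \<and> v \<notin> U)}"
  have "\<Union>\<C> \<in> ?S" if "\<C> \<noteq> {}" "subset.chain ?S \<C>" for \<C>
  proof -
    have "\<C> \<subseteq> ?S" using that(2) by (simp add: subset.chain_def)
    then show ?thesis using M.submodule_Union_chain[OF that] that(1) by blast
  qed
  moreover have "?S \<noteq> {}" using U0 v(2) by blast
  ultimately obtain U where U: "submodule U R M" "U0 \<subseteq> U" "v \<notin> U"
    and maximal: "\<And>W. W \<in> ?S \<Longrightarrow> U \<subseteq> W \<Longrightarrow> W = U"
    using subset_Zorn_nonempty[of ?S] by auto
  note UE = M.submoduleE[OF U(1)]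
  have Uc: "u \<in> carrier M" if "u \<in> U" for u using that UE(1) by blast
  have rv: "r \<in> \<mm>" if "r \<in> carrier R" "r \<odot>\<^bsub>M\<^esub> v \<in> U" for r
  proof (rule ccontr)
    assume "r \<notin> \<mm>"
    then have r: "r \<in> Units R" using nonmember_unit that(1) by blast
    have "inv r \<odot>\<^bsub>M\<^esub> (r \<odot>\<^bsub>M\<^esub> v) = v" using r v(1) that(1) by (simp flip: M.smult_assoc1)
    then show False using UE(4)[OF Units_inv_closed[OF r] that(2)] U(3) by simp
  qed
  have dec: "\<exists>r. r \<in> carrier R \<and> x \<ominus>\<^bsub>M\<^esub> r \<odot>\<^bsub>M\<^esub> v \<in> U" if x: "x \<in> carrier M" for x
  proof (cases "x \<in> U")
    case True
    then show ?thesis using x v(1) by (intro exI[of _ \<zero>]) simp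
  next
    case False
    define W where "W = {u \<oplus>\<^bsub>M\<^esub> r \<odot>\<^bsub>M\<^esub> x | u r. u \<in> U \<and> r \<in> carrier R}"
    have W: "submodule W R M" unfolding W_def by (rule M.submodule_add_multiples[OF U(1) x])
    have "u \<in> W" if "u \<in> U" for u
      unfolding W_def using that x Uc by (intro CollectI exI[of _ u] exI[of _ \<zero>]) simp
    then have UW: "U \<subseteq> W" by blast
    have "x \<in> W"
      unfolding W_def using x M.submodule_zero[OF U(1)]
      by (intro CollectI exI[of _ "\<zero>\<^bsub>M\<^esub>"] exI[of _ \<one>]) simp
    then have "W \<notin> ?S" using maximal[of W] UW False by blast
    then have "v \<in> W" using W UW U(2) by blast
    then obtain u r where ur: "u \<in> U" "r \<in> carrier R" "v = u \<oplus>\<^bsub>M\<^esub> r \<odot>\<^bsub>M\<^esub> x" unfolding W_def by blast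
    \<comment> \<open>For \<open>r\<close> in \<open>\<mm>\<close> the relation
      \<open>v = u + r x\<close> would put \<open>v\<close> into \<open>U\<close>. So
      \<open>r\<close> is invertible, and \<open>x\<close> is a multiple of \<open>v\<close> modulo
      \<open>U\<close>.\<close>
    have "r \<notin> \<mm>" using mM[OF _ x] U(2,3) UE(5) ur by blast
    then have r: "r \<in> Units R" using nonmember_unit ur(2) by blast
    have "inv r \<odot>\<^bsub>M\<^esub> v = inv r \<odot>\<^bsub>M\<^esub> u \<oplus>\<^bsub>M\<^esub> x"
      using r ur Uc x by (simp add: M.smult_r_distr flip: M.smult_assoc1)
    then have "x \<ominus>\<^bsub>M\<^esub> inv r \<odot>\<^bsub>M\<^esub> v = \<ominus>\<^bsub>M\<^esub> (inv r \<odot>\<^bsub>M\<^esub> u)"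
      using r Uc[OF ur(1)] x by (simp add: a_minus_def M.minus_add M.a_ac M.r_neg1 M.r_neg2)
    then show ?thesis using UE(3)[OF UE(4)[OF Units_inv_closed[OF r] ur(1)]] r by auto
  qed
  \<comment> \<open>By \<open>rv\<close> the coefficient is determined modulo \<open>\<mm>\<close>,
    so its coset does not depend on the choice.\<close>
  define \<alpha> where "\<alpha> x = \<mm> +> (SOME r. r \<in> carrier R \<and> x \<ominus>\<^bsub>M\<^esub> r \<odot>\<^bsub>M\<^esub> v \<in> U)" for x
  have \<alpha>: "\<alpha> x = \<mm> +> r" if x: "x \<in> carrier M" and r: "r \<in> carrier R" "x \<ominus>\<^bsub>M\<^esub> r \<odot>\<^bsub>M\<^esub> v \<in> U" for x r
  proof -
    define s where "s = (SOME r. r \<in> carrier R \<and> x \<ominus>\<^bsub>M\<^esub> r \<odot>\<^bsub>M\<^esub> v \<in> U)"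
    have s: "s \<in> carrier R" "x \<ominus>\<^bsub>M\<^esub> s \<odot>\<^bsub>M\<^esub> v \<in> U" using someI_ex[OF dec[OF x]] by (simp_all add: s_def)
    have "(x \<ominus>\<^bsub>M\<^esub> r \<odot>\<^bsub>M\<^esub> v) \<ominus>\<^bsub>M\<^esub> (x \<ominus>\<^bsub>M\<^esub> s \<odot>\<^bsub>M\<^esub> v) = (s \<ominus> r) \<odot>\<^bsub>M\<^esub> v"
      using x r(1) s(1) v(1) M.smult_l_diff[OF s(1) r(1) v(1)]
      by (simp add: a_minus_def M.minus_add M.a_ac M.r_neg1 M.r_neg2)
    then have "(s \<ominus> r) \<odot>\<^bsub>M\<^esub> v \<in> U" using M.submodule_diff[OF U(1) r(2) s(2)] by simp
    then have "s \<ominus> r \<in> \<mm>" using rv r(1) s(1) by simp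
    then show ?thesis using residue_eq_iff[OF s(1) r(1)] by (simp add: \<alpha>_def s_def)
  qed
  have "residue_functional M \<alpha>"
    unfolding residue_functional_def
  proof (intro conjI ballI)
    show "\<alpha> x \<in> carrier (R Quot \<mm>)" if x: "x \<in> carrier M" for x
      using dec[OF x] \<alpha>[OF x] \<rho>.hom_closed by auto
  next
    fix x y assume x: "x \<in> carrier M" and y: "y \<in> carrier M"
    obtain r s where r: "r \<in> carrier R" "x \<ominus>\<^bsub>M\<^esub> r \<odot>\<^bsub>M\<^esub> v \<in> U" and s: "s \<in> carrier R" "y \<ominus>\<^bsub>M\<^esub> s \<odot>\<^bsub>M\<^esub> v \<in> U"
      using dec[OF x] dec[OF y] by blast
    have "(x \<ominus>\<^bsub>M\<^esub> r \<odot>\<^bsub>M\<^esub> v) \<oplus>\<^bsub>M\<^esub> (y \<ominus>\<^bsub>M\<^esub> s \<odot>\<^bsub>M\<^esub> v) = (x \<oplus>\<^bsub>M\<^esub> y) \<ominus>\<^bsub>M\<^esub> (r \<oplus> s) \<odot>\<^bsub>M\<^esub> v"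
      using x y r(1) s(1) v(1) by (simp add: M.smult_l_distr a_minus_def M.minus_add M.a_ac)
    then have "(x \<oplus>\<^bsub>M\<^esub> y) \<ominus>\<^bsub>M\<^esub> (r \<oplus> s) \<odot>\<^bsub>M\<^esub> v \<in> U" using UE(5)[OF r(2) s(2)] by simp
    then show "\<alpha> (x \<oplus>\<^bsub>M\<^esub> y) = \<alpha> x \<oplus>\<^bsub>R Quot \<mm>\<^esub> \<alpha> y"
      using \<alpha>[OF x r] \<alpha>[OF y s] \<alpha>[of "x \<oplus>\<^bsub>M\<^esub> y" "r \<oplus> s"] x y r(1) s(1) by simp
  next
    fix c x assume c: "c \<in> carrier R" and x: "x \<in> carrier M"
    obtain r where r: "r \<in> carrier R" "x \<ominus>\<^bsub>M\<^esub> r \<odot>\<^bsub>M\<^esub> v \<in> U" using dec[OF x] by blast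
    have "c \<odot>\<^bsub>M\<^esub> (x \<ominus>\<^bsub>M\<^esub> r \<odot>\<^bsub>M\<^esub> v) = c \<odot>\<^bsub>M\<^esub> x \<ominus>\<^bsub>M\<^esub> (c \<otimes> r) \<odot>\<^bsub>M\<^esub> v"
      using c x r(1) v(1) by (simp add: M.smult_r_diff M.smult_assoc1)
    then have "c \<odot>\<^bsub>M\<^esub> x \<ominus>\<^bsub>M\<^esub> (c \<otimes> r) \<odot>\<^bsub>M\<^esub> v \<in> U" using UE(4)[OF c r(2)] by simp
    then show "\<alpha> (c \<odot>\<^bsub>M\<^esub> x) = (\<mm> +> c) \<otimes>\<^bsub>R Quot \<mm>\<^esub> \<alpha> x"
      using \<alpha>[OF x r] \<alpha>[of "c \<odot>\<^bsub>M\<^esub> x" "c \<otimes> r"] x c r(1) by simp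
  qed
  moreover have "\<alpha> v = \<one>\<^bsub>R Quot \<mm>\<^esub>"
    using \<alpha>[of v \<one>] v(1) M.submodule_zero[OF U(1)] by simp
  moreover have "\<alpha> u = \<zero>\<^bsub>R Quot \<mm>\<^esub>" if "u \<in> U0" for u
    using \<alpha>[of u \<zero>] that U(2) Uc[of u] v(1) by auto
  ultimately show thesis by (rule that)
qed

text \<open>The relation \<open>x' \<otimes> y = x \<otimes> y'\<close> holds in \<open>M \<otimes> N\<close> up to \<open>s\<close>-torsion.\<close>

definition fractions_balanced :: "('a, 'm, 'x) module_scheme \<Rightarrow> ('a, 'n, 'y) module_scheme \<Rightarrow> bool"
  where "fractions_balanced M N \<longleftrightarrow> (\<forall>\<alpha> \<beta> s t x x' y y'.
    residue_functional M \<alpha> \<longrightarrow> residue_functional N \<beta> \<longrightarrow>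
    s \<in> carrier R \<longrightarrow> s \<noteq> \<zero> \<longrightarrow> t \<in> carrier R \<longrightarrow> x \<in> carrier M \<longrightarrow> x' \<in> carrier M \<longrightarrow>
    y \<in> carrier N \<longrightarrow> y' \<in> carrier N \<longrightarrow>
    s \<odot>\<^bsub>M\<^esub> x' = t \<odot>\<^bsub>M\<^esub> x \<longrightarrow> s \<odot>\<^bsub>N\<^esub> y' = t \<odot>\<^bsub>N\<^esub> y \<longrightarrow>
    \<alpha> x' \<otimes>\<^bsub>R Quot \<mm>\<^esub> \<beta> y = \<alpha> x \<otimes>\<^bsub>R Quot \<mm>\<^esub> \<beta> y')"

lemma residue_functional_comp:
  assumes \<pi>: "\<pi> \<in> module_hom R M (M\<lparr>carrier := U\<rparr>)" and \<alpha>: "residue_functional (M\<lparr>carrier := U\<rparr>) \<alpha>"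
  shows "residue_functional M (\<lambda>x. \<alpha> (\<pi> x))"
  using module_homD[OF \<pi>] residue_functionalD[OF \<alpha>] unfolding residue_functional_def by simp

text \<open>Composition with the retractions turns functionals on the summands into functionals on
  \<open>M\<close> and \<open>N\<close>, and equations in the summands are equations in
  \<open>M\<close> and \<open>N\<close>. The tensor product is thus never decomposed.\<close>

lemma fractions_balanced_summands:
  assumes bal: "fractions_balanced M N" and M: "module R M" and N: "module R N"
    and U: "submodule U R M" "\<pi> \<in> module_hom R M (M\<lparr>carrier := U\<rparr>)" "\<forall>u\<in>U. \<pi> u = u"
    and V: "submodule V R N" "\<tau> \<in> module_hom R N (N\<lparr>carrier := V\<rparr>)" "\<forall>v\<in>V. \<tau> v = v"
  shows "fractions_balanced (M\<lparr>carrier := U\<rparr>) (N\<lparr>carrier := V\<rparr>)"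
  unfolding fractions_balanced_def
proof (intro allI impI)
  fix \<alpha> \<beta> s t x x' y y'
  assume \<alpha>: "residue_functional (M\<lparr>carrier := U\<rparr>) \<alpha>" and \<beta>: "residue_functional (N\<lparr>carrier := V\<rparr>) \<beta>"
    and st: "s \<in> carrier R" "s \<noteq> \<zero>" "t \<in> carrier R"
    and x: "x \<in> carrier (M\<lparr>carrier := U\<rparr>)" "x' \<in> carrier (M\<lparr>carrier := U\<rparr>)"
    and y: "y \<in> carrier (N\<lparr>carrier := V\<rparr>)" "y' \<in> carrier (N\<lparr>carrier := V\<rparr>)"
    and eq: "s \<odot>\<^bsub>M\<lparr>carrier := U\<rparr>\<^esub> x' = t \<odot>\<^bsub>M\<lparr>carrier := U\<rparr>\<^esub> x"
      "s \<odot>\<^bsub>N\<lparr>carrier := V\<rparr>\<^esub> y' = t \<odot>\<^bsub>N\<lparr>carrier := V\<rparr>\<^esub> y"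
  have "x \<in> carrier M" "x' \<in> carrier M" "y \<in> carrier N" "y' \<in> carrier N"
    using x y module.submoduleE(1)[OF M U(1)] module.submoduleE(1)[OF N V(1)] by auto
  then have "\<alpha> (\<pi> x') \<otimes>\<^bsub>R Quot \<mm>\<^esub> \<beta> (\<tau> y) = \<alpha> (\<pi> x) \<otimes>\<^bsub>R Quot \<mm>\<^esub> \<beta> (\<tau> y')"
    using bal[unfolded fractions_balanced_def, rule_format,
        OF residue_functional_comp[OF U(2) \<alpha>] residue_functional_comp[OF V(2) \<beta>] st] eq by simp
  then show "\<alpha> x' \<otimes>\<^bsub>R Quot \<mm>\<^esub> \<beta> y = \<alpha> x \<otimes>\<^bsub>R Quot \<mm>\<^esub> \<beta> y'" using U(3) V(3) x y by simp
qed

text \<open>In the tensor product \<open>s (x' \<otimes> y - x \<otimes> y') = t x \<otimes> y - x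
  \<otimes> t y = 0\<close>, so the difference vanishes by torsion-freeness; the bilinear map given
  by the products of the values of \<open>\<alpha>\<close> and \<open>\<beta>\<close> factors
  through the tensor product.\<close>

lemma torsion_free_tensor_balanced:
  fixes M :: "('a, 'm, 'x) module_scheme" and N :: "('a, 'n, 'y) module_scheme"
  assumes M: "module R M" and N: "module R N" and tf: "torsion_free R (tensor_product R M N)"
  shows "fractions_balanced M N"
  unfolding fractions_balanced_def
proof (intro allI impI)
  fix \<alpha> \<beta> s t x x' y y'
  assume \<alpha>: "residue_functional M \<alpha>" and \<beta>: "residue_functional N \<beta>"
    and s: "s \<in> carrier R" "s \<noteq> \<zero>" and t: "t \<in> carrier R"
    and x: "x \<in> carrier M" "x' \<in> carrier M" and y: "y \<in> carrier N" "y' \<in> carrier N"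
    and eq: "s \<odot>\<^bsub>M\<^esub> x' = t \<odot>\<^bsub>M\<^esub> x" "s \<odot>\<^bsub>N\<^esub> y' = t \<odot>\<^bsub>N\<^esub> y"
  interpret M: module R M by (rule M)
  interpret N: module R N by (rule N)
  interpret k: cring "R Quot \<mm>" by (rule residue_ring)
  interpret \<rho>: ring_hom_ring R "R Quot \<mm>" "(+>) \<mm>" by (rule residue_hom)
  note a = residue_functionalD[OF \<alpha>] and b = residue_functionalD[OF \<beta>]
  define F where "F = free_Abelian_group (carrier M \<times> carrier N)"
  define Rel where "Rel = tensor_relations R M N"
  define T where "T = generate F Rel"
  \<comment> \<open>Scalar multiplication by \<open>s\<close> on representatives in the free abelian
    group. It maps relations to relations, hence \<open>T\<close> into itself.\<close>
  define act where "act = frag_extend (\<lambda>(x :: 'm, y :: 'n). frag_of (s \<odot>\<^bsub>M\<^esub> x, y))"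
  interpret F: comm_group F unfolding F_def by (rule abelian_free_Abelian_group)
  have Fc: "u \<in> carrier F \<longleftrightarrow> Poly_Mapping.keys u \<subseteq> carrier M \<times> carrier N" for u
    by (simp add: F_def)
  have Fops: "u \<otimes>\<^bsub>F\<^esub> w = u + w" "\<one>\<^bsub>F\<^esub> = 0" for u w by (simp_all add: F_def)
  have of: "frag_of (p, q) \<in> carrier F" if "p \<in> carrier M" "q \<in> carrier N" for p q
    using that by (simp add: Fc)
  have Fdiff: "u - w \<in> carrier F" if "u \<in> carrier F" "w \<in> carrier F" for u w
    using that keys_diff[of u w] by (auto simp: Fc)
  have Finv: "inv\<^bsub>F\<^esub> u = - u" if "u \<in> carrier F" for u
    using that by (simp add: F_def)
  have RelF: "Rel \<subseteq> carrier F"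
  proof
    show "u \<in> carrier F" if "u \<in> Rel" for u
      using that unfolding Rel_def by (cases rule: tensor_relationsE) (auto intro!: Fdiff of)
  qed
  have Tsub: "subgroup T F" unfolding T_def by (rule F.generate_is_subgroup[OF RelF])
  interpret T: subgroup T F by (rule Tsub)
  have Tadd: "u + w \<in> T" if "u \<in> T" "w \<in> T" for u w using T.m_closed[OF that] by (simp add: Fops)
  have Tneg: "- u \<in> T" if "u \<in> T" for u using T.m_inv_closed[OF that] Finv[OF T.mem_carrier[OF that]] by simp
  have RelT: "u \<in> T" if "u \<in> Rel" for u unfolding T_def using that by (rule generate.incl)
  have balT: "frag_of (r \<odot>\<^bsub>M\<^esub> p, q) - frag_of (p, r \<odot>\<^bsub>N\<^esub> q) \<in> T"
    if "r \<in> carrier R" "p \<in> carrier M" "q \<in> carrier N" for r p q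
    using RelT tensor_relationsI(3)[OF that] by (simp add: Rel_def)
  have act_of: "act (frag_of (p, q)) = frag_of (s \<odot>\<^bsub>M\<^esub> p, q)" for p q by (simp add: act_def)
  have act_add: "act (u + w) = act u + act w" and act_diff: "act (u - w) = act u - act w" for u w
    by (simp_all add: act_def frag_extend_add frag_extend_diff)
  have actRel: "act u \<in> T" if "u \<in> Rel" for u
  proof (rule RelT)
    have "u \<in> tensor_relations R M N" using that by (simp add: Rel_def)
    then show "act u \<in> Rel"
    proof (cases rule: tensor_relationsE)
      case (1 p p' q)
      have "act u = frag_of (s \<odot>\<^bsub>M\<^esub> p \<oplus>\<^bsub>M\<^esub> s \<odot>\<^bsub>M\<^esub> p', q) - frag_of (s \<odot>\<^bsub>M\<^esub> p, q) - frag_of (s \<odot>\<^bsub>M\<^esub> p', q)"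
        using 1 s(1) by (simp add: act_of act_diff M.smult_r_distr)
      then show ?thesis
        using tensor_relationsI(1)[where M = M and N = N and R = R] 1(1-3) s(1) by (simp add: Rel_def)
    next
      case (2 p q q')
      have "act u = frag_of (s \<odot>\<^bsub>M\<^esub> p, q \<oplus>\<^bsub>N\<^esub> q') - frag_of (s \<odot>\<^bsub>M\<^esub> p, q) - frag_of (s \<odot>\<^bsub>M\<^esub> p, q')"
        using 2 by (simp add: act_of act_diff)
      then show ?thesis
        using tensor_relationsI(2)[where M = M and N = N and R = R] 2(1-3) s(1) by (simp add: Rel_def)
    next
      case (3 r p q)
      have "s \<odot>\<^bsub>M\<^esub> (r \<odot>\<^bsub>M\<^esub> p) = r \<odot>\<^bsub>M\<^esub> (s \<odot>\<^bsub>M\<^esub> p)"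
        using 3(1,2) s(1) by (simp add: m_comm[of s r] flip: M.smult_assoc1)
      then have "act u = frag_of (r \<odot>\<^bsub>M\<^esub> (s \<odot>\<^bsub>M\<^esub> p), q) - frag_of (s \<odot>\<^bsub>M\<^esub> p, r \<odot>\<^bsub>N\<^esub> q)"
        using 3 by (simp add: act_of act_diff)
      then show ?thesis
        using tensor_relationsI(3)[where M = M and N = N and R = R] 3(1-3) s(1) by (simp add: Rel_def)
    qed
  qed
  have actT: "act u \<in> T" if "u \<in> T" for u
    using that unfolding T_def
  proof (induction rule: generate.induct)
    case one
    show ?case using generate.one[of F Rel] by (simp add: Fops act_def)
  next
    case (incl h)
    then show ?case using actRel by (simp add: T_def)
  next
    case (inv h)
    then have "act (inv\<^bsub>F\<^esub> h) = - act h"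
      using Finv[of h] RelF act_diff[of 0 h] by (auto simp: act_def)
    then show ?case using Tneg[OF actRel[OF inv]] by (simp add: T_def)
  next
    case (eng h1 h2)
    then show ?case using Tadd by (simp add: Fops act_add T_def)
  qed
  define u where "u = frag_of (x', y) - frag_of (x, y')"
  have uF: "u \<in> carrier F" unfolding u_def using x y of Fdiff by blast
  \<comment> \<open>The first bracket is the relation that moves \<open>t\<close> across, the second
    the one that moves \<open>s\<close>; the terms \<open>(x, t y)\<close> and
    \<open>(x, s y')\<close> cancel by the second equation.\<close>
  have "act u = (frag_of (t \<odot>\<^bsub>M\<^esub> x, y) - frag_of (x, t \<odot>\<^bsub>N\<^esub> y)) + - (frag_of (s \<odot>\<^bsub>M\<^esub> x, y') - frag_of (x, s \<odot>\<^bsub>N\<^esub> y'))"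
    using eq by (simp add: u_def act_diff act_of)
  then have actu: "act u \<in> T" using Tadd[OF balT[OF t x(1) y(1)] Tneg[OF balT[OF s(1) x(1) y(2)]]] by simp
  let ?P = "tensor_product R M N"
  define A where "A = T #>\<^bsub>F\<^esub> u"
  have P: "carrier ?P = carrier (F Mod T)" "\<zero>\<^bsub>?P\<^esub> = T" "s \<odot>\<^bsub>?P\<^esub> A = (\<Union>w\<in>A. T #>\<^bsub>F\<^esub> act w)"
    unfolding tensor_product_def Let_def F_def T_def Rel_def act_def by (simp_all add: FactGroup_def)
  have A: "A \<in> carrier ?P" unfolding P(1) A_def FactGroup_def RCOSETS_def using uF by auto
  have uA: "u \<in> A" unfolding A_def by (rule F.rcos_self[OF uF Tsub])
  \<comment> \<open>All representatives of the class of \<open>u\<close> are sent into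
    \<open>T\<close>, so the union that defines the scalar multiple is the single coset
    \<open>T\<close>, the zero of the tensor product.\<close>
  have "T #>\<^bsub>F\<^esub> act w = T" if w: "w \<in> A" for w
  proof -
    obtain h where "h \<in> T" "w = h + u" using w by (auto simp: A_def r_coset_def Fops)
    then have "act w \<in> T" using actT actu Tadd act_add by simp
    then show ?thesis using F.coset_join2[OF T.mem_carrier Tsub] by blast
  qed
  then have "s \<odot>\<^bsub>?P\<^esub> A = \<zero>\<^bsub>?P\<^esub>" unfolding P(2,3) using uA by blast
  moreover have "regular_element R s" unfolding regular_element_def using s integral by blast
  ultimately have "A = T" using tf A unfolding torsion_free_def P(2) by metis
  then have uT: "u \<in> T" using uA by simp
  \<comment> \<open>The additive map given on generators by the product of the values of
    \<open>\<alpha>\<close> and \<open>\<beta>\<close>. It kills the relations because both are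
    linear, and hence \<open>T\<close>.\<close>
  obtain h where h: "h \<in> hom F (add_monoid (R Quot \<mm>))"
    and hof: "\<And>p. p \<in> carrier M \<times> carrier N \<Longrightarrow> h (frag_of p) = (case p of (p, q) \<Rightarrow> \<alpha> p \<otimes>\<^bsub>R Quot \<mm>\<^esub> \<beta> q)"
    using comm_group.free_Abelian_group_universal[OF k.a_comm_group, of "\<lambda>(p, q). \<alpha> p \<otimes>\<^bsub>R Quot \<mm>\<^esub> \<beta> q" "carrier M \<times> carrier N"] a(1) b(1)
    unfolding F_def by (auto simp: image_subset_iff)
  interpret h: group_hom F "add_monoid (R Quot \<mm>)" h
    by (intro group_hom.intro group_hom_axioms.intro h F.is_group comm_group.axioms(2)[OF k.a_comm_group])
  have hdiff: "h (u - w) = h u \<ominus>\<^bsub>R Quot \<mm>\<^esub> h w" if "u \<in> carrier F" "w \<in> carrier F" for u w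
  proof -
    have "h (u \<otimes>\<^bsub>F\<^esub> inv\<^bsub>F\<^esub> w) = h u \<oplus>\<^bsub>R Quot \<mm>\<^esub> (\<ominus>\<^bsub>R Quot \<mm>\<^esub> h w)"
      using that h.hom_mult[of u "inv\<^bsub>F\<^esub> w"] h.hom_inv[of w] by (simp add: a_inv_def)
    then show ?thesis using that by (simp add: Fops Finv a_minus_def)
  qed
  have hRel: "h v = \<zero>\<^bsub>R Quot \<mm>\<^esub>" if "v \<in> Rel" for v
  proof -
    have "v \<in> tensor_relations R M N" using that by (simp add: Rel_def)
    then show ?thesis
    proof (cases rule: tensor_relationsE)
      case (1 p p' q)
      then show ?thesis using a b of Fdiff
        by (simp add: hdiff hof k.l_distr k.minus_add a_minus_def k.a_ac k.r_neg1 k.r_neg2 k.r_neg)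
    next
      case (2 p q q')
      then show ?thesis using a b of Fdiff
        by (simp add: hdiff hof k.r_distr k.minus_add a_minus_def k.a_ac k.r_neg1 k.r_neg2 k.r_neg)
    next
      case (3 r p q)
      then show ?thesis using a b of by (simp add: hdiff hof k.m_ac)
    qed
  qed
  have "h v = \<zero>\<^bsub>R Quot \<mm>\<^esub>" if "v \<in> T" for v
    using that unfolding T_def
  proof (induction rule: generate.induct)
    case one
    show ?case using h.hom_one by simp
  next
    case (incl v)
    then show ?case by (rule hRel)
  next
    case (inv v)
    then have "h (inv\<^bsub>F\<^esub> v) = \<ominus>\<^bsub>R Quot \<mm>\<^esub> \<zero>\<^bsub>R Quot \<mm>\<^esub>"
      using h.hom_inv[of v] RelF hRel by (auto simp: a_inv_def)
    then show ?case by simp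
  next
    case (eng v w)
    then show ?case using h.hom_mult[of v w] F.generate_in_carrier[OF RelF] by simp
  qed
  then have "h u = \<zero>\<^bsub>R Quot \<mm>\<^esub>" using uT by blast
  then have "\<alpha> x' \<otimes>\<^bsub>R Quot \<mm>\<^esub> \<beta> y \<ominus>\<^bsub>R Quot \<mm>\<^esub> \<alpha> x \<otimes>\<^bsub>R Quot \<mm>\<^esub> \<beta> y' = \<zero>\<^bsub>R Quot \<mm>\<^esub>"
    using hdiff[OF of of] x y by (simp add: u_def hof)
  then show "\<alpha> x' \<otimes>\<^bsub>R Quot \<mm>\<^esub> \<beta> y = \<alpha> x \<otimes>\<^bsub>R Quot \<mm>\<^esub> \<beta> y'"
    using k.minus_eq_zero_iff a(1) b(1) x y by simp
qed

end

section \<open>The endomorphism ring of the maximal ideal\<close>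

text \<open>
  Nakayama's lemma: among the ideals \<open>J \<subseteq> I\<close> that contain no \<open>c I\<close> with \<open>c \<equiv> 1\<close> modulo \<open>\<nn>\<close>, a
  maximal one contains \<open>\<nn> I\<close>.
\<close>

lemma (in noetherian_domain) exists_proper_subideal:
  assumes \<nn>: "ideal \<nn> R" "\<one> \<notin> \<nn>" and I: "ideal I R" "I \<noteq> {\<zero>}"
  obtains J where "ideal J R" "J \<subset> I" "\<And>\<nu> y. \<nu> \<in> \<nn> \<Longrightarrow> y \<in> I \<Longrightarrow> \<nu> \<otimes> y \<in> J"
proof -
  interpret n: ideal \<nn> R by (rule \<nn>(1))
  interpret I: ideal I R by (rule I(1))
  \<comment> \<open>For maximal \<open>\<nn>\<close> and \<open>J\<close> inside \<open>I\<close>,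
    the existence of such a \<open>c\<close> means that \<open>I\<close> and \<open>J\<close> agree
    after localization at \<open>\<nn>\<close>.\<close>
  let ?P = "\<lambda>c J. c \<in> carrier R \<and> \<one> \<ominus> c \<in> \<nn> \<and> (\<forall>y\<in>I. c \<otimes> y \<in> J)"
  let ?S = "{J. ideal J R \<and> J \<subseteq> I \<and> \<not> (\<exists>c. ?P c J)}"
  obtain y0 where y0: "y0 \<in> I" "y0 \<noteq> \<zero>" using I(2) I.zero_closed by blast
  have "\<not> ?P c {\<zero>}" for c
  proof
    assume c: "?P c {\<zero>}"
    then have "c = \<zero>" using y0 integral[of c y0] I.Icarr by auto
    then show False using c \<nn>(2) by (simp add: a_minus_def)
  qed
  then have "{\<zero>} \<in> ?S" using zeroideal I.zero_closed by blast
  then obtain J where J: "ideal J R" "J \<subseteq> I" "\<And>c. \<not> ?P c J"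
    and max: "\<And>J'. J' \<in> ?S \<Longrightarrow> J \<subseteq> J' \<Longrightarrow> J' = J"
    using exists_maximal_ideal_in[of ?S] by (smt (verit) empty_iff mem_Collect_eq subsetI)
  interpret J: ideal J R by (rule J(1))
  have "?P \<one> I" using I.Icarr n.zero_closed by (simp add: a_minus_def r_neg)
  then have neq: "J \<noteq> I" using J(3) by blast
  have "\<nu> \<otimes> y \<in> J" if \<nu>: "\<nu> \<in> \<nn>" and y: "y \<in> I" for \<nu> y
  proof (rule ccontr)
    assume no: "\<nu> \<otimes> y \<notin> J"
    have yR: "y \<in> carrier R" and \<nu>R: "\<nu> \<in> carrier R" using y \<nu> I.Icarr n.Icarr by blast+
    have \<nu>y: "\<nu> \<otimes> y \<in> carrier R" "\<nu> \<otimes> y \<in> I" using yR \<nu>R y I.I_l_closed by simp_all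
    let ?J = "J <+>\<^bsub>R\<^esub> PIdl (\<nu> \<otimes> y)"
    have idl: "ideal ?J R" by (rule add_ideals[OF J(1) cgenideal_ideal[OF \<nu>y(1)]])
    have memJ: "u \<in> ?J \<longleftrightarrow> (\<exists>j\<in>J. \<exists>r\<in>carrier R. u = j \<oplus> r \<otimes> (\<nu> \<otimes> y))" for u
      by (auto simp: set_add_def set_mult_def cgenideal_def)
    have JJ: "J \<subseteq> ?J"
    proof
      show "j \<in> ?J" if "j \<in> J" for j
        unfolding memJ using that \<nu>y J.Icarr[OF that] by (intro bexI[of _ j] bexI[of _ \<zero>]) simp_all
    qed
    have "\<nu> \<otimes> y \<in> ?J"
      unfolding memJ using \<nu>y J.zero_closed by (intro bexI[of _ \<zero>] bexI[of _ \<one>]) simp_all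
    then have "?J \<noteq> J" using no by blast
    then have "?J \<notin> ?S" using max[of ?J] JJ by blast
    moreover have "?J \<subseteq> I"
    proof
      show "u \<in> I" if "u \<in> ?J" for u
        using that[unfolded memJ] J(2) \<nu>y(2) I.I_l_closed I.a_closed by blast
    qed
    ultimately obtain c where c: "?P c ?J" using idl by blast
    then have cR: "c \<in> carrier R" and c1: "\<one> \<ominus> c \<in> \<nn>" by blast+
    have "c \<otimes> y \<in> ?J" using c y by blast
    then obtain j e where j: "j \<in> J" and e: "e \<in> carrier R" and cy: "c \<otimes> y = j \<oplus> e \<otimes> (\<nu> \<otimes> y)"
      unfolding memJ by blast
    note jR = J.Icarr[OF j]
    \<comment> \<open>Since \<open>d y\<close> lies in \<open>J\<close>, multiplication by
      \<open>d\<close> absorbs the multiples of \<open>\<nu> y\<close> in \<open>?J\<close>. Thus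
      \<open>d c\<close> carries \<open>I\<close> into \<open>J\<close>, and it is still congruent
      to 1 modulo \<open>\<nn>\<close>.\<close>
    define d where "d = c \<ominus> e \<otimes> \<nu>"
    have dR: "d \<in> carrier R" using cR e \<nu>R by (simp add: d_def)
    have dy: "d \<otimes> y = j" using cy cR e \<nu>R yR jR unfolding d_def by algebra
    have e\<nu>: "e \<otimes> \<nu> \<in> \<nn>" using n.I_l_closed[OF \<nu> e] .
    have "\<one> \<ominus> d \<otimes> c = (\<one> \<ominus> c) \<otimes> (\<one> \<oplus> c) \<oplus> c \<otimes> (e \<otimes> \<nu>)"
      using cR e \<nu>R unfolding d_def by algebra
    then have "\<one> \<ominus> d \<otimes> c \<in> \<nn>"
      using n.I_r_closed[OF c1, of "\<one> \<oplus> c"] n.I_l_closed[OF e\<nu> cR] cR n.a_closed by simp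
    moreover have "(d \<otimes> c) \<otimes> z \<in> J" if z: "z \<in> I" for z
    proof -
      have "c \<otimes> z \<in> ?J" using c z by blast
      then obtain j' e' where j': "j' \<in> J" and e': "e' \<in> carrier R" and cz: "c \<otimes> z = j' \<oplus> e' \<otimes> (\<nu> \<otimes> y)"
        unfolding memJ by blast
      have "(d \<otimes> c) \<otimes> z = d \<otimes> (c \<otimes> z)" using dR cR I.Icarr[OF z] by (simp add: m_assoc)
      also have "\<dots> = d \<otimes> j' \<oplus> (e' \<otimes> \<nu>) \<otimes> (d \<otimes> y)"
        unfolding cz using dR e' \<nu>R yR J.Icarr[OF j'] by algebra
      finally show ?thesis
        unfolding dy using J.I_l_closed[OF j' dR] J.I_l_closed[OF j, of "e' \<otimes> \<nu>"] e' \<nu>R J.a_closed by simp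
    qed
    ultimately show False using J(3)[of "d \<otimes> c"] dR cR by simp
  qed
  then show thesis using that[OF J(1)] J(2) neq by blast
qed

locale max_multipliers = one_dim_local_domain R \<mm> + K: field K
  for R :: "('a, 'b) ring_scheme" (structure) and \<mm> and K :: "('a, 'b) ring_scheme" +
  assumes subring_R: "subring (carrier R) K" and R_eq: "R = K\<lparr>carrier := carrier R\<rparr>"
begin

sublocale max: ideal \<mm> R by (rule ideal_max)

definition E :: "('a, 'b) ring_scheme" where "E = multiplier_ring K \<mm>"

lemma R_ops: "monoid.mult R = monoid.mult K" "ring.add R = ring.add K" "\<zero> = \<zero>\<^bsub>K\<^esub>" "\<one> = \<one>\<^bsub>K\<^esub>"
  by (subst R_eq, simp)+

lemma E_ops [simp]: "monoid.mult E = monoid.mult K" "ring.add E = ring.add K"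
  "\<zero>\<^bsub>E\<^esub> = \<zero>\<^bsub>K\<^esub>" "\<one>\<^bsub>E\<^esub> = \<one>\<^bsub>K\<^esub>"
  by (simp_all add: E_def multiplier_ring_def)

lemma in_E_iff: "e \<in> carrier E \<longleftrightarrow> e \<in> carrier K \<and> (\<forall>x\<in>\<mm>. e \<otimes>\<^bsub>K\<^esub> x \<in> \<mm>)"
  by (simp add: E_def multiplier_ring_def)

lemma R_K: "r \<in> carrier R \<Longrightarrow> r \<in> carrier K"
  using subringE(1)[OF subring_R] by blast

lemma R_closed:
  assumes "r \<in> carrier R" "s \<in> carrier R"
  shows "r \<otimes>\<^bsub>K\<^esub> s \<in> carrier R" "r \<oplus>\<^bsub>K\<^esub> s \<in> carrier R" "\<ominus>\<^bsub>K\<^esub> r \<in> carrier R" "r \<ominus>\<^bsub>K\<^esub> s \<in> carrier R"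
  using assms subringE(5-7)[OF subring_R] by (simp_all add: a_minus_def)

lemma E_K: "e \<in> carrier E \<Longrightarrow> e \<in> carrier K"
  by (simp add: in_E_iff)

lemma E_max: "e \<in> carrier E \<Longrightarrow> x \<in> \<mm> \<Longrightarrow> e \<otimes>\<^bsub>K\<^esub> x \<in> \<mm>"
  by (simp add: in_E_iff)

lemma max_closed:
  assumes "x \<in> \<mm>"
  shows "y \<in> \<mm> \<Longrightarrow> x \<oplus>\<^bsub>K\<^esub> y \<in> \<mm>" "r \<in> carrier R \<Longrightarrow> r \<otimes>\<^bsub>K\<^esub> x \<in> \<mm>" "\<ominus>\<^bsub>K\<^esub> x \<in> \<mm>" "x \<in> carrier K"
    and "x \<in> carrier R"
proof -
  show "y \<in> \<mm> \<Longrightarrow> x \<oplus>\<^bsub>K\<^esub> y \<in> \<mm>" using max.a_closed[OF assms, of y] by (simp add: R_ops)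
  show r: "r \<otimes>\<^bsub>K\<^esub> x \<in> \<mm>" if "r \<in> carrier R" for r
    using max.I_l_closed[OF assms that] by (simp add: R_ops)
  show "x \<in> carrier R" using max.Icarr[OF assms] .
  then show x: "x \<in> carrier K" by (rule R_K)
  show "\<ominus>\<^bsub>K\<^esub> x \<in> \<mm>" using r[of "\<ominus>\<^bsub>K\<^esub> \<one>\<^bsub>K\<^esub>"] subringE(3,5)[OF subring_R] x by (simp add: K.l_minus)
qed

lemma R_subset_E: "carrier R \<subseteq> carrier E"
  using R_K max_closed(2) by (auto simp: in_E_iff)

lemma subring_E: "subring (carrier E) K"
proof (rule K.subringI)
  show "carrier E \<subseteq> carrier K" using E_K by blast
  show "\<one>\<^bsub>K\<^esub> \<in> carrier E" using max_closed(4) by (auto simp: in_E_iff)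
  show "\<ominus>\<^bsub>K\<^esub> e \<in> carrier E" if "e \<in> carrier E" for e
    using that max_closed(3,4) by (auto simp: in_E_iff K.l_minus)
  show "e \<otimes>\<^bsub>K\<^esub> e' \<in> carrier E" if "e \<in> carrier E" "e' \<in> carrier E" for e e'
    using that max_closed(4) by (auto simp: in_E_iff K.m_assoc)
  show "e \<oplus>\<^bsub>K\<^esub> e' \<in> carrier E" if "e \<in> carrier E" "e' \<in> carrier E" for e e'
    using that max_closed(1,4) by (auto simp: in_E_iff K.l_distr)
qed

lemma E_eq: "E = K\<lparr>carrier := carrier E\<rparr>"
  by (simp add: E_def multiplier_ring_def)

lemma domain_E: "domain E"
  using K.subring_is_domain[OF subring_E] E_eq by simp

lemma E_uminus: "e \<in> carrier E \<Longrightarrow> \<ominus>\<^bsub>E\<^esub> e = \<ominus>\<^bsub>K\<^esub> e"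
  by (rule abelian_group.minus_equality[of E])
    (use domain_E E_K subringE(5)[OF subring_E] in \<open>auto simp: domain_def cring_def ring_def K.l_neg\<close>)

lemma exists_max_element: obtains a where "a \<in> \<mm>" "a \<noteq> \<zero>\<^bsub>K\<^esub>"
  using max_nonzero R_ops(3) by metis

text \<open>Multiplication by a nonzero \<open>a\<close> in \<open>\<mm>\<close> embeds
  \<open>E\<close> into \<open>\<mm>\<close> and turns ideals of \<open>E\<close> into ideals of
  \<open>R\<close>. A finite set generating \<open>a I\<close> over \<open>R\<close> has the form
  \<open>a T\<close>, and \<open>T\<close> generates \<open>I\<close> over \<open>E\<close>.\<close>

lemma noetherian_E: "noetherian_ring E"
proof -
  interpret E: domain E by (rule domain_E)
  obtain a where a: "a \<in> \<mm>" "a \<noteq> \<zero>\<^bsub>K\<^esub>" by (rule exists_max_element)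
  note aK = max_closed(4)[OF a(1)]
  let ?a = "\<lambda>I. (\<lambda>e. e \<otimes>\<^bsub>K\<^esub> a) ` I"
  have inj: "e = e'" if "e \<otimes>\<^bsub>K\<^esub> a = e' \<otimes>\<^bsub>K\<^esub> a" "e \<in> carrier E" "e' \<in> carrier E" for e e'
    using that E_K aK a(2) K.m_rcancel by blast
  have idl: "ideal (?a I) R" if "ideal I E" for I
  proof -
    interpret I: ideal I E by (rule that)
    show ?thesis
    proof (rule idealI)
      show "ring R" by (rule ring_axioms)
      show "subgroup (?a I) (add_monoid R)"
      proof (rule add.subgroupI)
        show "?a I \<subseteq> carrier R" using E_max[OF I.Icarr a(1)] max.Icarr by blast
        show "?a I \<noteq> {}" using I.zero_closed by blast
        show "\<ominus> x \<in> ?a I" if x: "x \<in> ?a I" for x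
        proof -
          obtain e where e: "e \<in> I" "x = e \<otimes>\<^bsub>K\<^esub> a" using x by blast
          have xR: "x \<in> carrier R" using E_max[OF I.Icarr[OF e(1)] a(1)] e(2) max.Icarr by simp
          have "\<ominus>\<^bsub>K\<^esub> x \<oplus> x = \<zero>" using R_K[OF xR] by (simp add: R_ops K.l_neg)
          then have "\<ominus> x = \<ominus>\<^bsub>K\<^esub> x" using minus_equality xR R_closed(3) by blast
          also have "\<dots> = (\<ominus>\<^bsub>E\<^esub> e) \<otimes>\<^bsub>K\<^esub> a"
            using e(2) E_K[OF I.Icarr[OF e(1)]] aK E_uminus[OF I.Icarr[OF e(1)]] by (simp add: K.l_minus)
          finally show ?thesis using I.a_inv_closed[OF e(1)] by (auto simp: a_inv_def)
        qed
        show "x \<oplus> y \<in> ?a I" if xy: "x \<in> ?a I" "y \<in> ?a I" for x y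
        proof -
          obtain e e' where e: "e \<in> I" "x = e \<otimes>\<^bsub>K\<^esub> a" "e' \<in> I" "y = e' \<otimes>\<^bsub>K\<^esub> a" using xy by blast
          have "x \<oplus> y = (e \<oplus>\<^bsub>K\<^esub> e') \<otimes>\<^bsub>K\<^esub> a"
            using e E_K[OF I.Icarr] aK by (simp add: R_ops K.l_distr)
          then show ?thesis using I.a_closed[OF e(1,3)] by auto
        qed
      qed
      show "r \<otimes> x \<in> ?a I" if r: "r \<in> carrier R" and x: "x \<in> ?a I" for r x
      proof -
        obtain e where e: "e \<in> I" "x = e \<otimes>\<^bsub>K\<^esub> a" using x by blast
        have "r \<otimes> x = (r \<otimes>\<^bsub>K\<^esub> e) \<otimes>\<^bsub>K\<^esub> a"
          using e E_K[OF I.Icarr] aK R_K[OF r] by (simp add: R_ops K.m_assoc)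
        then show ?thesis using I.I_l_closed[OF e(1), of r] R_subset_E r by auto
      qed
      then show "x \<otimes> r \<in> ?a I" if "r \<in> carrier R" "x \<in> ?a I" for r x
        using that E_max[OF I.Icarr a(1)] max.Icarr m_comm[of x r] by force
    qed
  qed
  show ?thesis
  proof (rule E.noetherian_ringI)
    fix I assume I: "ideal I E"
    interpret I: ideal I E by (rule I)
    obtain S where S: "S \<subseteq> carrier R" "finite S" "?a I = Idl S" using finetely_gen[OF idl[OF I]] by blast
    have SI: "S \<subseteq> ?a I" using genideal_self[OF S(1)] S(3) by simp
    then obtain T where T: "T \<subseteq> I" "finite T" "S = ?a T" using finite_subset_image[OF S(2)] by blast
    have TE: "T \<subseteq> carrier E" using T(1) I.Icarr by blast
    have "Idl\<^bsub>E\<^esub> T \<subseteq> I" by (rule E.genideal_minimal[OF I T(1)])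
    moreover have "I \<subseteq> Idl\<^bsub>E\<^esub> T"
    proof
      fix e assume e: "e \<in> I"
      interpret T: ideal "Idl\<^bsub>E\<^esub> T" E by (rule E.genideal_ideal[OF TE])
      have "S \<subseteq> ?a (Idl\<^bsub>E\<^esub> T)" using E.genideal_self[OF TE] T(3) by blast
      then have "?a I \<subseteq> ?a (Idl\<^bsub>E\<^esub> T)"
        unfolding S(3) by (rule genideal_minimal[OF idl[OF T.is_ideal]])
      then obtain e' where "e' \<in> Idl\<^bsub>E\<^esub> T" "e \<otimes>\<^bsub>K\<^esub> a = e' \<otimes>\<^bsub>K\<^esub> a" using e by blast
      then show "e \<in> Idl\<^bsub>E\<^esub> T" using inj I.Icarr[OF e] T.Icarr by blast
    qed
    ultimately show "\<exists>T\<subseteq>carrier E. finite T \<and> I = Idl\<^bsub>E\<^esub> T" using TE T(2) by blast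
  qed
qed

sublocale E: noetherian_domain E
  using noetherian_E domain_E by (intro noetherian_domain.intro)

text \<open>Any nonzero \<open>a\<close> in \<open>\<mm>\<close> serves as denominator:
  \<open>p = e a\<close> lies in \<open>\<mm>\<close>, and \<open>p r = a (e r)\<close> with
  \<open>e r\<close> in \<open>\<mm>\<close>. This is the kind of fraction that
  \<open>fraction_multiple_in_image\<close> accepts.\<close>

lemma fraction_of_E:
  assumes "e \<in> carrier E"
  obtains p q where "p \<in> carrier R" "q \<in> carrier R" "q \<noteq> \<zero>" "p = e \<otimes>\<^bsub>K\<^esub> q"
    "\<And>r. r \<in> \<mm> \<Longrightarrow> \<exists>s\<in>carrier R. p \<otimes> r = q \<otimes> s"
proof -
  obtain a where a: "a \<in> \<mm>" "a \<noteq> \<zero>\<^bsub>K\<^esub>" by (rule exists_max_element)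
  show thesis
  proof (rule that[of "e \<otimes>\<^bsub>K\<^esub> a" a])
    fix r assume r: "r \<in> \<mm>"
    have "(e \<otimes>\<^bsub>K\<^esub> a) \<otimes> r = a \<otimes> (e \<otimes>\<^bsub>K\<^esub> r)"
      using E_K[OF assms] max_closed(4) a(1) r by (simp add: R_ops K.m_ac)
    then show "\<exists>s\<in>carrier R. (e \<otimes>\<^bsub>K\<^esub> a) \<otimes> r = a \<otimes> s" using E_max[OF assms r] max.Icarr by blast
  qed (use a E_max[OF assms a(1)] max.Icarr R_ops in auto)
qed

text \<open>\<open>e x\<close> stays in \<open>\<mm>\<close>, so the inverse exists already in
  \<open>R\<close>. This places \<open>\<mm>\<close> in the Jacobson radical of
  \<open>E\<close>.\<close>

lemma one_minus_max_unit:
  assumes "e \<in> carrier E" "x \<in> \<mm>"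
  shows "\<one>\<^bsub>K\<^esub> \<ominus>\<^bsub>K\<^esub> e \<otimes>\<^bsub>K\<^esub> x \<in> Units E"
proof -
  let ?z = "e \<otimes>\<^bsub>K\<^esub> x"
  have z: "?z \<in> \<mm>" by (rule E_max[OF assms])
  note zc = max_closed(4,5)[OF z]
  have one: "\<one>\<^bsub>K\<^esub> \<in> carrier R" by (rule subringE(3)[OF subring_R])
  have wR: "\<one>\<^bsub>K\<^esub> \<ominus>\<^bsub>K\<^esub> ?z \<in> carrier R" using R_closed(4)[OF one zc(2)] .
  have "\<one>\<^bsub>K\<^esub> \<ominus>\<^bsub>K\<^esub> ?z \<notin> \<mm>"
  proof
    assume "\<one>\<^bsub>K\<^esub> \<ominus>\<^bsub>K\<^esub> ?z \<in> \<mm>"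
    then have "(\<one>\<^bsub>K\<^esub> \<ominus>\<^bsub>K\<^esub> ?z) \<oplus>\<^bsub>K\<^esub> ?z \<in> \<mm>" using max_closed(1) z by blast
    moreover have "(\<one>\<^bsub>K\<^esub> \<ominus>\<^bsub>K\<^esub> ?z) \<oplus>\<^bsub>K\<^esub> ?z = \<one>\<^bsub>K\<^esub>" using zc(1) by (simp add: a_minus_def K.a_assoc K.l_neg)
    ultimately show False using one_nonmember by (simp add: R_ops)
  qed
  then have "\<one>\<^bsub>K\<^esub> \<ominus>\<^bsub>K\<^esub> ?z \<in> Units R" using nonmember_unit wR by blast
  then show ?thesis using R_subset_E unfolding Units_def by (auto simp: R_ops)
qed

text \<open>If \<open>x\<close> were outside \<open>\<nn>\<close>, then \<open>1 = j + e x\<close>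
  with \<open>j\<close> in \<open>\<nn>\<close>, and \<open>j\<close> would be a unit by
  \<open>one_minus_max_unit\<close>. Consequently a quotient killed by \<open>\<nn>\<close> is a
  vector space over \<open>k\<close>, which functionals to \<open>k\<close> can detect.\<close>

lemma max_subset_maximalideal:
  assumes "maximalideal \<nn> E"
  shows "\<mm> \<subseteq> \<nn>"
proof
  fix x assume x: "x \<in> \<mm>"
  interpret n: maximalideal \<nn> E by (rule assms)
  have xE: "x \<in> carrier E" using max_closed(5)[OF x] R_subset_E by blast
  show "x \<in> \<nn>"
  proof (rule ccontr)
    assume nx: "x \<notin> \<nn>"
    let ?J = "\<nn> <+>\<^bsub>E\<^esub> PIdl\<^bsub>E\<^esub> x"
    have memJ: "u \<in> ?J \<longleftrightarrow> (\<exists>j\<in>\<nn>. \<exists>e\<in>carrier E. u = j \<oplus>\<^bsub>K\<^esub> e \<otimes>\<^bsub>K\<^esub> x)" for u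
      by (auto simp: set_add_def set_mult_def cgenideal_def)
    have J: "ideal ?J E" by (rule E.add_ideals[OF n.is_ideal E.cgenideal_ideal[OF xE]])
    have "\<nn> \<subseteq> ?J"
    proof
      show "j \<in> ?J" if "j \<in> \<nn>" for j
        unfolding memJ using that E_K[OF xE] E_K[OF n.Icarr[OF that]] E.zero_closed
        by (intro bexI[of _ j] bexI[of _ "\<zero>\<^bsub>K\<^esub>"]) simp_all
    qed
    moreover have "x \<in> ?J"
      unfolding memJ using E_K[OF xE] n.zero_closed E.one_closed
      by (intro bexI[of _ "\<zero>\<^bsub>K\<^esub>"] bexI[of _ "\<one>\<^bsub>K\<^esub>"]) simp_all
    ultimately have "?J = carrier E" using n.I_maximal[OF J] nx ideal.Icarr[OF J] by blast
    then have "\<one>\<^bsub>K\<^esub> \<in> ?J" using E.one_closed by simp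
    then obtain j e where j: "j \<in> \<nn>" and e: "e \<in> carrier E" and eq: "\<one>\<^bsub>K\<^esub> = j \<oplus>\<^bsub>K\<^esub> e \<otimes>\<^bsub>K\<^esub> x"
      unfolding memJ by blast
    have "j = \<one>\<^bsub>K\<^esub> \<ominus>\<^bsub>K\<^esub> e \<otimes>\<^bsub>K\<^esub> x"
      unfolding eq using E_K[OF n.Icarr[OF j]] E_K[OF e] E_K[OF xE]
      by (simp add: a_minus_def K.a_assoc K.r_neg)
    then have "j \<in> Units E" using one_minus_max_unit[OF e x] by simp
    then obtain i where "i \<in> carrier E" "i \<otimes>\<^bsub>E\<^esub> j = \<one>\<^bsub>E\<^esub>" unfolding Units_def by blast
    then have "\<one>\<^bsub>E\<^esub> \<in> \<nn>" using n.I_l_closed[OF j] by metis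
    then show False using n.one_imp_carrier n.I_notcarr by blast
  qed
qed

text \<open>
  For \<open>0 \<noteq> a \<in> \<mm>\<close> the ideals \<open>a (R + R e + \<dots> + R e\<^sup>k)\<close> of \<open>R\<close> become stationary.
\<close>

lemma E_subset_integral_closure: "carrier E \<subseteq> integral_closure R K"
proof
  fix e assume e: "e \<in> carrier E"
  note eK = E_K[OF e]
  obtain a where a: "a \<in> \<mm>" "a \<noteq> \<zero>\<^bsub>K\<^esub>" by (rule exists_max_element)
  note aK = max_closed(4)[OF a(1)]
  let ?ev = "\<lambda>p. K.eval p e"
  \<comment> \<open>Coefficient lists may begin with zeros, so length \<open>k\<close> means degree
    below \<open>k\<close>, and \<open>L k\<close> is
    \<open>R + R e + ... + R e^(k-1)\<close>.\<close>
  define L where "L k = {?ev p | p. set p \<subseteq> carrier R \<and> length p = k}" for k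
  have LI: "?ev p \<in> L k" if "set p \<subseteq> carrier R" "length p = k" for p k using that by (auto simp: L_def)
  have evE: "?ev p \<in> carrier E" if "set p \<subseteq> carrier R" for p
    using that
  proof (induction p)
    case Nil
    then show ?case using E.zero_closed by simp
  next
    case (Cons r p)
    have "e [^]\<^bsub>K\<^esub> n \<in> carrier E" for n :: nat
      by (induction n) (use e E.one_closed E.m_closed in auto)
    then show ?case using Cons R_subset_E E.m_closed[of r] E.a_closed by auto
  qed
  have evK: "?ev p \<in> carrier K" if "set p \<subseteq> carrier R" for p using E_K[OF evE[OF that]] .
  have pow: "e [^]\<^bsub>K\<^esub> n \<in> carrier K" for n :: nat using eK by simp
  have add: "\<exists>r. set r \<subseteq> carrier R \<and> length r = length p \<and> ?ev r = ?ev p \<oplus>\<^bsub>K\<^esub> ?ev q"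
    if "length p = length q" "set p \<subseteq> carrier R" "set q \<subseteq> carrier R" for p q
    using that
  proof (induction p q rule: list_induct2)
    case Nil
    then show ?case by simp
  next
    case (Cons x xs y ys)
    then obtain r where r: "set r \<subseteq> carrier R" "length r = length xs" "?ev r = ?ev xs \<oplus>\<^bsub>K\<^esub> ?ev ys" by auto
    have "?ev ((x \<oplus>\<^bsub>K\<^esub> y) # r) = ?ev (x # xs) \<oplus>\<^bsub>K\<^esub> ?ev (y # ys)"
      using Cons.prems Cons.hyps r evK[of xs] evK[of ys] R_K pow
      by (simp add: K.l_distr K.a_ac)
    then show ?case
      using r(1,2) Cons.prems R_closed(2) by (intro exI[of _ "(x \<oplus>\<^bsub>K\<^esub> y) # r"]) simp
  qed
  have scale: "?ev (map (\<lambda>x. c \<otimes>\<^bsub>K\<^esub> x) p) = c \<otimes>\<^bsub>K\<^esub> ?ev p" if "set p \<subseteq> carrier R" "c \<in> carrier R" for p c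
    using that
  proof (induction p)
    case Nil
    then show ?case using R_K by simp
  next
    case (Cons x p)
    then show ?case using evK[of p] R_K pow by (simp add: K.r_distr K.m_assoc)
  qed
  let ?J = "\<lambda>k. (\<lambda>y. y \<otimes>\<^bsub>K\<^esub> a) ` L k"
  have idl: "ideal (?J k) R" for k
  proof (rule idealI)
    show "ring R" by (rule ring_axioms)
    have JR: "?J k \<subseteq> carrier R" using E_max[OF evE a(1)] max.Icarr by (auto simp: L_def)
    have mult: "r \<otimes> x \<in> ?J k" if r: "r \<in> carrier R" and x: "x \<in> ?J k" for r x
    proof -
      obtain p where p: "set p \<subseteq> carrier R" "length p = k" "x = ?ev p \<otimes>\<^bsub>K\<^esub> a" using x by (auto simp: L_def)
      let ?p = "map (\<lambda>x. r \<otimes>\<^bsub>K\<^esub> x) p"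
      have "r \<otimes> x = ?ev ?p \<otimes>\<^bsub>K\<^esub> a"
        using p evK[OF p(1)] R_K[OF r] aK scale[OF p(1) r] by (simp add: R_ops K.m_assoc)
      moreover have "set ?p \<subseteq> carrier R" using p(1) r R_closed(1) by auto
      moreover have "length ?p = k" using p(2) by simp
      ultimately show ?thesis using LI by (metis imageI)
    qed
    show "subgroup (?J k) (add_monoid R)"
    proof (rule add.subgroupI[OF JR])
      have "?ev (replicate k \<zero>) \<in> L k" by (rule LI) auto
      then show "?J k \<noteq> {}" by blast
      show "\<ominus> x \<in> ?J k" if "x \<in> ?J k" for x
        using mult[of "\<ominus> \<one>" x] that JR by (auto simp: l_minus)
      show "x \<oplus> y \<in> ?J k" if xy: "x \<in> ?J k" "y \<in> ?J k" for x y
      proof -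
        obtain p q where p: "set p \<subseteq> carrier R" "length p = k" "x = ?ev p \<otimes>\<^bsub>K\<^esub> a"
          and q: "set q \<subseteq> carrier R" "length q = k" "y = ?ev q \<otimes>\<^bsub>K\<^esub> a" using xy by (auto simp: L_def)
        obtain r where r: "set r \<subseteq> carrier R" "length r = k" "?ev r = ?ev p \<oplus>\<^bsub>K\<^esub> ?ev q"
          using add[of p q] p q by auto
        have "x \<oplus> y = ?ev r \<otimes>\<^bsub>K\<^esub> a"
          using p(3) q(3) r(3) evK[OF p(1)] evK[OF q(1)] aK by (simp add: R_ops K.l_distr)
        then show ?thesis using LI[OF r(1,2)] by blast
      qed
    qed
    show "r \<otimes> x \<in> ?J k" if "x \<in> ?J k" "r \<in> carrier R" for r x using mult that by blast
    then show "x \<otimes> r \<in> ?J k" if "x \<in> ?J k" "r \<in> carrier R" for r x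
      using that JR m_comm[of x r] by auto
  qed
  obtain k where k: "\<And>l. ?J k \<subseteq> ?J l \<Longrightarrow> ?J l = ?J k"
  proof -
    have "range ?J \<noteq> {}" "range ?J \<subseteq> {I. ideal I R}" using idl by auto
    then obtain I where I: "I \<in> range ?J" "\<And>J. J \<in> range ?J \<Longrightarrow> I \<subseteq> J \<Longrightarrow> J = I"
      by (rule exists_maximal_ideal_in) blast
    from I(1) obtain k where "I = ?J k" by blast
    then show thesis using that[of k] I(2) by blast
  qed
  have "L k \<subseteq> L (Suc k)"
  proof
    fix y assume "y \<in> L k"
    then obtain p where p: "set p \<subseteq> carrier R" "length p = k" "y = ?ev p" by (auto simp: L_def)
    have "y = ?ev (\<zero> # p)" using p(3) evK[OF p(1)] pow by (simp add: R_ops)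
    then show "y \<in> L (Suc k)" using LI[of "\<zero> # p" "Suc k"] p(1,2) by simp
  qed
  then have "?J (Suc k) = ?J k" using k[of "Suc k"] by blast
  moreover have "e [^]\<^bsub>K\<^esub> k \<in> L (Suc k)"
  proof -
    have zeros: "?ev (replicate k \<zero>) = \<zero>\<^bsub>K\<^esub>"
      using K.eval_replicate[of "[]" e k] eK by (simp add: R_ops)
    have "e [^]\<^bsub>K\<^esub> k = ?ev (\<one> # replicate k \<zero>)" using zeros pow by (simp add: R_ops)
    moreover have "?ev (\<one> # replicate k \<zero>) \<in> L (Suc k)" by (rule LI) auto
    ultimately show ?thesis by simp
  qed
  ultimately have "e [^]\<^bsub>K\<^esub> k \<otimes>\<^bsub>K\<^esub> a \<in> ?J k" by blast
  then obtain y where y: "y \<in> L k" "e [^]\<^bsub>K\<^esub> k \<otimes>\<^bsub>K\<^esub> a = y \<otimes>\<^bsub>K\<^esub> a" by blast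
  obtain p where p: "set p \<subseteq> carrier R" "length p = k" "y = ?ev p" using y(1) by (auto simp: L_def)
  have eq: "e [^]\<^bsub>K\<^esub> k = ?ev p" using y(2) p(3) evK[OF p(1)] pow aK a(2) K.m_rcancel by simp
  have none: "\<ominus>\<^bsub>K\<^esub> \<one>\<^bsub>K\<^esub> \<in> carrier R" using subringE(3,5)[OF subring_R] by blast
  \<comment> \<open>The polynomial \<open>X^k - p\<close>: the head of a list is the leading
    coefficient, and \<open>p\<close> has exactly \<open>k\<close> entries.\<close>
  define f where "f = \<one>\<^bsub>K\<^esub> # map (\<lambda>x. (\<ominus>\<^bsub>K\<^esub> \<one>\<^bsub>K\<^esub>) \<otimes>\<^bsub>K\<^esub> x) p"
  have "set f \<subseteq> carrier R"
    using p(1) R_closed(1)[OF none] subringE(3)[OF subring_R] by (auto simp: f_def)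
  then have "f \<in> carrier ((carrier R) [X]\<^bsub>K\<^esub>)"
    using univ_poly_carrier[of K "carrier R" f] by (simp add: polynomial_def f_def)
  moreover have "?ev f = \<zero>\<^bsub>K\<^esub>"
    using scale[OF p(1) none] p(2) eq evK[OF p(1)] pow by (simp add: f_def K.l_minus K.r_neg)
  ultimately show "e \<in> integral_closure R K"
    unfolding integral_closure_def using eK by (auto simp: f_def intro!: bexI[of _ f])
qed

end

section \<open>Modules with torsion-free tensor product\<close>

context one_dim_local_domain
begin

lemma fractions_balanced_sym:
  assumes M: "module R M" and N: "module R N" and bal: "fractions_balanced M N"
  shows "fractions_balanced N M"
  unfolding fractions_balanced_def
proof (intro allI impI)
  fix \<beta> \<alpha> s t y y' x x'
  assume *: "residue_functional N \<beta>" "residue_functional M \<alpha>" "s \<in> carrier R" "s \<noteq> \<zero>" "t \<in> carrier R"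
    "y \<in> carrier N" "y' \<in> carrier N" "x \<in> carrier M" "x' \<in> carrier M"
    "s \<odot>\<^bsub>N\<^esub> y' = t \<odot>\<^bsub>N\<^esub> y" "s \<odot>\<^bsub>M\<^esub> x' = t \<odot>\<^bsub>M\<^esub> x"
  interpret k: cring "R Quot \<mm>" by (rule residue_ring)
  have "\<alpha> x' \<otimes>\<^bsub>R Quot \<mm>\<^esub> \<beta> y = \<alpha> x \<otimes>\<^bsub>R Quot \<mm>\<^esub> \<beta> y'"
    using bal * unfolding fractions_balanced_def by blast
  then show "\<beta> y' \<otimes>\<^bsub>R Quot \<mm>\<^esub> \<alpha> x = \<beta> y \<otimes>\<^bsub>R Quot \<mm>\<^esub> \<alpha> x'"
    using residue_functionalD(1)[OF *(1)] residue_functionalD(1)[OF *(2)] *(6-9) by (simp add: k.m_comm)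
qed

lemma residue_functional_zero:
  assumes M: "module R M" and \<alpha>: "residue_functional M \<alpha>"
  shows "\<alpha> \<zero>\<^bsub>M\<^esub> = \<zero>\<^bsub>R Quot \<mm>\<^esub>"
proof -
  interpret M: module R M by (rule M)
  interpret k: cring "R Quot \<mm>" by (rule residue_ring)
  have "\<alpha> \<zero>\<^bsub>M\<^esub> = \<alpha> \<zero>\<^bsub>M\<^esub> \<oplus>\<^bsub>R Quot \<mm>\<^esub> \<alpha> \<zero>\<^bsub>M\<^esub>"
    using residue_functionalD(2)[OF \<alpha>, of "\<zero>\<^bsub>M\<^esub>" "\<zero>\<^bsub>M\<^esub>"] by simp
  then show ?thesis using residue_functionalD(1)[OF \<alpha>, of "\<zero>\<^bsub>M\<^esub>"] k.add.r_cancel_one'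
    by (metis M.M.zero_closed)
qed

text \<open>
  A submodule that is maximal among those containing all but one of the generators of a minimal
  generating system, and not the remaining one, contains \<open>\<mm> M\<close>.
\<close>

lemma exists_nonzero_residue_functional:
  assumes M: "module R M" and S: "finite S" "generated_by R M S" and nz: "carrier M \<noteq> {\<zero>\<^bsub>M\<^esub>}"
  obtains \<alpha> x where "residue_functional M \<alpha>" "x \<in> carrier M" "\<alpha> x = \<one>\<^bsub>R Quot \<mm>\<^esub>"
proof -
  interpret M: module R M by (rule M)
  interpret max: ideal \<mm> R by (rule ideal_max)
  obtain S where S: "finite S" "generated_by R M S"
    and min: "\<And>S'. finite S' \<Longrightarrow> generated_by R M S' \<Longrightarrow> card S \<le> card S'"
    using ex_has_least_nat[of "\<lambda>S. finite S \<and> generated_by R M S" S card] S by blast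
  have SM: "S \<subseteq> carrier M" using S(2) by (simp add: generated_by_def)
  have "S \<noteq> {}"
  proof
    assume "S = {}"
    moreover have "submodule {\<zero>\<^bsub>M\<^esub>} R M" by (rule M.submoduleI) auto
    ultimately have "carrier M \<subseteq> {\<zero>\<^bsub>M\<^esub>}" using S(2) by (simp add: generated_by_def)
    then show False using nz M.zero_closed by blast
  qed
  then obtain x where x: "x \<in> S" by blast
  have xM: "x \<in> carrier M" using x SM by blast
  have "\<not> generated_by R M (S - {x})"
    using min[of "S - {x}"] S(1) card_Diff1_less[OF S(1) x] by auto
  then obtain V where V: "submodule V R M" "S - {x} \<subseteq> V" "\<not> carrier M \<subseteq> V"
    using SM unfolding generated_by_def by blast
  have "x \<notin> V" using V S(2) x unfolding generated_by_def by blast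
  let ?S = "{U. submodule U R M \<and> (S - {x} \<subseteq> U \<and> x \<notin> U)}"
  have chains: "\<Union>\<C> \<in> ?S" if "\<C> \<noteq> {}" "subset.chain ?S \<C>" for \<C>
  proof -
    have "\<C> \<subseteq> ?S" using that(2) by (simp add: subset.chain_def)
    then show ?thesis using M.submodule_Union_chain[OF that] that(1) by blast
  qed
  have nonempty: "?S \<noteq> {}" using V \<open>x \<notin> V\<close> by blast
  have "\<exists>U\<in>?S. \<forall>W\<in>?S. U \<subseteq> W \<longrightarrow> W = U"
    by (rule subset_Zorn_nonempty[OF nonempty]) (rule chains)
  then obtain U where US: "U \<in> ?S" and maximal: "\<forall>W\<in>?S. U \<subseteq> W \<longrightarrow> W = U" by (elim bexE)
  from US have U: "submodule U R M" "S - {x} \<subseteq> U" "x \<notin> U" by simp_all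
  note UE = M.submoduleE[OF U(1)]
  have Uc: "u \<in> carrier M" if "u \<in> U" for u using that UE(1) by blast
  let ?add = "\<lambda>z. {u \<oplus>\<^bsub>M\<^esub> r \<odot>\<^bsub>M\<^esub> z | u r. u \<in> U \<and> r \<in> carrier R}"
  have addI: "u \<oplus>\<^bsub>M\<^esub> r \<odot>\<^bsub>M\<^esub> z \<in> ?add z" if "u \<in> U" "r \<in> carrier R" for u r z using that by blast
  have Uadd: "U \<subseteq> ?add z" "z \<in> ?add z" if "z \<in> carrier M" for z
  proof -
    show "U \<subseteq> ?add z" using addI[of _ \<zero> z] that Uc by auto
    show "z \<in> ?add z" using addI[of "\<zero>\<^bsub>M\<^esub>" \<one> z] that M.submodule_zero[OF U(1)] by simp
  qed
  have dec: "\<exists>u\<in>U. \<exists>r\<in>carrier R. y = u \<oplus>\<^bsub>M\<^esub> r \<odot>\<^bsub>M\<^esub> x" if y: "y \<in> carrier M" for y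
  proof -
    have "S \<subseteq> ?add x" using Uadd[OF xM] U(2) by blast
    then have "carrier M \<subseteq> ?add x"
      using S(2) M.submodule_add_multiples[OF U(1) xM] unfolding generated_by_def by simp
    then show ?thesis using y by blast
  qed
  have mU: "r \<odot>\<^bsub>M\<^esub> y \<in> U" if r: "r \<in> \<mm>" and y: "y \<in> carrier M" for r y
  proof (rule ccontr)
    assume no: "r \<odot>\<^bsub>M\<^esub> y \<notin> U"
    have rR: "r \<in> carrier R" using r max.Icarr by blast
    let ?z = "r \<odot>\<^bsub>M\<^esub> y"
    have z: "?z \<in> carrier M" using rR y by simp
    have "?add ?z \<notin> ?S" using bspec[OF maximal, of "?add ?z"] Uadd[OF z] no by blast
    then have "x \<in> ?add ?z" using M.submodule_add_multiples[OF U(1) z] Uadd(1)[OF z] U(2) by blast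
    then obtain u t where u: "u \<in> U" "t \<in> carrier R" "x = u \<oplus>\<^bsub>M\<^esub> t \<odot>\<^bsub>M\<^esub> ?z" by blast
    obtain u' s where u': "u' \<in> U" "s \<in> carrier R" "y = u' \<oplus>\<^bsub>M\<^esub> s \<odot>\<^bsub>M\<^esub> x" using dec[OF y] by blast
    \<comment> \<open>Substituting the decomposition of \<open>y\<close> into that of
      \<open>x\<close> gives \<open>x\<close> as an element of \<open>U\<close> plus
      \<open>c x\<close> with \<open>c\<close> in \<open>\<mm>\<close>. As \<open>1 - c\<close> is a
      unit, \<open>x\<close> would lie in \<open>U\<close>.\<close>
    define c where "c = t \<otimes> r \<otimes> s"
    have c: "c \<in> carrier R" using u(2) u'(2) rR by (simp add: c_def)
    have cm: "c \<in> \<mm>" using u(2) u'(2) max.I_l_closed[OF r u(2)] max.I_r_closed by (simp add: c_def)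
    have w: "u \<oplus>\<^bsub>M\<^esub> (t \<otimes> r) \<odot>\<^bsub>M\<^esub> u' \<in> U" using UE(4,5) u u' rR by simp
    have "t \<odot>\<^bsub>M\<^esub> ?z = (t \<otimes> r) \<odot>\<^bsub>M\<^esub> (u' \<oplus>\<^bsub>M\<^esub> s \<odot>\<^bsub>M\<^esub> x)"
      using u(2) rR y by (simp add: M.smult_assoc1 flip: u'(3))
    also have "\<dots> = (t \<otimes> r) \<odot>\<^bsub>M\<^esub> u' \<oplus>\<^bsub>M\<^esub> c \<odot>\<^bsub>M\<^esub> x"
      using u(2) u' rR xM Uc by (simp add: M.smult_r_distr c_def flip: M.smult_assoc1)
    finally have "x = (u \<oplus>\<^bsub>M\<^esub> (t \<otimes> r) \<odot>\<^bsub>M\<^esub> u') \<oplus>\<^bsub>M\<^esub> c \<odot>\<^bsub>M\<^esub> x"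
      using u Uc[OF u(1)] Uc[OF u'(1)] rR xM c by (simp add: M.M.a_assoc)
    then have "\<one> \<odot>\<^bsub>M\<^esub> x \<ominus>\<^bsub>M\<^esub> c \<odot>\<^bsub>M\<^esub> x = (u \<oplus>\<^bsub>M\<^esub> (t \<otimes> r) \<odot>\<^bsub>M\<^esub> u') \<ominus>\<^bsub>M\<^esub> \<zero>\<^bsub>M\<^esub>"
      using xM c Uc[OF w] M.M.diff_eq_diff_if_sums_eq[of "\<zero>\<^bsub>M\<^esub>" x "u \<oplus>\<^bsub>M\<^esub> (t \<otimes> r) \<odot>\<^bsub>M\<^esub> u'" "c \<odot>\<^bsub>M\<^esub> x"] by simp
    then have "(\<one> \<ominus> c) \<odot>\<^bsub>M\<^esub> x \<in> U" using w Uc[OF w] c xM by (simp add: M.smult_l_diff)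
    moreover have "\<one> \<ominus> c \<notin> \<mm>"
    proof
      assume "\<one> \<ominus> c \<in> \<mm>"
      then have "(\<one> \<ominus> c) \<oplus> c \<in> \<mm>" using cm max.a_closed by blast
      then show False using one_nonmember c by (simp add: a_minus_def a_assoc l_neg)
    qed
    then have unit: "\<one> \<ominus> c \<in> Units R" using nonmember_unit c by simp
    ultimately have "inv (\<one> \<ominus> c) \<odot>\<^bsub>M\<^esub> ((\<one> \<ominus> c) \<odot>\<^bsub>M\<^esub> x) \<in> U" using UE(4) by simp
    then show False using unit c xM U(3) by (simp flip: M.smult_assoc1)
  qed
  obtain \<alpha> where "residue_functional M \<alpha>" "\<alpha> x = \<one>\<^bsub>R Quot \<mm>\<^esub>" "\<And>u. u \<in> U \<Longrightarrow> \<alpha> u = \<zero>\<^bsub>R Quot \<mm>\<^esub>"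
    using exists_residue_functional[OF M U(1) mU xM U(3)] by blast
  then show thesis using that xM by blast
qed

text \<open>If all forms vanish, \<open>separating_forms\<close> gives a nonzero \<open>d\<close>
  that kills \<open>M\<close>. Then \<open>M \<otimes> N\<close> would be torsion, but it is not
  zero, as the product of two nonzero functionals shows.\<close>

lemma exists_nonzero_form:
  assumes M: "module R M" "finite S" "generated_by R M S" "carrier M \<noteq> {\<zero>\<^bsub>M\<^esub>}"
    and N: "module R N" "finite T" "generated_by R N T" "carrier N \<noteq> {\<zero>\<^bsub>N\<^esub>}"
    and bal: "fractions_balanced M N"
  obtains f x where "f \<in> module_hom R M (regular_module R)" "x \<in> carrier M" "f x \<noteq> \<zero>"
proof (rule ccontr)
  note obtained = that
  assume "\<not> thesis"
  then have zero: "f x = \<zero>" if "f \<in> module_hom R M (regular_module R)" "x \<in> carrier M" for f x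
    using obtained[OF that] by blast
  interpret M: module R M by (rule M)
  interpret N: module R N by (rule N)
  interpret k: cring "R Quot \<mm>" by (rule residue_ring)
  obtain D d where D: "finite D" "D \<subseteq> module_hom R M (regular_module R)" and d: "d \<in> carrier R" "d \<noteq> \<zero>"
    and sep: "\<And>y. y \<in> carrier M \<Longrightarrow> \<forall>f\<in>D. f y = \<zero> \<Longrightarrow> d \<odot>\<^bsub>M\<^esub> y = \<zero>\<^bsub>M\<^esub>"
    by (rule separating_forms[OF M(1-3)]) blast
  obtain \<alpha> x where \<alpha>: "residue_functional M \<alpha>" "x \<in> carrier M" "\<alpha> x = \<one>\<^bsub>R Quot \<mm>\<^esub>"
    by (rule exists_nonzero_residue_functional[OF M])
  obtain \<beta> y where \<beta>: "residue_functional N \<beta>" "y \<in> carrier N" "\<beta> y = \<one>\<^bsub>R Quot \<mm>\<^esub>"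
    by (rule exists_nonzero_residue_functional[OF N])
  have "d \<odot>\<^bsub>M\<^esub> x = \<zero>\<^bsub>M\<^esub>" using sep[OF \<alpha>(2)] zero[OF _ \<alpha>(2)] D(2) by blast
  \<comment> \<open>Balancing is applied with \<open>s = d\<close>, \<open>t = 0\<close>,
    \<open>x' = x\<close> and \<open>y' = 0\<close>.\<close>
  then have "\<alpha> x \<otimes>\<^bsub>R Quot \<mm>\<^esub> \<beta> y = \<alpha> x \<otimes>\<^bsub>R Quot \<mm>\<^esub> \<beta> \<zero>\<^bsub>N\<^esub>"
    using bal[unfolded fractions_balanced_def, rule_format, OF \<alpha>(1) \<beta>(1) d zero_closed \<alpha>(2,2) \<beta>(2) N.zero_closed]
      \<alpha>(2) \<beta>(2) d(1) by simp
  then show False using \<alpha>(3) \<beta>(3) residue_functional_zero[OF N(1) \<beta>(1)] residue_one_nonzero by simp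
qed

end

locale gorenstein_multipliers = one_dim_gorenstein_domain R \<mm> A B \<epsilon> \<delta> + max_multipliers R \<mm> K
  for R :: "('a, 'b) ring_scheme" (structure) and K :: "('a, 'b) ring_scheme" and \<mm> and A B :: "('a, 'i) module" and \<epsilon> \<delta>
begin

text \<open>Multiplication by \<open>e \<in> E\<close> lifts along all forms of \<open>M\<close>, hence to \<open>M\<close> modulo torsion.\<close>

lemma multiplier_lift:
  assumes M: "module R M" "finite S" "generated_by R M S"
    and forms_max: "\<forall>f\<in>forms M. \<forall>x\<in>carrier M. f x \<in> \<mm>"
    and e: "e \<in> carrier E" and x: "x \<in> carrier M" and f: "f \<in> forms M"
  obtains x' s t where "x' \<in> carrier M" "s \<in> carrier R" "s \<noteq> \<zero>" "t \<in> carrier R" "t = e \<otimes>\<^bsub>K\<^esub> s"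
    "s \<odot>\<^bsub>M\<^esub> x' = t \<odot>\<^bsub>M\<^esub> x" "f x' = e \<otimes>\<^bsub>K\<^esub> f x"
proof -
  interpret M: module R M by (rule M)
  obtain D d where D: "finite D" "D \<subseteq> forms M" and d: "d \<in> carrier R" "d \<noteq> \<zero>"
    and sep: "\<And>y. y \<in> carrier M \<Longrightarrow> \<forall>f\<in>D. f y = \<zero> \<Longrightarrow> d \<odot>\<^bsub>M\<^esub> y = \<zero>\<^bsub>M\<^esub>"
    by (rule separating_forms[OF M]) blast
  obtain p q where p: "p \<in> carrier R" and q: "q \<in> carrier R" "q \<noteq> \<zero>" and pq: "p = e \<otimes>\<^bsub>K\<^esub> q"
    "\<And>r. r \<in> \<mm> \<Longrightarrow> \<exists>s\<in>carrier R. p \<otimes> r = q \<otimes> s"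
    by (rule fraction_of_E[OF e]) blast
  have fx: "g x \<in> \<mm>" if "g \<in> forms M" for g by (rule bspec[OF bspec[OF forms_max that] x])
  \<comment> \<open>\<open>f\<close> joins the separating forms, to which it may not belong, so that
    the lift is exact for \<open>f\<close> too.\<close>
  have "finite (insert f D)" "insert f D \<subseteq> forms M" using D f by auto
  then have "\<exists>x'\<in>carrier M. \<forall>g\<in>insert f D. q \<otimes> g x' = p \<otimes> g x"
    by (rule fraction_multiple_in_image[OF M(1) _ _ p q _ x]) (erule pq(2), erule fx)
  then obtain x' where x': "x' \<in> carrier M" "\<And>g. g \<in> insert f D \<Longrightarrow> q \<otimes> g x' = p \<otimes> g x" by blast
  \<comment> \<open>All separating forms vanish on \<open>q x' - p x\<close>, so this element is
    killed by \<open>d\<close>. This is the origin of \<open>s = d q\<close> and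
    \<open>t = d p\<close>.\<close>
  have "d \<odot>\<^bsub>M\<^esub> (q \<odot>\<^bsub>M\<^esub> x' \<ominus>\<^bsub>M\<^esub> p \<odot>\<^bsub>M\<^esub> x) = \<zero>\<^bsub>M\<^esub>"
  proof (rule sep)
    show "q \<odot>\<^bsub>M\<^esub> x' \<ominus>\<^bsub>M\<^esub> p \<odot>\<^bsub>M\<^esub> x \<in> carrier M" using p q x x' by simp
    show "\<forall>g\<in>D. g (q \<odot>\<^bsub>M\<^esub> x' \<ominus>\<^bsub>M\<^esub> p \<odot>\<^bsub>M\<^esub> x) = \<zero>"
    proof
      fix g assume g: "g \<in> D"
      then have gf: "g \<in> forms M" using D(2) by blast
      note hg = module_homD[OF gf, simplified]
      have "g (q \<odot>\<^bsub>M\<^esub> x' \<ominus>\<^bsub>M\<^esub> p \<odot>\<^bsub>M\<^esub> x) = g (q \<odot>\<^bsub>M\<^esub> x') \<ominus>\<^bsub>regular_module R\<^esub> g (p \<odot>\<^bsub>M\<^esub> x)"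
        using module_hom_diff[OF M(1) module_regular[OF is_cring] gf] p q x x' by simp
      also have "\<dots> = q \<otimes> g x' \<ominus> p \<otimes> g x" using hg(3) p q(1) x x'(1) by (simp add: a_minus_def)
      also have "\<dots> = \<zero>" using x'(2)[of g] g hg(1)[OF x] p by simp
      finally show "g (q \<odot>\<^bsub>M\<^esub> x' \<ominus>\<^bsub>M\<^esub> p \<odot>\<^bsub>M\<^esub> x) = \<zero>" .
    qed
  qed
  then have eq: "(d \<otimes> q) \<odot>\<^bsub>M\<^esub> x' = (d \<otimes> p) \<odot>\<^bsub>M\<^esub> x"
    using d p q x x' M.M.minus_eq_zero_iff by (simp add: M.smult_r_diff M.smult_assoc1)
  have fR: "f x \<in> carrier K" "f x' \<in> carrier K" using module_homD(1)[OF f] x x'(1) R_K by auto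
  have "q \<otimes>\<^bsub>K\<^esub> f x' = q \<otimes>\<^bsub>K\<^esub> (e \<otimes>\<^bsub>K\<^esub> f x)"
    using x'(2)[of f] fR E_K[OF e] R_K[OF q(1)] unfolding pq(1) by (simp add: R_ops K.m_ac)
  then have fx': "f x' = e \<otimes>\<^bsub>K\<^esub> f x"
    using fR E_K[OF e] R_K[OF q(1)] q(2) K.m_lcancel[of q] by (simp add: R_ops)
  have t: "d \<otimes> p = e \<otimes>\<^bsub>K\<^esub> (d \<otimes> q)"
    using R_K[OF d(1)] R_K[OF q(1)] E_K[OF e] unfolding pq(1) by (simp add: R_ops K.m_lcomm)
  have "d \<otimes> q \<noteq> \<zero>" using d q integral by blast
  then show thesis using that[OF x'(1) m_closed[OF d(1) q(1)] _ m_closed[OF d(1) p] t eq fx'] by blast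
qed

text \<open>By \<open>multiplier_lift\<close>, \<open>e\<close> times a value of \<open>f\<close> is
  again a value of \<open>f\<close>. On \<open>M\<close> the ring \<open>E\<close> acts only modulo
  torsion, on this image directly.\<close>

lemma ideal_form_image:
  assumes M: "module R M" "finite S" "generated_by R M S"
    and forms_max: "\<forall>f\<in>forms M. \<forall>x\<in>carrier M. f x \<in> \<mm>"
    and f: "f \<in> forms M"
  shows "ideal (f ` carrier M) E"
proof -
  interpret M: module R M by (rule M)
  note h = module_homD[OF f, simplified]
  have mult: "e \<otimes>\<^bsub>E\<^esub> u \<in> f ` carrier M" if e: "e \<in> carrier E" and u: "u \<in> f ` carrier M" for e u
  proof -
    obtain x where x: "x \<in> carrier M" "u = f x" using u by blast
    obtain x' where "x' \<in> carrier M" "f x' = e \<otimes>\<^bsub>K\<^esub> f x"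
      using multiplier_lift[OF M forms_max e x(1) f] by metis
    then show ?thesis using x(2) by (metis E_ops(1) imageI)
  qed
  have sub: "f ` carrier M \<subseteq> carrier E" using h(1) R_subset_E by blast
  show ?thesis
  proof (rule idealI)
    show "ring E" by (rule E.ring_axioms)
    show "subgroup (f ` carrier M) (add_monoid E)"
    proof (rule E.add.subgroupI[OF sub])
      show "f ` carrier M \<noteq> {}" using M.M.zero_closed by blast
      show "\<ominus>\<^bsub>E\<^esub> u \<in> f ` carrier M" if "u \<in> f ` carrier M" for u
        using mult[of "\<ominus>\<^bsub>E\<^esub> \<one>\<^bsub>E\<^esub>" u] that sub E.l_minus[OF E.one_closed, of u] E.l_one[of u] E.a_inv_closed[OF E.one_closed]
        by (simp add: subset_iff)
      show "u \<oplus>\<^bsub>E\<^esub> v \<in> f ` carrier M" if uv: "u \<in> f ` carrier M" "v \<in> f ` carrier M" for u v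
      proof -
        obtain x y where "x \<in> carrier M" "y \<in> carrier M" "u = f x" "v = f y" using uv by blast
        then have "u \<oplus>\<^bsub>E\<^esub> v = f (x \<oplus>\<^bsub>M\<^esub> y)" "x \<oplus>\<^bsub>M\<^esub> y \<in> carrier M" using h(2) by (simp_all add: R_ops)
        then show ?thesis by blast
      qed
    qed
    show "e \<otimes>\<^bsub>E\<^esub> u \<in> f ` carrier M" if "u \<in> f ` carrier M" "e \<in> carrier E" for e u
      using mult that by blast
    then show "u \<otimes>\<^bsub>E\<^esub> e \<in> f ` carrier M" if "u \<in> f ` carrier M" "e \<in> carrier E" for e u
      using that sub E.m_comm[of u e] by (simp add: subset_iff)
  qed
qed

lemma submodule_if_ideal_E:
  assumes J: "ideal J E" "J \<subseteq> carrier R"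
  shows "submodule J R (regular_module R)"
proof -
  interpret J: ideal J E by (rule J(1))
  interpret reg: module R "regular_module R" by (rule module_regular[OF is_cring])
  have mult: "r \<otimes> x \<in> J" if "r \<in> carrier R" "x \<in> J" for r x
    using J.I_l_closed[OF that(2), of r] that(1) R_subset_E by (auto simp: R_ops)
  show ?thesis
  proof (rule reg.submoduleI)
    show "J \<subseteq> carrier (regular_module R)" using J(2) by simp
    show "\<zero>\<^bsub>regular_module R\<^esub> \<in> J" using J.zero_closed by (simp add: R_ops)
    show "\<ominus>\<^bsub>regular_module R\<^esub> x \<in> J" if x: "x \<in> J" for x
    proof -
      have "\<ominus> x = (\<ominus> \<one>) \<otimes> x" using l_minus[OF one_closed subsetD[OF J(2) x]] subsetD[OF J(2) x] by simp
      then show ?thesis using mult[OF a_inv_closed[OF one_closed] x] by simp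
    qed
    show "x \<oplus>\<^bsub>regular_module R\<^esub> y \<in> J" if "x \<in> J" "y \<in> J" for x y
      using J.a_closed[OF that] by (simp add: R_ops)
    show "r \<odot>\<^bsub>regular_module R\<^esub> x \<in> J" if "r \<in> carrier R" "x \<in> J" for r x
      using mult[OF that] by simp
  qed
qed

end

text \<open>
  The form \<open>\<alpha> \<otimes> \<beta>\<close> on \<open>M/\<mm>M \<otimes> N/\<mm>N\<close> is balanced over \<open>E\<close>. Applied to functionals that come from
  the quotients \<open>f(M)/A\<close> and \<open>g(N)/C\<close>, this restricts how an element of \<open>E\<close> acts on them.
\<close>

locale balanced_pair = gorenstein_multipliers R K \<mm> A B \<epsilon> \<delta>
  for R :: "('a, 'b) ring_scheme" (structure) and K :: "('a, 'b) ring_scheme" and \<mm> and A B :: "('a, 'i) module" and \<epsilon> \<delta> +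
  fixes M :: "('a, 'm, 'x) module_scheme" and N :: "('a, 'n, 'y) module_scheme" and S T f g
  assumes M: "module R M" "finite S" "generated_by R M S" "\<forall>f\<in>forms M. \<forall>x\<in>carrier M. f x \<in> \<mm>"
    and N: "module R N" "finite T" "generated_by R N T" "\<forall>g\<in>forms N. \<forall>y\<in>carrier N. g y \<in> \<mm>"
    and balanced: "fractions_balanced M N"
    and f: "f \<in> forms M" "f ` carrier M \<noteq> {\<zero>\<^bsub>E\<^esub>}" and g: "g \<in> forms N" "g ` carrier N \<noteq> {\<zero>\<^bsub>E\<^esub>}"
begin

text \<open>If \<open>e b\<close> were outside \<open>V\<close>, there would be functionals that
  vanish on the preimages of \<open>U\<close> and \<open>V\<close>, with
  \<open>\<alpha> x = 1\<close> and \<open>\<beta> y' = 1\<close>, where \<open>x'\<close> and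
  \<open>y'\<close> lift \<open>e x\<close> and \<open>e y\<close>. Balancing equates the products
  of \<open>\<alpha> x'\<close> with \<open>\<beta> y\<close> and of \<open>\<alpha> x\<close> with
  \<open>\<beta> y'\<close>, which are 0 and 1. So an \<open>e\<close> that kills one nonzero class
  of \<open>f(M)/U\<close> kills all of \<open>g(N)/V\<close>.\<close>

lemma multiplier_action:
  assumes U: "submodule U R (regular_module R)" "\<And>r x. r \<in> \<mm> \<Longrightarrow> x \<in> carrier M \<Longrightarrow> r \<otimes> f x \<in> U"
    and V: "submodule V R (regular_module R)" "\<And>r y. r \<in> \<mm> \<Longrightarrow> y \<in> carrier N \<Longrightarrow> r \<otimes> g y \<in> V"
    and e: "e \<in> carrier E"
    and a: "a \<in> f ` carrier M" "a \<notin> U" "e \<otimes>\<^bsub>K\<^esub> a \<in> U" and b: "b \<in> g ` carrier N"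
  shows "e \<otimes>\<^bsub>K\<^esub> b \<in> V"
proof (rule ccontr)
  assume eb: "e \<otimes>\<^bsub>K\<^esub> b \<notin> V"
  interpret M: module R M by (rule M)
  interpret N: module R N by (rule N)
  interpret k: cring "R Quot \<mm>" by (rule residue_ring)
  have reg: "module R (regular_module R)" by (rule module_regular[OF is_cring])
  obtain x where x: "x \<in> carrier M" "a = f x" using a(1) by blast
  obtain y where y: "y \<in> carrier N" "b = g y" using b by blast
  obtain x' s1 t1 where x': "x' \<in> carrier M" "f x' = e \<otimes>\<^bsub>K\<^esub> f x" and s1: "s1 \<in> carrier R" "s1 \<noteq> \<zero>"
    and t1: "t1 \<in> carrier R" "t1 = e \<otimes>\<^bsub>K\<^esub> s1" and eq1: "s1 \<odot>\<^bsub>M\<^esub> x' = t1 \<odot>\<^bsub>M\<^esub> x"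
    by (rule multiplier_lift[OF M e x(1) f(1)])
  obtain y' s2 t2 where y': "y' \<in> carrier N" "g y' = e \<otimes>\<^bsub>K\<^esub> g y" and s2: "s2 \<in> carrier R" "s2 \<noteq> \<zero>"
    and t2: "t2 \<in> carrier R" "t2 = e \<otimes>\<^bsub>K\<^esub> s2" and eq2: "s2 \<odot>\<^bsub>N\<^esub> y' = t2 \<odot>\<^bsub>N\<^esub> y"
    by (rule multiplier_lift[OF N e y(1) g(1)])
  \<comment> \<open>The two lifts come with different denominators, while balancing needs common
    ones: \<open>s = s2 s1\<close> and \<open>t = e s1 s2\<close>, which is both
    \<open>s2 t1\<close> and \<open>s1 t2\<close>.\<close>
  have s: "s2 \<otimes> s1 \<in> carrier R" "s2 \<otimes> s1 \<noteq> \<zero>" using s1 s2 integral by auto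
  have t: "s1 \<otimes> t2 = s2 \<otimes> t1"
    unfolding t1(2) t2(2) using R_K[OF s1(1)] R_K[OF s2(1)] E_K[OF e] by (simp add: R_ops K.m_ac)
  have eq1': "(s2 \<otimes> s1) \<odot>\<^bsub>M\<^esub> x' = (s2 \<otimes> t1) \<odot>\<^bsub>M\<^esub> x"
    using eq1 s1(1) s2(1) t1(1) x(1) x'(1) by (simp add: M.smult_assoc1)
  have eq2': "(s2 \<otimes> s1) \<odot>\<^bsub>N\<^esub> y' = (s2 \<otimes> t1) \<odot>\<^bsub>N\<^esub> y"
    unfolding t[symmetric] m_comm[OF s2(1) s1(1)]
    using eq2 s1(1) s2(1) t2(1) y(1) y'(1) by (simp add: N.smult_assoc1)
  let ?U = "{z \<in> carrier M. f z \<in> U}" and ?V = "{z \<in> carrier N. g z \<in> V}"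
  note hf = module_homD[OF f(1), simplified] and hg = module_homD[OF g(1), simplified]
  have mM: "r \<odot>\<^bsub>M\<^esub> z \<in> ?U" if "r \<in> \<mm>" "z \<in> carrier M" for r z
    using U(2)[OF that] hf(3) that max.Icarr by simp
  have mN: "r \<odot>\<^bsub>N\<^esub> z \<in> ?V" if "r \<in> \<mm>" "z \<in> carrier N" for r z
    using V(2)[OF that] hg(3) that max.Icarr by simp
  have "x \<notin> ?U" using a(2) x(2) by simp
  then obtain \<alpha> where \<alpha>: "residue_functional M \<alpha>" "\<alpha> x = \<one>\<^bsub>R Quot \<mm>\<^esub>" "\<And>u. u \<in> ?U \<Longrightarrow> \<alpha> u = \<zero>\<^bsub>R Quot \<mm>\<^esub>"
    using exists_residue_functional[OF M(1) M.submodule_preimage[OF reg f(1) U(1)] mM x(1)] by blast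
  have "y' \<notin> ?V" using eb y(2) y'(2) by simp
  then obtain \<beta> where \<beta>: "residue_functional N \<beta>" "\<beta> y' = \<one>\<^bsub>R Quot \<mm>\<^esub>"
      "\<And>v. v \<in> ?V \<Longrightarrow> \<beta> v = \<zero>\<^bsub>R Quot \<mm>\<^esub>"
    using exists_residue_functional[OF N(1) N.submodule_preimage[OF reg g(1) V(1)] mN y'(1)] by blast
  have "\<alpha> x' = \<zero>\<^bsub>R Quot \<mm>\<^esub>" using \<alpha>(3)[of x'] x' a(3) x(2) by simp
  moreover have "\<alpha> x' \<otimes>\<^bsub>R Quot \<mm>\<^esub> \<beta> y = \<alpha> x \<otimes>\<^bsub>R Quot \<mm>\<^esub> \<beta> y'"
    using balanced[unfolded fractions_balanced_def, rule_format, OF \<alpha>(1) \<beta>(1) s _ x(1) x'(1) y(1) y'(1) eq1' eq2']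
      s2(1) t1(1) by simp
  ultimately show False
    using \<alpha>(2) \<beta>(2) residue_one_nonzero residue_functionalD(1)[OF \<beta>(1) y(1)] by simp
qed

section \<open>Maximal ideals and residue classes of \<open>E\<close>\<close>

lemma ideals: "ideal (f ` carrier M) E" "ideal (g ` carrier N) E"
  "f ` carrier M \<subseteq> carrier R" "g ` carrier N \<subseteq> carrier R"
proof -
  show "ideal (f ` carrier M) E" by (rule ideal_form_image[OF M f(1)])
  show "ideal (g ` carrier N) E" by (rule ideal_form_image[OF N g(1)])
  show "f ` carrier M \<subseteq> carrier R" using module_homD(1)[OF f(1)] by (simp add: image_subset_iff)
  show "g ` carrier N \<subseteq> carrier R" using module_homD(1)[OF g(1)] by (simp add: image_subset_iff)
qed

text \<open>Write \<open>1 = e + j\<close> with \<open>e\<close> in \<open>\<nn>\<^sub>1\<close> and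
  \<open>j\<close> in \<open>\<nn>\<^sub>2\<close>, and take nonzero quotients \<open>f(M)/U\<close>
  killed by \<open>\<nn>\<^sub>1\<close> and \<open>g(N)/V\<close> killed by
  \<open>\<nn>\<^sub>2\<close>. By \<open>multiplier_action\<close>, \<open>e\<close> kills
  \<open>g(N)/V\<close> as well as \<open>j\<close> does; hence 1 kills it, which is absurd.\<close>

lemma maximalideal_unique:
  assumes n1: "maximalideal \<nn>\<^sub>1 E" and n2: "maximalideal \<nn>\<^sub>2 E"
  shows "\<nn>\<^sub>1 = \<nn>\<^sub>2"
proof (rule ccontr)
  assume neq: "\<nn>\<^sub>1 \<noteq> \<nn>\<^sub>2"
  interpret n1: maximalideal "\<nn>\<^sub>1" E by (rule n1)
  interpret n2: maximalideal "\<nn>\<^sub>2" E by (rule n2)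
  have one1: "\<one>\<^bsub>E\<^esub> \<notin> \<nn>\<^sub>1" and one2: "\<one>\<^bsub>E\<^esub> \<notin> \<nn>\<^sub>2"
    using n1.one_imp_carrier n1.I_notcarr n2.one_imp_carrier n2.I_notcarr by blast+
  let ?J = "\<nn>\<^sub>1 <+>\<^bsub>E\<^esub> \<nn>\<^sub>2"
  have memJ: "u \<in> ?J \<longleftrightarrow> (\<exists>i\<in>\<nn>\<^sub>1. \<exists>j\<in>\<nn>\<^sub>2. u = i \<oplus>\<^bsub>E\<^esub> j)" for u
    by (auto simp: set_add_def set_mult_def)
  have J: "ideal ?J E" by (rule E.add_ideals[OF n1.is_ideal n2.is_ideal])
  have s1: "\<nn>\<^sub>1 \<subseteq> ?J"
  proof
    show "i \<in> ?J" if "i \<in> \<nn>\<^sub>1" for i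
      unfolding memJ using that n1.Icarr[OF that] n2.zero_closed E.r_zero[OF n1.Icarr[OF that]] by metis
  qed
  have s2: "\<nn>\<^sub>2 \<subseteq> ?J"
  proof
    show "i \<in> ?J" if "i \<in> \<nn>\<^sub>2" for i
      unfolding memJ using that n2.Icarr[OF that] n1.zero_closed E.l_zero[OF n2.Icarr[OF that]] by metis
  qed
  have "?J = carrier E"
    using n1.I_maximal[OF J s1] n2.I_maximal[OF J s2] ideal.Icarr[OF J] neq by blast
  then have "\<one>\<^bsub>E\<^esub> \<in> ?J" using E.one_closed by blast
  then obtain e j where e: "e \<in> \<nn>\<^sub>1" and j: "j \<in> \<nn>\<^sub>2" and ej: "\<one>\<^bsub>E\<^esub> = e \<oplus>\<^bsub>E\<^esub> j" unfolding memJ by blast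
  obtain U where U: "ideal U E" "U \<subset> f ` carrier M" "\<And>\<nu> y. \<nu> \<in> \<nn>\<^sub>1 \<Longrightarrow> y \<in> f ` carrier M \<Longrightarrow> \<nu> \<otimes>\<^bsub>E\<^esub> y \<in> U"
    using E.exists_proper_subideal[OF n1.is_ideal one1 ideals(1) f(2)] by blast
  obtain V where V: "ideal V E" "V \<subset> g ` carrier N" "\<And>\<nu> y. \<nu> \<in> \<nn>\<^sub>2 \<Longrightarrow> y \<in> g ` carrier N \<Longrightarrow> \<nu> \<otimes>\<^bsub>E\<^esub> y \<in> V"
    using E.exists_proper_subideal[OF n2.is_ideal one2 ideals(2) g(2)] by blast
  interpret V: ideal V E by (rule V(1))
  obtain a where a: "a \<in> f ` carrier M" "a \<notin> U" using U(2) by blast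
  obtain b where b: "b \<in> g ` carrier N" "b \<notin> V" using V(2) by blast
  have bE: "b \<in> carrier E" using b(1) ideals(4) R_subset_E by blast
  have "e \<otimes>\<^bsub>K\<^esub> b \<in> V"
  proof (rule multiplier_action[of U V e a b])
    show "submodule U R (regular_module R)" "submodule V R (regular_module R)"
      using submodule_if_ideal_E U(1,2) V(1,2) ideals(3,4) by (meson order_trans psubset_imp_subset)+
    show "r \<otimes> f x \<in> U" if "r \<in> \<mm>" "x \<in> carrier M" for r x
      using U(3)[of r "f x"] max_subset_maximalideal[OF n1] that by (auto simp: R_ops)
    show "r \<otimes> g y \<in> V" if "r \<in> \<mm>" "y \<in> carrier N" for r y
      using V(3)[of r "g y"] max_subset_maximalideal[OF n2] that by (auto simp: R_ops)
    show "e \<otimes>\<^bsub>K\<^esub> a \<in> U" using U(3)[OF e a(1)] by simp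
  qed (use a b(1) n1.Icarr[OF e] in auto)
  moreover have "j \<otimes>\<^bsub>K\<^esub> b \<in> V" using V(3)[OF j b(1)] by simp
  moreover have "b = e \<otimes>\<^bsub>E\<^esub> b \<oplus>\<^bsub>E\<^esub> j \<otimes>\<^bsub>E\<^esub> b"
    using E.l_one[OF bE] E.l_distr[OF n1.Icarr[OF e] n2.Icarr[OF j] bE] ej by simp
  ultimately have "b \<in> V" using V.a_closed by (metis E_ops(1))
  then show False using b(2) by blast
qed

lemma local_ring_E: "local_ring E"
proof -
  obtain \<nn> where "maximalideal \<nn> E" using E.exists_maximalideal[OF E.zeroideal] E.one_not_zero by auto
  then show ?thesis
    unfolding local_ring_def using maximalideal_unique E.noetherian_ring_axioms E.is_cring by blast
qed

text \<open>Otherwise \<open>e a\<close> spans over \<open>k\<close> a line in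
  \<open>f(M)/U0\<close> that misses the class of \<open>a\<close>. Adding this line to
  \<open>U0\<close> gives a submodule modulo which \<open>e\<close> kills the nonzero class of
  \<open>a\<close>, so \<open>e\<close> kills \<open>g(N)/V\<close> by
  \<open>multiplier_action\<close>; but \<open>e\<close> is a unit of \<open>E\<close>.\<close>

lemma residue_field_surj:
  assumes e: "e \<in> carrier E"
  shows "\<exists>r\<in>carrier R. e \<ominus>\<^bsub>E\<^esub> r \<in> max_ideal E"
proof (rule ccontr)
  let ?n = "max_ideal E"
  assume no: "\<not> ?thesis"
  note maxi = max_ideal_maximal(1)[OF local_ring_E]
  interpret n: maximalideal ?n E by (rule maxi)
  have one: "\<one>\<^bsub>E\<^esub> \<notin> ?n" using n.one_imp_carrier n.I_notcarr by blast
  note unit = local_ring_nonmember_unit[OF local_ring_E]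
  interpret reg: module R "regular_module R" by (rule module_regular[OF is_cring])
  \<comment> \<open>The case \<open>r = 0\<close> of the assumption; it makes \<open>e\<close> a
    unit of \<open>E\<close>.\<close>
  have e_notin: "e \<notin> ?n"
  proof
    assume "e \<in> ?n"
    moreover have "e \<ominus>\<^bsub>E\<^esub> \<zero> = e" using E.a_minus_zero[OF e] by (simp add: R_ops)
    ultimately have "e \<ominus>\<^bsub>E\<^esub> \<zero> \<in> ?n" by simp
    then show False using no zero_closed by blast
  qed
  obtain U0 where U0: "ideal U0 E" "U0 \<subset> f ` carrier M" "\<And>\<nu> y. \<nu> \<in> ?n \<Longrightarrow> y \<in> f ` carrier M \<Longrightarrow> \<nu> \<otimes>\<^bsub>E\<^esub> y \<in> U0"
    using E.exists_proper_subideal[OF n.is_ideal one ideals(1) f(2)] by blast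
  obtain V where V: "ideal V E" "V \<subset> g ` carrier N" "\<And>\<nu> y. \<nu> \<in> ?n \<Longrightarrow> y \<in> g ` carrier N \<Longrightarrow> \<nu> \<otimes>\<^bsub>E\<^esub> y \<in> V"
    using E.exists_proper_subideal[OF n.is_ideal one ideals(2) g(2)] by blast
  interpret U0: ideal U0 E by (rule U0(1))
  interpret V: ideal V E by (rule V(1))
  interpret I: ideal "f ` carrier M" E by (rule ideals(1))
  have unit_cancel: "z \<in> J" if "ideal J E" "u \<in> carrier E" "u \<notin> ?n" "z \<in> carrier E" "u \<otimes>\<^bsub>E\<^esub> z \<in> J" for J u z
  proof -
    have u: "u \<in> Units E" using unit that(2,3) by blast
    then have "inv\<^bsub>E\<^esub> u \<otimes>\<^bsub>E\<^esub> (u \<otimes>\<^bsub>E\<^esub> z) \<in> J" using ideal.I_l_closed[OF that(1,5)] by blast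
    then show ?thesis using E.Units_inv_mult_cancel[OF u that(4)] by simp
  qed
  obtain a where a: "a \<in> f ` carrier M" "a \<notin> U0" using U0(2) by blast
  obtain b where b: "b \<in> g ` carrier N" "b \<notin> V" using V(2) by blast
  have aE: "a \<in> carrier E" using I.Icarr[OF a(1)] .
  have bE: "b \<in> carrier E" using b(1) ideals(4) R_subset_E by blast
  have ea: "e \<otimes>\<^bsub>E\<^esub> a \<in> carrier R" using I.I_l_closed[OF a(1) e] ideals(3) by blast
  have U0sub: "submodule U0 R (regular_module R)"
    using submodule_if_ideal_E[OF U0(1)] U0(2) ideals(3) by blast
  \<comment> \<open>Only the multiples of \<open>e a\<close> by \<open>R\<close> are added: its
    multiples by \<open>E\<close> include \<open>a\<close>, since \<open>e\<close> is a
    unit.\<close>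
  let ?U = "{v \<oplus>\<^bsub>regular_module R\<^esub> r \<odot>\<^bsub>regular_module R\<^esub> (e \<otimes>\<^bsub>E\<^esub> a) | v r. v \<in> U0 \<and> r \<in> carrier R}"
  have memU: "u \<in> ?U \<longleftrightarrow> (\<exists>v\<in>U0. \<exists>r\<in>carrier R. u = v \<oplus>\<^bsub>E\<^esub> r \<otimes>\<^bsub>E\<^esub> (e \<otimes>\<^bsub>E\<^esub> a))" for u
    by (auto simp: R_ops)
  have U0U: "u \<in> ?U" if "u \<in> U0" for u
  proof -
    have "\<zero> \<otimes>\<^bsub>E\<^esub> (e \<otimes>\<^bsub>E\<^esub> a) = \<zero>\<^bsub>E\<^esub>" using E_K[OF e] E_K[OF aE] by (simp add: R_ops)
    then have "u = u \<oplus>\<^bsub>E\<^esub> \<zero> \<otimes>\<^bsub>E\<^esub> (e \<otimes>\<^bsub>E\<^esub> a)" using E.r_zero[OF U0.Icarr[OF that]] by simp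
    then show ?thesis unfolding memU using that zero_closed by blast
  qed
  have "e \<otimes>\<^bsub>K\<^esub> b \<in> V"
  proof (rule multiplier_action[of ?U V e a b])
    show "submodule ?U R (regular_module R)"
      using reg.submodule_add_multiples[OF U0sub, of "e \<otimes>\<^bsub>E\<^esub> a"] ea by simp
    show "submodule V R (regular_module R)"
      using submodule_if_ideal_E[OF V(1)] V(2) ideals(4) by blast
    show "r \<otimes> f x \<in> ?U" if "r \<in> \<mm>" "x \<in> carrier M" for r x
      using U0U U0(3)[of r "f x"] max_subset_maximalideal[OF maxi] that by (auto simp: R_ops)
    show "r \<otimes> g y \<in> V" if "r \<in> \<mm>" "y \<in> carrier N" for r y
      using V(3)[of r "g y"] max_subset_maximalideal[OF maxi] that by (auto simp: R_ops)
    have "e \<otimes>\<^bsub>E\<^esub> a = \<zero>\<^bsub>E\<^esub> \<oplus>\<^bsub>E\<^esub> \<one> \<otimes>\<^bsub>E\<^esub> (e \<otimes>\<^bsub>E\<^esub> a)"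
      using E_K[OF e] E_K[OF aE] by (simp add: R_ops)
    then have "e \<otimes>\<^bsub>E\<^esub> a \<in> ?U" unfolding memU using U0.zero_closed one_closed by blast
    then show "e \<otimes>\<^bsub>K\<^esub> a \<in> ?U" by simp
    show "a \<notin> ?U"
    proof
      assume "a \<in> ?U"
      then obtain v r where v: "v \<in> U0" and r: "r \<in> carrier R" and eq: "a = v \<oplus>\<^bsub>E\<^esub> r \<otimes>\<^bsub>E\<^esub> (e \<otimes>\<^bsub>E\<^esub> a)"
        unfolding memU by blast
      have rE: "r \<in> carrier E" using r R_subset_E by blast
      let ?w = "\<one>\<^bsub>E\<^esub> \<ominus>\<^bsub>E\<^esub> r \<otimes>\<^bsub>E\<^esub> e"
      have w: "?w \<in> carrier E" using E.minus_closed[OF E.one_closed E.m_closed[OF rE e]] .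
      have "?w \<otimes>\<^bsub>E\<^esub> a = v"
      proof -
        have "?w \<otimes>\<^bsub>E\<^esub> a = a \<ominus>\<^bsub>E\<^esub> r \<otimes>\<^bsub>E\<^esub> (e \<otimes>\<^bsub>E\<^esub> a)"
          using rE e aE by (simp only: a_minus_def E.l_distr E.l_minus E.m_assoc E.l_one E.one_closed
              E.m_closed E.a_inv_closed)
        also have "\<dots> = v"
          using eq U0.Icarr[OF v] E.m_closed[OF rE E.m_closed[OF e aE]]
          by (metis a_minus_def E.a_assoc E.a_inv_closed E.r_neg E.r_zero)
        finally show ?thesis .
      qed
      \<comment> \<open>For \<open>r\<close> in \<open>\<mm>\<close>, \<open>r e\<close> lies in the
        maximal ideal of \<open>E\<close>, so \<open>1 - r e\<close> does not. For a unit
        \<open>r\<close> of \<open>R\<close>, \<open>1 - r e\<close> in the maximal ideal would give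
        \<open>e\<close> the residue class of the inverse of \<open>r\<close>.\<close>
      moreover have "?w \<notin> ?n"
      proof
        assume w_in: "?w \<in> ?n"
        show False
        proof (cases "r \<in> \<mm>")
          case True
          then have "r \<otimes>\<^bsub>E\<^esub> e \<in> ?n" using max_subset_maximalideal[OF maxi] n.I_r_closed e by blast
          then have "?w \<oplus>\<^bsub>E\<^esub> r \<otimes>\<^bsub>E\<^esub> e \<in> ?n" using w_in n.a_closed by blast
          moreover have "?w \<oplus>\<^bsub>E\<^esub> r \<otimes>\<^bsub>E\<^esub> e = \<one>\<^bsub>E\<^esub>"
            using rE e by (metis a_minus_def E.a_assoc E.a_inv_closed E.l_neg E.r_zero E.m_closed E.one_closed)
          ultimately show False using one by simp
        next
          case False
          then have ru: "r \<in> Units R" using nonmember_unit r by blast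
          then have i: "inv r \<in> carrier R" "inv r \<otimes> r = \<one>" by simp_all
          have iE: "inv r \<in> carrier E" using i(1) R_subset_E by blast
          have "e \<ominus>\<^bsub>E\<^esub> inv r = \<ominus>\<^bsub>E\<^esub> (inv r \<otimes>\<^bsub>E\<^esub> ?w)"
          proof -
            have "inv r \<otimes>\<^bsub>E\<^esub> ?w = inv r \<ominus>\<^bsub>E\<^esub> (inv r \<otimes>\<^bsub>E\<^esub> r) \<otimes>\<^bsub>E\<^esub> e"
              using iE rE e by (simp only: a_minus_def E.r_distr E.r_minus E.m_assoc E.r_one E.one_closed
                  E.m_closed E.a_inv_closed)
            also have "(inv r \<otimes>\<^bsub>E\<^esub> r) \<otimes>\<^bsub>E\<^esub> e = e" using i(2) e E.l_one by (simp add: R_ops)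
            finally show ?thesis using iE e
              by (simp only: a_minus_def E.minus_add E.minus_minus E.a_comm E.a_inv_closed)
          qed
          also have "\<dots> \<in> ?n" using n.I_l_closed[OF w_in iE] n.a_inv_closed by (simp add: a_inv_def)
          finally show False using no i(1) by blast
        qed
      qed
      ultimately show False using unit_cancel[OF U0(1) w _ aE] v a(2) by simp
    qed
  qed (use a(1) b(1) e in auto)
  then show False using unit_cancel[OF V(1) e e_notin bE] b(2) by simp
qed

end

section \<open>The map of residue fields\<close>

context balanced_pair
begin

text \<open>\<open>\<mm>\<close> lies in the maximal ideal of \<open>E\<close>, so the map is well
  defined; elements of \<open>R\<close> outside \<open>\<mm>\<close> are units, so the contraction
  of that ideal is \<open>\<mm>\<close> and the map is injective. Surjectivity is
  \<open>residue_field_surj\<close>.\<close>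

lemma residue_field_bij:
  "bij_betw (induced_residue_map R E (\<lambda>x. x)) (carrier (R Quot \<mm>)) (carrier (residue_field E))"
proof -
  let ?n = "max_ideal E"
  note maxi = max_ideal_maximal(1)[OF local_ring_E]
  interpret n: maximalideal ?n E by (rule maxi)
  have one: "\<one>\<^bsub>E\<^esub> \<notin> ?n" using n.one_imp_carrier n.I_notcarr by blast
  have coset_eq: "?n +>\<^bsub>E\<^esub> x = ?n +>\<^bsub>E\<^esub> y \<longleftrightarrow> x \<ominus>\<^bsub>E\<^esub> y \<in> ?n" if "x \<in> carrier E" "y \<in> carrier E" for x y
    using E.quotient_eq_iff_same_a_r_cos[OF n.is_ideal that] by blast
  have RE: "x \<in> carrier E" if "x \<in> carrier R" for x using that R_subset_E by blast
  have nm: "x \<in> \<mm>" if "x \<in> ?n" "x \<in> carrier R" for x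
  proof (rule ccontr)
    assume "x \<notin> \<mm>"
    then have x: "x \<in> Units R" using nonmember_unit that(2) by blast
    have "inv x \<otimes>\<^bsub>E\<^esub> x \<in> ?n" using n.I_l_closed[OF that(1) RE[OF Units_inv_closed[OF x]]] .
    moreover have "inv x \<otimes>\<^bsub>E\<^esub> x = \<one>\<^bsub>E\<^esub>" using Units_l_inv[OF x] by (simp add: R_ops)
    ultimately show False using one by simp
  qed
  have minus: "x \<ominus> y = x \<ominus>\<^bsub>E\<^esub> y" if "x \<in> carrier R" "y \<in> carrier R" for x y
  proof -
    have "\<ominus> y = \<ominus>\<^bsub>E\<^esub> y"
      by (rule minus_equality) (use that E_uminus[OF RE] R_closed(3) R_K in \<open>auto simp: R_ops K.l_neg\<close>)
    then show ?thesis by (simp add: a_minus_def R_ops)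
  qed
  \<comment> \<open>The defining union runs over a coset of \<open>\<mm>\<close>, all of whose
    elements have the same class in the residue field of \<open>E\<close>.\<close>
  have val: "induced_residue_map R E (\<lambda>x. x) (\<mm> +> x) = ?n +>\<^bsub>E\<^esub> x" if x: "x \<in> carrier R" for x
  proof -
    have "?n +>\<^bsub>E\<^esub> y = ?n +>\<^bsub>E\<^esub> x" if y: "y \<in> \<mm> +> x" for y
    proof -
      obtain h where h: "h \<in> \<mm>" "y = h \<oplus> x" using y by (auto simp: a_r_coset_def r_coset_def)
      have hE: "h \<in> carrier E" using RE max.Icarr h(1) by blast
      have "y = h \<oplus>\<^bsub>E\<^esub> x" using h(2) by (simp add: R_ops)
      then have "y \<ominus>\<^bsub>E\<^esub> x = h"
        using hE RE[OF x] by (metis a_minus_def E.a_assoc E.a_inv_closed E.r_neg E.r_zero)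
      moreover have "y \<in> carrier E" using h(2) max.Icarr[OF h(1)] x RE by simp
      ultimately show ?thesis using coset_eq RE[OF x] h(1) max_subset_maximalideal[OF maxi] by blast
    qed
    moreover have "x \<in> \<mm> +> x" by (rule max.a_rcos_self[OF x])
    ultimately show ?thesis unfolding induced_residue_map_def by blast
  qed
  have carR: "carrier (R Quot \<mm>) = (+>) \<mm> ` carrier R"
    by (auto simp: FactRing_def A_RCOSETS_def')
  have carE: "carrier (residue_field E) = (\<lambda>x. ?n +>\<^bsub>E\<^esub> x) ` carrier E"
    by (auto simp: residue_field_def FactRing_def A_RCOSETS_def')
  show ?thesis
  proof (rule bij_betw_imageI)
    show "inj_on (induced_residue_map R E (\<lambda>x. x)) (carrier (R Quot \<mm>))"
    proof (rule inj_onI)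
      fix c d assume "c \<in> carrier (R Quot \<mm>)" "d \<in> carrier (R Quot \<mm>)"
        and eq: "induced_residue_map R E (\<lambda>x. x) c = induced_residue_map R E (\<lambda>x. x) d"
      then obtain x y where x: "x \<in> carrier R" "c = \<mm> +> x" and y: "y \<in> carrier R" "d = \<mm> +> y"
        unfolding carR by blast
      have "x \<ominus>\<^bsub>E\<^esub> y \<in> ?n" using eq val x y coset_eq RE by simp
      then have "x \<ominus> y \<in> \<mm>" using nm minus[OF x(1) y(1)] x(1) y(1) minus_closed by metis
      then show "c = d" using residue_eq_iff x y by simp
    qed
    show "induced_residue_map R E (\<lambda>x. x) ` carrier (R Quot \<mm>) = carrier (residue_field E)"
    proof (intro equalityI subsetI)
      fix Z assume "Z \<in> induced_residue_map R E (\<lambda>x. x) ` carrier (R Quot \<mm>)"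
      then show "Z \<in> carrier (residue_field E)" unfolding carR carE using val RE by auto
    next
      fix Z assume "Z \<in> carrier (residue_field E)"
      then obtain e where e: "e \<in> carrier E" "Z = ?n +>\<^bsub>E\<^esub> e" unfolding carE by blast
      obtain r where r: "r \<in> carrier R" "e \<ominus>\<^bsub>E\<^esub> r \<in> ?n" using residue_field_surj[OF e(1)] by blast
      have "Z = induced_residue_map R E (\<lambda>x. x) (\<mm> +> r)"
        using coset_eq[OF e(1) RE[OF r(1)]] r val e(2) by simp
      then show "Z \<in> induced_residue_map R E (\<lambda>x. x) ` carrier (R Quot \<mm>)" unfolding carR using r(1) by blast
    qed
  qed
qed

end

theorem theorem2p3:
  fixes R K E :: "('a, 'b) ring_scheme"
    and M :: "('a, 'm, 'x) module_scheme"
    and N :: "('a, 'n, 'y) module_scheme"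
  assumes "domain R"
    and "gorenstein_local_ring TYPE('i) R"
    and "krull_dim R = 1"
    and "quotient_field R K"
    and "E = multiplier_ring K (max_ideal R)"
    and "module R M" and "finitely_generated R M" and "\<not> free_module R M"
    and "module R N" and "finitely_generated R N" and "\<not> free_module R N"
    and "torsion_free R (tensor_product R M N)"
  shows "carrier R \<subseteq> carrier E \<and> carrier E \<subseteq> integral_closure R K \<and>
    local_ring E \<and>
    bij_betw (induced_residue_map R E (\<lambda>x. x))
      (carrier (residue_field R)) (carrier (residue_field E))"
proof -
  let ?m = "max_ideal R"
  have loc: "local_ring R" using assms(2) by (simp add: gorenstein_local_ring_def)
  interpret one_dim_local_domain R ?m by (rule krull_dim_one_local_domain[OF assms(1) loc assms(3)])
  obtain S T where S: "finite S" "generated_by R M S" and T: "finite T" "generated_by R N T"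
    by (rule finitely_generated_generators[OF assms(6,7)], rule finitely_generated_generators[OF assms(9,10)])
  \<comment> \<open>Here the hypothesis that neither module is free is spent: the summands are
    nonzero and all their forms have values in the maximal ideal.\<close>
  obtain U \<pi> S' where U: "submodule U R M" "\<pi> \<in> module_hom R M (M\<lparr>carrier := U\<rparr>)" "\<forall>u\<in>U. \<pi> u = u"
    and S': "finite S'" "generated_by R (M\<lparr>carrier := U\<rparr>) S'" "U \<noteq> {\<zero>\<^bsub>M\<^esub>}"
      "\<forall>f\<in>module_hom R (M\<lparr>carrier := U\<rparr>) (regular_module R). \<forall>u\<in>U. f u \<in> ?m"
    using exists_summand_with_forms_in_max[OF assms(6) S assms(8)] by (elim exE conjE)
  obtain V \<tau> T' where V: "submodule V R N" "\<tau> \<in> module_hom R N (N\<lparr>carrier := V\<rparr>)" "\<forall>v\<in>V. \<tau> v = v"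
    and T': "finite T'" "generated_by R (N\<lparr>carrier := V\<rparr>) T'" "V \<noteq> {\<zero>\<^bsub>N\<^esub>}"
      "\<forall>f\<in>module_hom R (N\<lparr>carrier := V\<rparr>) (regular_module R). \<forall>v\<in>V. f v \<in> ?m"
    using exists_summand_with_forms_in_max[OF assms(9) T assms(11)] by (elim exE conjE)
  let ?M = "M\<lparr>carrier := U\<rparr>" and ?N = "N\<lparr>carrier := V\<rparr>"
  have M': "module R ?M" by (rule module.submodule_module[OF assms(6) U(1)])
  have N': "module R ?N" by (rule module.submodule_module[OF assms(9) V(1)])
  \<comment> \<open>Torsion-freeness is used for the tensor product of \<open>M\<close> and
    \<open>N\<close> themselves; the balancing identity then passes to the summands.\<close>
  have bal: "fractions_balanced ?M ?N"
    using fractions_balanced_summands[OF torsion_free_tensor_balanced[OF assms(6,9,12)] assms(6,9) U V] .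
  obtain A B :: "('a, 'i) module" and \<epsilon> \<delta> where gor: "one_dim_gorenstein_domain R ?m A B \<epsilon> \<delta>"
    by (rule gorenstein_one_dim[OF assms(2)])
  have K: "field K" "subring (carrier R) K" "R = K\<lparr>carrier := carrier R\<rparr>"
    using assms(4) by (auto simp: quotient_field_def)
  have mult: "gorenstein_multipliers R K ?m A B \<epsilon> \<delta>"
    by (intro gorenstein_multipliers.intro gor max_multipliers.intro max_multipliers_axioms.intro K
        one_dim_local_domain_axioms)
  interpret gorenstein_multipliers R K ?m A B \<epsilon> \<delta> by (rule mult)
  have E': "local.E = E" by (simp add: local.E_def assms(5))
  have nz: "carrier ?M \<noteq> {\<zero>\<^bsub>?M\<^esub>}" "carrier ?N \<noteq> {\<zero>\<^bsub>?N\<^esub>}" using S'(3) T'(3) by simp_all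
  obtain f x where f: "f \<in> module_hom R ?M (regular_module R)" "x \<in> carrier ?M" "f x \<noteq> \<zero>\<^bsub>R\<^esub>"
    by (rule exists_nonzero_form[OF M' S'(1,2) nz(1) N' T'(1,2) nz(2) bal])
  \<comment> \<open>The same argument with the two modules exchanged, hence the symmetric form of
    the balancing.\<close>
  obtain g y where g: "g \<in> module_hom R ?N (regular_module R)" "y \<in> carrier ?N" "g y \<noteq> \<zero>\<^bsub>R\<^esub>"
    by (rule exists_nonzero_form[OF N' T'(1,2) nz(2) M' S'(1,2) nz(1) fractions_balanced_sym[OF M' N' bal]])
  have "f ` carrier ?M \<noteq> {\<zero>\<^bsub>local.E\<^esub>}" "g ` carrier ?N \<noteq> {\<zero>\<^bsub>local.E\<^esub>}"
    using imageI[OF f(2), of f] f(3) imageI[OF g(2), of g] g(3) R_ops(3) E_ops(3) by (metis singletonD)+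
  then have pair: "balanced_pair R K ?m A B \<epsilon> \<delta> ?M ?N S' T' f g"
    using M' N' S' T' bal f(1) g(1)
    by (intro balanced_pair.intro mult balanced_pair_axioms.intro) simp_all
  interpret pair: balanced_pair R K ?m A B \<epsilon> \<delta> ?M ?N S' T' f g by (rule pair)
  show ?thesis
    using R_subset_E E_subset_integral_closure pair.local_ring_E pair.residue_field_bij
    unfolding E' residue_field_def[of R] by blast
qed

end
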